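(* Let $\lambda_{BS}>0$, $p\in(0,1]$, $P_{macro}>0$, $P_{micro}\ge0$, $\beta>2$, $\lambda_{SU}>0$. Let $\Phi_{macro},\Phi_{micro}$ be independent homogeneous Poisson point processes on $\mathbb{R}^2$ of intensities $p\lambda_{BS}$ and $(1-p)\lambda_{BS}$, and $\mathcal{U}_{static}$ an independent homogeneous Poisson point process of intensity $\lambda_{SU}$. Let $X^*$ be the point of $\Phi_{macro}$ closest to the origin and $\overline N_{SU,macro}=\mathbf{E}[|\mathcal{U}_{static}(V_{het}(X^* ))|]$. Then $$\overline N_{SU,macro}\le\frac{1.2802\,\lambda_{SU}}{\lambda_{BS}p}.$$
   Context: With $\Phi=\Phi_{macro}\cup\Phi_{micro}$ and $P_i=P_{macro}$ for macro stations, $P_i=P_{micro}$ for micro stations, the hetnet cell $V_{het}(X_i)$ of a station $X_i\in\Phi$ is the set of $z\in\mathbb{R}^2$ with $P_i|X_i-z|^{-\beta}\ge P_j|X_j-z|^{-\beta}$ for all $X_j\in\Phi$. $|\mathcal{U}_{static}(B)|$ is the number of static users in $B$. *)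

theory Defs
  imports "HOL-Probability.Probability"
begin

type_synonym point = "real ^ 2"

definition poisson_pp :: "'w measure \<Rightarrow> real \<Rightarrow> ('w \<Rightarrow> point set) \<Rightarrow> bool" where
  "poisson_pp M lam Phi \<longleftrightarrow>
     prob_space M \<and> lam \<ge> 0 \<and>
     (\<forall>B. B \<in> sets borel \<and> bounded B \<longrightarrow>
        (AE \<omega> in M. finite (Phi \<omega> \<inter> B)) \<and>
        (\<forall>k::nat. {\<omega> \<in> space M. card (Phi \<omega> \<inter> B) = k} \<in> sets M \<and>
           measure M {\<omega> \<in> space M. card (Phi \<omega> \<inter> B) = k}
             = (lam * measure lborel B) ^ k * exp (- (lam * measure lborel B)) / fact k)) \<and>
     (\<forall>(I::nat set) B. finite I \<and> disjoint_family_on B I \<and>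
        (\<forall>i\<in>I. B i \<in> sets borel \<and> bounded (B i)) \<longrightarrow>
        prob_space.indep_vars M (\<lambda>_. count_space UNIV) (\<lambda>i \<omega>. card (Phi \<omega> \<inter> B i)) I)"

definition proc_events :: "'w measure \<Rightarrow> ('w \<Rightarrow> point set) \<Rightarrow> 'w set set" where
  "proc_events M Phi = {{\<omega> \<in> space M. card (Phi \<omega> \<inter> B) = k} | B k.
                          B \<in> sets borel \<and> bounded B}"

definition indep_processes :: "'w measure \<Rightarrow> ('i \<Rightarrow> 'w \<Rightarrow> point set) \<Rightarrow> 'i set \<Rightarrow> bool" where
  "indep_processes M Psi I \<longleftrightarrow>
     prob_space.indep_sets M (\<lambda>i. sigma_sets (space M) (proc_events M (Psi i))) I"

definition rx_power :: "real \<Rightarrow> real \<Rightarrow> point \<Rightarrow> point \<Rightarrow> ereal" where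
  "rx_power P beta X z =
     (if X = z then (if P > 0 then \<infinity> else 0) else ereal (P * dist X z powr (- beta)))"

definition het_cell :: "point set \<Rightarrow> (point \<Rightarrow> real) \<Rightarrow> real \<Rightarrow> point \<Rightarrow> point set" where
  "het_cell Phi P beta X = {z. \<forall>Y\<in>Phi. rx_power (P Y) beta Y z \<le> rx_power (P X) beta X z}"

definition nearest_to_origin :: "point set \<Rightarrow> point" where
  "nearest_to_origin S = (SOME x. x \<in> S \<and> (\<forall>y\<in>S. norm x \<le> norm y))"

definition ecount :: "point set \<Rightarrow> ennreal" where
  "ecount S = (if finite S then of_nat (card S) else \<infinity>)"

end

theory Submission
  imports Defs
begin

text \<open>
  A user at \<open>z\<close> served by \<open>X\<close>, the macro station nearest to the origin, is at least as close to \<open>X\<close> as to any other macro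
  station. Hence no macro station lies in the two discs around \<open>0\<close> and \<open>z\<close> that have \<open>X\<close> on their boundary. Partitioning the plane
  into a mesh, and letting its width tend to \<open>0\<close>, bounds the mean number of users by
  \<open>\<lambda>\<^bsub>SU\<^esub> \<lambda> \<integral>\<integral> exp (- \<lambda> |B(0, |x|) \<union> B(z, |x - z|)|) dx dz\<close> with \<open>\<lambda> = p \<lambda>\<^bsub>BS\<^esub>\<close>; only void probabilities are needed for this.

  With \<open>x\<close> as the origin and the centre of the first disc as the complex unit, scaling turns the double integral into
  \<open>(\<pi> / \<lambda>\<^sup>2) \<integral> dw / A(w)\<^sup>2\<close>, where \<open>A(w)\<close> is the area of \<open>B(1, 1) \<union> B(w, |w|)\<close>. Cutting the union along a ray from the origin, which
  lies on both circles, gives \<open>A(\<surd>s cis (\<plusminus> \<pi> u)) \<ge> \<pi> (\<kappa>(v) + s \<kappa>(u - v))\<close> for every \<open>v\<close>, with equality for the ray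
  through the second point of intersection. So it remains to integrate \<open>1 / max\<^sub>v (\<kappa>(v) + s \<kappa>(u - v))\<^sup>2\<close> over \<open>0 \<le> s, u \<le> 1\<close>; the rest of
  the plane follows by \<open>s \<mapsto> 1 / s\<close> and reflection. This integral is \<open>0.640088\<dots>\<close>, and it is bounded by \<open>0.6401\<close> on an adaptive
  partition into rectangles with a suitable \<open>v\<close> on each of them: the integral over \<open>s\<close> is then elementary, and the one over \<open>u\<close>
  is estimated by Simpson's rule, all in integer arithmetic. In total \<open>2 \<cdot> 0.6401 = 1.2802\<close>.
\<close>

subsection \<open>Simpson's rule\<close>

text \<open>The constant leaves hardly any room. With macro stations alone, the cell of the station
  nearest to the origin is the Voronoi cell that contains the origin, and \<open>\<lambda>\<close>
  times its mean area is the normalised second moment \<open>1.28017...\<close> of a Poisson Voronoi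
  cell. So the certificate may lose only about \<open>1.2 * 10^-5\<close> of
  \<open>0.640088...\<close>. Two facts make this affordable: a cut that misses the best one by
  \<open>\<delta>\<close> costs only \<open>O(\<delta>^2)\<close>, because the best cut is a
  maximum, so cuts linear in \<open>u\<close> on moderate rectangles suffice; and these cuts do not
  depend on \<open>s\<close>, so that only the integral over \<open>u\<close> has to be
  approximated, by a rule of high order. On the probabilistic side, the integrand of the expectation
  involves a chosen nearest point and a random cell, whereas the processes are known through counts
  in bounded Borel sets. The mesh stands in for a Palm or Mecke formula: it covers every
  configuration by countably many events about such counts, and the limit of vanishing width is
  taken on deterministic integrals only.\<close>

lemma simpson_upper:
  fixes f f1 f2 f3 f4 :: "real \<Rightarrow> real"
  assumes "0 < k"
    and cont: "continuous_on {-k..k} f"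
    and f1: "\<And>t. -k < t \<Longrightarrow> t < k \<Longrightarrow> (f has_real_derivative f1 t) (at t)"
    and f2: "\<And>t. -k < t \<Longrightarrow> t < k \<Longrightarrow> (f1 has_real_derivative f2 t) (at t)"
    and f3: "\<And>t. -k < t \<Longrightarrow> t < k \<Longrightarrow> (f2 has_real_derivative f3 t) (at t)"
    and f4: "\<And>t. -k < t \<Longrightarrow> t < k \<Longrightarrow> (f3 has_real_derivative f4 t) (at t)"
    and M: "\<And>t. -k < t \<Longrightarrow> t < k \<Longrightarrow> - M \<le> f4 t"
  shows "integral {-k..k} f \<le> k / 3 * (f (-k) + 4 * f 0 + f k) + M * k ^ 5 / 90"
proof -
  define F where "F t = integral {-k..t} f" for t
  have F: "(F has_real_derivative f t) (at t)" if "-k < t" "t < k" for t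
    using integral_has_real_derivative[OF cont, of t] that
    by (auto simp: F_def[abs_def] at_within_Icc_at)
  have contF: "continuous_on {-k..k} F"
    unfolding F_def by (intro indefinite_integral_continuous_1 integrable_continuous_real cont)
  have mirror: "((\<lambda>s. g (- s)) has_real_derivative - g' (- t)) (at t)"
    if "-k < t" "t < k" "\<And>t. -k < t \<Longrightarrow> t < k \<Longrightarrow> (g has_real_derivative g' t) (at t)" for g g' t
    using DERIV_chain2[of g "g' (-t)" uminus t "-1"] that(1,2) that(3)[of "-t"]
      DERIV_minus[OF DERIV_ident, of t UNIV] by auto
  note d = derivative_eq_intros mirror[OF _ _ F] mirror[OF _ _ f1] mirror[OF _ _ f2] mirror[OF _ _ f3]
    mirror[OF _ _ f4] F f1 f2 f3 f4
  \<comment> \<open>The error of Simpson's rule on \<open>{-h..h}\<close>, less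
    \<open>M * h ^ 5 / 90\<close>, is the function \<open>G0\<close> below. Its derivative in
    \<open>h\<close> is \<open>G1\<close>, that of \<open>G1\<close> is \<open>G2\<close>, that of
    \<open>G2\<close> is \<open>- (h / 3) * G3\<close>, and all four vanish at \<open>0\<close>. The
    bound on \<open>f4\<close> makes \<open>G3\<close> increase; going back up the chain yields the
    sign of \<open>G0\<close>.\<close>
  define G3 where "G3 h = f3 h - f3 (-h) + 2 * M * h" for h
  have G3: "G3 0 \<le> G3 h" if "0 \<le> h" "h < k" for h
  proof (rule DERIV_nonneg_imp_nondecreasing[OF that(1)])
    fix x assume x: "0 \<le> x" "x \<le> h"
    have "(G3 has_real_derivative f4 x + f4 (-x) + 2 * M) (at x)"
      unfolding G3_def using x that by (auto intro!: d)
    moreover have "0 \<le> f4 x + f4 (-x) + 2 * M" using M[of x] M[of "-x"] x that by auto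
    ultimately show "\<exists>y. (G3 has_real_derivative y) (at x) \<and> 0 \<le> y" by blast
  qed
  define G2 where "G2 h = (f1 h - f1 (-h)) / 3 - h / 3 * (f2 h + f2 (-h)) - 2 * M * h ^ 3 / 9" for h
  have G2: "G2 0 \<ge> G2 h" if "0 \<le> h" "h < k" for h
  proof (rule DERIV_nonpos_imp_nonincreasing[OF that(1)])
    fix x assume x: "0 \<le> x" "x \<le> h"
    have "(G2 has_real_derivative - (x / 3) * G3 x) (at x)"
      unfolding G2_def G3_def using x that
      by (auto intro!: d simp: field_simps power2_eq_square)
    moreover have "- (x / 3) * G3 x \<le> 0" using G3[of x] x that by (auto simp: G3_def)
    ultimately show "\<exists>y. (G2 has_real_derivative y) (at x) \<and> y \<le> 0" by blast
  qed
  define G1 where "G1 h = f h + f (-h) - (f h + f (-h) + 4 * f 0) / 3 - h / 3 * (f1 h - f1 (-h)) - M * h ^ 4 / 18" for h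
  have G1: "G1 0 \<ge> G1 h" if "0 \<le> h" "h < k" for h
  proof (rule DERIV_nonpos_imp_nonincreasing[OF that(1)])
    fix x assume x: "0 \<le> x" "x \<le> h"
    have "(G1 has_real_derivative G2 x) (at x)"
      unfolding G1_def G2_def using x that
      by (auto intro!: d simp: field_simps)
    moreover have "G2 x \<le> 0" using G2[of x] x that by (auto simp: G2_def)
    ultimately show "\<exists>y. (G1 has_real_derivative y) (at x) \<and> y \<le> 0" by blast
  qed
  define G0 where "G0 h = F h - F (-h) - h / 3 * (f h + f (-h) + 4 * f 0) - M * h ^ 5 / 90" for h
  \<comment> \<open>The derivatives exist only inside the interval, so the end point
    \<open>k\<close> is reached by continuity.\<close>
  have "G0 0 \<ge> G0 k"
  proof (rule DERIV_nonpos_imp_decreasing_open[of 0 k G0])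
    show "0 \<le> k" using assms by simp
  next
    fix x assume x: "0 < x" "x < k"
    have "(G0 has_real_derivative G1 x) (at x)"
      unfolding G0_def G1_def using x
      by (auto intro!: d simp: field_simps)
    moreover have "G1 x \<le> 0" using G1[of x] x by (auto simp: G1_def)
    ultimately show "\<exists>y. (G0 has_real_derivative y) (at x) \<and> y \<le> 0" by blast
  next
    have "continuous_on {0..k} F" "continuous_on {0..k} f"
      by (auto intro: continuous_on_subset contF cont)
    moreover have "continuous_on {0..k} (\<lambda>x. g (-x))" if "continuous_on {-k..k} g" for g :: "real \<Rightarrow> real"
      using continuous_on_compose2[OF that continuous_on_minus[OF continuous_on_id], of "{0..k}"] by auto
    ultimately show "continuous_on {0..k} G0"
      unfolding G0_def using contF cont by (intro continuous_intros) auto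
  qed
  then show ?thesis by (simp add: G0_def F_def field_simps)
qed

text \<open>\<open>\<pi> \<kappa>(v)\<close> is the area of the part of a unit disc on one side of a line through a point of its circle,
  where \<open>\<pi> v\<close> is the signed angle from the centre, seen from that point, to the line.\<close>
definition kappa :: "real \<Rightarrow> real" where
  "kappa v = v + 1 / 2 + sin (2 * pi * v) / (2 * pi)"

text \<open>\<open>ph\<close> is the bound given by a cut that moves linearly with the angle. All
  its derivatives are combinations of sines and cosines with weights \<open>r ^ n\<close> and
  \<open>s * (1 - r) ^ n\<close>, hence at most a constant times \<open>r + s * (1 - r)\<close>;
  this factor survives in the error term. The best cut gives at least
  \<open>kappa (1 / 2) = 1\<close>, and \<open>31 / 32\<close> leaves room for one that is only
  nearly best.\<close>

lemma line_simpson: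
  fixes v x r s k :: real
  defines "ph \<equiv> \<lambda>t. kappa (v + r * t) + s * kappa (x + (1 - r) * t)"
  assumes k: "0 < k" and r: "0 \<le> r" "r \<le> 1" and s: "0 \<le> s" "s \<le> 1" and lb: "31 / 32 \<le> ph (- k)"
  shows "integral {-k..k} (\<lambda>t. 1 / (ph t)\<^sup>2)
    \<le> k / 3 * (1 / (ph (-k))\<^sup>2 + 4 / (ph 0)\<^sup>2 + 1 / (ph k)\<^sup>2) + 82 * (r + s * (1 - r)) * k ^ 5"
proof -
  define q where "q = 1 - r"
  have q: "0 \<le> q" "q \<le> 1" using r by (auto simp: q_def)
  define b where "b = r + s * q"
  have b: "0 \<le> b" "b \<le> 1"
    using r s q mult_right_mono[OF s(2) q(1)] by (auto simp: b_def q_def)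
  define A where "A t = 2 * pi * (v + r * t)" for t
  define C where "C t = 2 * pi * (x + q * t)" for t
  define p1 where "p1 t = r * (1 + cos (A t)) + s * q * (1 + cos (C t))" for t
  define p2 where "p2 t = - (2 * pi) * (r\<^sup>2 * sin (A t) + s * q\<^sup>2 * sin (C t))" for t
  define p3 where "p3 t = - (2 * pi)\<^sup>2 * (r ^ 3 * cos (A t) + s * q ^ 3 * cos (C t))" for t
  define p4 where "p4 t = (2 * pi) ^ 3 * (r ^ 4 * sin (A t) + s * q ^ 4 * sin (C t))" for t
  have dA: "(A has_real_derivative 2 * pi * r) (at t)" for t
    unfolding A_def by (auto intro!: derivative_eq_intros)
  have dC: "(C has_real_derivative 2 * pi * q) (at t)" for t
    unfolding C_def by (auto intro!: derivative_eq_intros)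
  have ph_eq: "ph = (\<lambda>t. v + r * t + 1 / 2 + sin (A t) / (2 * pi) + s * (x + q * t + 1 / 2 + sin (C t) / (2 * pi)))"
    by (simp add: ph_def kappa_def A_def C_def q_def fun_eq_iff)
  have d0: "(ph has_real_derivative p1 t) (at t)" for t
    unfolding ph_eq p1_def by (auto intro!: derivative_eq_intros dA dC simp: field_simps)
  have d1: "(p1 has_real_derivative p2 t) (at t)" for t
    unfolding p1_def p2_def by (auto intro!: derivative_eq_intros dA dC simp: field_simps power2_eq_square)
  have d2: "(p2 has_real_derivative p3 t) (at t)" for t
    unfolding p2_def p3_def
    by (auto intro!: derivative_eq_intros dA dC simp: field_simps power2_eq_square power3_eq_cube)
  have d3: "(p3 has_real_derivative p4 t) (at t)" for t
    unfolding p3_def p4_def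
    by (auto intro!: derivative_eq_intros dA dC simp: field_simps power2_eq_square power3_eq_cube power4_eq_xxxx)
  have p1_nonneg: "0 \<le> p1 t" for t
  proof -
    have "0 \<le> 1 + cos (A t)" "0 \<le> 1 + cos (C t)"
      using cos_ge_minus_one[of "A t"] cos_ge_minus_one[of "C t"] by linarith+
    then show ?thesis unfolding p1_def using r s q by simp
  qed
  have lb': "31 / 32 \<le> ph t" if "-k \<le> t" for t
    using DERIV_nonneg_imp_nondecreasing[OF that, of ph] d0 p1_nonneg lb by fastforce
  define w where "w t = inverse (ph t)" for t
  have w: "0 \<le> w t" "w t \<le> 32 / 31" if "-k \<le> t" for t
    using lb'[OF that] by (auto simp: w_def field_simps)
  have dw: "(w has_real_derivative - p1 t * (w t)\<^sup>2) (at t)" if "-k < t" for t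
    unfolding w_def using lb'[of t] that
    by (auto intro!: derivative_eq_intros d0 simp: power2_eq_square)
  \<comment> \<open>\<open>7380 = 82 * 90\<close>. The estimates below need
    \<open>144 * 30 + 24 * 90 + 2 * 274 = 7028\<close>, so this is rounded up.\<close>
  define M where "M = 7380 * b"
  have "integral {-k..k} (\<lambda>t. (w t)\<^sup>2)
    \<le> k / 3 * ((w (-k))\<^sup>2 + 4 * (w 0)\<^sup>2 + (w k)\<^sup>2) + M * k ^ 5 / 90"
  proof (rule simpson_upper)
    have "continuous_on {-k..k} ph" using d0 by (meson DERIV_continuous_on DERIV_subset subset_UNIV)
    moreover have "\<forall>t\<in>{-k..k}. ph t \<noteq> 0" using lb' by fastforce
    ultimately show "continuous_on {-k..k} (\<lambda>t. (w t)\<^sup>2)"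
      unfolding w_def by (intro continuous_intros) auto
  next
    fix t assume t: "-k < t" "t < k"
    show "((\<lambda>t. (w t)\<^sup>2) has_real_derivative - 2 * p1 t * w t ^ 3) (at t)"
      using t by (auto intro!: derivative_eq_intros dw simp: power2_eq_square power3_eq_cube)
    show "((\<lambda>t. - 2 * p1 t * w t ^ 3) has_real_derivative 6 * (p1 t)\<^sup>2 * w t ^ 4 - 2 * p2 t * w t ^ 3) (at t)"
      using t by (auto intro!: derivative_eq_intros dw d1 simp: algebra_simps eval_nat_numeral)
    show "((\<lambda>t. 6 * (p1 t)\<^sup>2 * w t ^ 4 - 2 * p2 t * w t ^ 3) has_real_derivative
        - 24 * p1 t ^ 3 * w t ^ 5 + 18 * p1 t * p2 t * w t ^ 4 - 2 * p3 t * w t ^ 3) (at t)"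
      using t by (auto intro!: derivative_eq_intros dw d1 d2 simp: algebra_simps eval_nat_numeral)
    show "((\<lambda>t. - 24 * p1 t ^ 3 * w t ^ 5 + 18 * p1 t * p2 t * w t ^ 4 - 2 * p3 t * w t ^ 3) has_real_derivative
        120 * p1 t ^ 4 * w t ^ 6 - 144 * (p1 t)\<^sup>2 * p2 t * w t ^ 5
        + (18 * (p2 t)\<^sup>2 + 24 * p1 t * p3 t) * w t ^ 4 - 2 * p4 t * w t ^ 3) (at t)"
      using t by (auto intro!: derivative_eq_intros dw d1 d2 d3 simp: algebra_simps eval_nat_numeral)
    have rs: "r ^ n + s * q ^ n \<le> b" if "0 < n" for n
      using power_le_one_iff[of r n] power_decreasing[of 1 n r] power_decreasing[of 1 n q] r q s that
      by (auto simp: b_def intro!: add_mono mult_left_mono)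
    have trig: "\<bar>r ^ n * a + s * q ^ n * c\<bar> \<le> b" if "0 < n" "\<bar>a\<bar> \<le> 1" "\<bar>c\<bar> \<le> 1" for n and a c :: real
    proof -
      have "\<bar>r ^ n * a + s * q ^ n * c\<bar> \<le> r ^ n * \<bar>a\<bar> + s * q ^ n * \<bar>c\<bar>"
        using r s q abs_triangle_ineq[of "r ^ n * a" "s * q ^ n * c"] by (simp add: abs_mult)
      also have "\<dots> \<le> r ^ n * 1 + s * q ^ n * 1"
        using that r s q by (intro add_mono mult_left_mono) auto
      also have "\<dots> \<le> b" using rs[OF that(1)] by simp
      finally show ?thesis .
    qed
    have P1: "p1 t \<le> 2 * b"
    proof -
      have "p1 t = b + (r * cos (A t) + s * q * cos (C t))" by (simp add: p1_def b_def algebra_simps)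
      also have "\<dots> \<le> b + b" using trig[of 1 "cos (A t)" "cos (C t)"] by simp
      finally show ?thesis by simp
    qed
    have pi2: "(2 * pi)\<^sup>2 \<le> 39.5" "(2 * pi) ^ 3 \<le> 248.2" "2 * pi \<le> 6.2832"
    proof -
      show a: "2 * pi \<le> 6.2832" using pi_approx by simp
      show "(2 * pi)\<^sup>2 \<le> 39.5"
        using power_mono[OF a, of 2] by (auto simp: power2_eq_square)
      show "(2 * pi) ^ 3 \<le> 248.2"
        using power_mono[OF a, of 3] by (auto simp: power3_eq_cube)
    qed
    have P2: "\<bar>p2 t\<bar> \<le> 6.2832 * b"
      using mult_mono[OF pi2(3) trig[of 2 "sin (A t)" "sin (C t)"]] by (simp add: p2_def abs_mult)
    have P3: "\<bar>p3 t\<bar> \<le> 39.5 * b"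
      using mult_mono[OF pi2(1) trig[of 3 "cos (A t)" "cos (C t)"]] by (simp add: p3_def abs_mult)
    have P4: "\<bar>p4 t\<bar> \<le> 248.2 * b"
      using mult_mono[OF pi2(2) trig[of 4 "sin (A t)" "sin (C t)"]] by (simp add: p4_def abs_mult)
    have W: "0 \<le> w t" "w t \<le> 32 / 31" using w[of t] t by auto
    have W3: "w t ^ 3 \<le> 1.1001" and W4: "w t ^ 4 \<le> 1.1356" and W5: "w t ^ 5 \<le> 1.1722"
      using power_mono[OF W(2,1), of 3] power_mono[OF W(2,1), of 4] power_mono[OF W(2,1), of 5]
      by (auto simp: eval_nat_numeral)
    \<comment> \<open>Products of two or three derivatives carry \<open>b * b\<close> or
      \<open>b * b * b\<close>; as \<open>b \<le> 1\<close>, the bound stays proportional to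
      \<open>b\<close>.\<close>
    have bb: "b * b \<le> b" "b * b * b \<le> b"
      using b mult_left_mono[of b 1 b] mult_left_mono[of "b * b" 1 b] by (auto simp: mult_le_one)
    have "(p1 t)\<^sup>2 * p2 t * w t ^ 5 \<le> (p1 t)\<^sup>2 * \<bar>p2 t\<bar> * w t ^ 5"
      using W by (intro mult_right_mono mult_left_mono) auto
    also have "\<dots> \<le> (2 * b)\<^sup>2 * (6.2832 * b) * 1.1722"
      using P1 P2 W5 W p1_nonneg b by (intro mult_mono power_mono) auto
    also have "\<dots> \<le> 30 * b" using bb b(1) by (simp add: power2_eq_square)
    finally have T1: "(p1 t)\<^sup>2 * p2 t * w t ^ 5 \<le> 30 * b" .
    have "- (p1 t * p3 t * w t ^ 4) = p1 t * - p3 t * w t ^ 4" by simp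
    also have "\<dots> \<le> p1 t * \<bar>p3 t\<bar> * w t ^ 4"
      using W p1_nonneg[of t] by (intro mult_right_mono mult_left_mono) auto
    also have "\<dots> \<le> (2 * b) * (39.5 * b) * 1.1356"
      using P1 P3 W4 W p1_nonneg b by (intro mult_mono) auto
    also have "\<dots> \<le> 90 * b" using bb b(1) by simp
    finally have T2: "- (p1 t * p3 t * w t ^ 4) \<le> 90 * b" .
    have "p4 t * w t ^ 3 \<le> \<bar>p4 t\<bar> * w t ^ 3" using W by (intro mult_right_mono) auto
    also have "\<dots> \<le> (248.2 * b) * 1.1001"
      using P4 W3 W b by (intro mult_mono) auto
    finally have T3: "p4 t * w t ^ 3 \<le> 274 * b" using b(1) by simp
    \<comment> \<open>Only a lower bound is wanted, so the two summands of definite sign are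
      dropped.\<close>
    have "0 \<le> p1 t ^ 4 * w t ^ 6" "0 \<le> (p2 t)\<^sup>2 * w t ^ 4" using W p1_nonneg by auto
    moreover have "120 * p1 t ^ 4 * w t ^ 6 - 144 * (p1 t)\<^sup>2 * p2 t * w t ^ 5
        + (18 * (p2 t)\<^sup>2 + 24 * p1 t * p3 t) * w t ^ 4 - 2 * p4 t * w t ^ 3
      = 120 * (p1 t ^ 4 * w t ^ 6) - 144 * ((p1 t)\<^sup>2 * p2 t * w t ^ 5)
        + 18 * ((p2 t)\<^sup>2 * w t ^ 4) + 24 * (p1 t * p3 t * w t ^ 4) - 2 * (p4 t * w t ^ 3)"
      by (simp add: algebra_simps)
    ultimately show "- M \<le> 120 * p1 t ^ 4 * w t ^ 6 - 144 * (p1 t)\<^sup>2 * p2 t * w t ^ 5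
        + (18 * (p2 t)\<^sup>2 + 24 * p1 t * p3 t) * w t ^ 4 - 2 * p4 t * w t ^ 3"
      using T1 T2 T3 b(1) unfolding M_def by linarith
  qed (fact k)
  moreover have "(w t)\<^sup>2 = 1 / (ph t)\<^sup>2" for t by (simp add: w_def power_inverse divide_inverse)
  moreover have "M * k ^ 5 / 90 = 82 * (r + s * (1 - r)) * k ^ 5" by (simp add: M_def b_def q_def)
  ultimately show ?thesis by simp
qed

subsection \<open>A certified upper bound for the integral over the unit square\<close>

text \<open>Indexed by the binary numeral itself, so that an entry is found in at most eight
  unfoldings. The certificate is evaluated symbolically and needs six sines on every leaf.\<close>

datatype trie = En | Nd trie int trie

fun look_num :: "trie \<Rightarrow> num \<Rightarrow> int" where
  "look_num En n = 0"
| "look_num (Nd l v r) num.One = v"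
| "look_num (Nd l v r) (num.Bit0 n) = look_num l n"
| "look_num (Nd l v r) (num.Bit1 n) = look_num r n"

definition look :: "trie \<Rightarrow> int \<Rightarrow> int" where
  "look t i = look_num t (num_of_nat (nat i))"

lemma look_code [code]:
  "look t (Int.Pos n) = look_num t n" "look t 0 = look_num t num.One"
  "look t (Int.Neg n) = look_num t num.One"
  by (simp_all add: look_def num_of_nat.simps)

text \<open>Position \<open>j + 1\<close>, read from the least significant bit, holds the integer part of
  \<open>2\<^sup>2\<^sup>2 sin (2 \<pi> j / 512) / (2 \<pi>)\<close>.\<close>
definition sin_trie :: trie where
  "sin_trie = Nd (Nd (Nd (Nd (Nd (Nd (Nd (Nd En 667493 En) 466197 En) 247870 (Nd En 613549 En)) 122187 (Nd (Nd En 550449 En)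
    364028 (Nd En 653070 En))) 57273 (Nd (Nd (Nd En 510782 En) 307429 (Nd En 636373 En)) 185924 (Nd (Nd En 584815
    En) 417121 (Nd En 663476 En)))) 24570 (Nd (Nd (Nd (Nd En 489079 En) 277985 (Nd En 625715 En)) 154241 (Nd (Nd
    En 568317 En) 391045 (Nd En 659067 En))) 89838 (Nd (Nd (Nd En 531256 En) 336134 (Nd En 645499 En)) 217159 (Nd
    (Nd En 599904 En) 442191 (Nd En 666287 En))))) 8191 (Nd (Nd (Nd (Nd (Nd En 477781 En) 263007 (Nd En 619818
    En)) 138256 (Nd (Nd En 559552 En) 377650 (Nd En 656266 En))) 73578 (Nd (Nd (Nd En 521176 En) 321878 (Nd En
    641129 En)) 201602 (Nd (Nd En 592538 En) 429786 (Nd En 665082 En)))) 40934 (Nd (Nd (Nd (Nd En 500081 En)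
    292795 (Nd En 631234 En)) 170134 (Nd (Nd En 576740 En) 404205 (Nd En 661471 En))) 106044 (Nd (Nd (Nd En 541016
    En) 350186 (Nd En 649480 En)) 232584 (Nd (Nd En 606909 En) 454331 (Nd En 667091 En)))))) 0 (Nd (Nd (Nd (Nd (Nd
    (Nd (Nd En 667544 En) 472025 En) 255458 (Nd En 616730 En)) 130231 (Nd (Nd En 555042 En) 370867 (Nd En 654717
    En))) 65430 (Nd (Nd (Nd En 516018 En) 314678 (Nd En 638799 En)) 193777 (Nd (Nd En 588721 En) 423485 (Nd En
    664329 En)))) 32754 (Nd (Nd (Nd (Nd En 494617 En) 285411 (Nd En 628522 En)) 162200 (Nd (Nd En 572571 En)
    397655 (Nd En 660319 En))) 97949 (Nd (Nd (Nd En 536176 En) 343186 (Nd En 647538 En)) 224888 (Nd (Nd En 603452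
    En) 448295 (Nd En 666740 En))))) 16382 (Nd (Nd (Nd (Nd (Nd En 483466 En) 270516 (Nd En 622813 En)) 146259 (Nd
    (Nd En 563977 En) 384377 (Nd En 657716 En))) 81714 (Nd (Nd (Nd En 526256 En) 329031 (Nd En 643363 En)) 209396
    (Nd (Nd En 596266 En) 436021 (Nd En 665735 En)))) 49107 (Nd (Nd (Nd (Nd En 505470 En) 300135 (Nd En 633852
    En)) 178042 (Nd (Nd En 580821 En) 410694 (Nd En 662523 En))) 114124 (Nd (Nd (Nd En 545774 En) 357134 (Nd En
    651324 En)) 240245 (Nd (Nd En 610275 En) 460298 (Nd En 667343 En))))))"

text \<open>A lower bound for \<open>2 ^ 22 * kappa (i / 512)\<close> when
  \<open>\<bar>i\<bar> \<le> 256\<close>; \<open>8192 = 2 ^ 22 / 512\<close> and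
  \<open>2097152 = 2 ^ 22 / 2\<close>. The table covers a quarter of the period, and reflection at
  the quarter gives the rest of the half. For negative \<open>i\<close> the sine changes sign, so
  that an upper bound, the integer part plus 1, has to be subtracted. Keys are shifted by 1 because
  numerals are positive.\<close>

definition kappa_lb :: "int \<Rightarrow> int" where
  "kappa_lb i = 8192 * i + 2097152 +
     (if 0 \<le> i then (if i \<le> 128 then look sin_trie (i + 1) else look sin_trie (257 - i))
      else (if -128 \<le> i then - look sin_trie (1 - i) - 1 else - look sin_trie (257 + i) - 1))"

text \<open>A certificate covers the rectangle \<open>[s0, s1] / 1024 \<times> [lo, hi] / 512\<close> of points \<open>(s, u)\<close>; \<open>Sx\<close> and \<open>Ux\<close> halve it in the
  direction of \<open>s\<close> and of \<open>u\<close>. On a leaf \<open>Lf m q\<close>, the cut \<open>v\<close> moves linearly from \<open>(m - q) / 512\<close> to \<open>(m + q) / 512\<close> while \<open>u\<close> runs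
  through its interval. The value is \<open>6 \<cdot> 2\<^sup>3\<^sup>9\<close> times an upper bound for the integral.\<close>
datatype cert = Lf int int | Sx cert cert | Ux cert cert

text \<open>\<open>P\<close> and \<open>y\<close> have 22 fractional bits, \<open>s0\<close> and
  \<open>s1\<close> have 10; so \<open>A\<close> and \<open>B\<close> are \<open>2 ^ 32\<close>
  times lower bounds for \<open>p + s q\<close> at both ends of the range of \<open>s\<close>. Their
  product is the denominator in the exact integral of \<open>1 / (p + s q)^2\<close>. The default
  \<open>0\<close> makes the checker reject the leaf.\<close>

definition node :: "int \<Rightarrow> int \<Rightarrow> int \<Rightarrow> int \<Rightarrow> int" where
  "node P y s0 s1 = (let A = 1024 * P + s0 * y; B = 1024 * P + s1 * y in if 0 < A \<and> 0 < B then A * B else 0)"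

text \<open>\<open>D1\<close>, \<open>D2\<close>, \<open>D3\<close> belong to the nodes of Simpson's rule; the large constant is \<open>2\<^sup>8\<^sup>4\<close>. The condition with
  \<open>4160749568 = 31 \<cdot> 2\<^sup>2\<^sup>7\<close> provides the lower bound \<open>31 / 32\<close> of \<open>line_simpson\<close>, and the last summand is its error term.\<close>
primrec cert_val :: "cert \<Rightarrow> int \<Rightarrow> int \<Rightarrow> int \<Rightarrow> int \<Rightarrow> int option" where
  "cert_val (Lf m q) s0 s1 lo hi =
     (let c = (lo + hi) div 2; h = hi - c; x = c - m; P = kappa_lb (m - q); y = kappa_lb (x - (h - q));
        D1 = node P y s0 s1; D2 = node (kappa_lb m) (kappa_lb x) s0 s1; D3 = node (kappa_lb (m + q)) (kappa_lb (x + (h - q))) s0 s1 in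
      if c - lo = h \<and> 0 < h \<and> 0 \<le> q \<and> q \<le> h \<and> \<bar>m\<bar> + q \<le> 256 \<and> \<bar>x\<bar> + (h - q) \<le> 256
         \<and> 4160749568 \<le> 1024 * P + s0 * y \<and> 0 < D1 \<and> 0 < D2 \<and> 0 < D3
      then Some ((s1 - s0) * (hi - lo) *
        (19342813113834066795298816 * (D2 * D3 + 4 * (D1 * D3) + D1 * D2) div (D1 * (D2 * D3)) + 1
         + (123 * (h * h * h) * (1024 * q + s1 * (h - q))) div 33554432 + 1))
      else None)"
| "cert_val (Sx a b) s0 s1 lo hi = (let m = (s0 + s1) div 2 in
     case cert_val a s0 m lo hi of None \<Rightarrow> None | Some x \<Rightarrow> map_option ((+) x) (cert_val b m s1 lo hi))"
| "cert_val (Ux a b) s0 s1 lo hi = (let m = (lo + hi) div 2 in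
     case cert_val a s0 s1 lo m of None \<Rightarrow> None | Some x \<Rightarrow> map_option ((+) x) (cert_val b s0 s1 m hi))"

text \<open>The sines are compared with the powers of \<open>cis (\<pi> / 256)\<close>, computed with 44 fractional bits. Every multiplication adds at
  most 4 units to the error, hence at most 512 in total. The two factors next to \<open>t\<close> and \<open>t + 1\<close> are \<open>2\<^sup>2\<^sup>3\<close> times an upper and a lower
  bound for \<open>10\<^sup>1\<^sup>3 \<pi>\<close>.\<close>
primrec table_ok :: "int list \<Rightarrow> int \<Rightarrow> int \<Rightarrow> bool" where
  "table_ok [] c s \<longleftrightarrow> True"
| "table_ok (j # js) c s \<longleftrightarrow> (let t = look sin_trie (j + 1) in
     0 \<le> t \<and> t * 263535892666454638592 \<le> (s - 512) * 10000000000000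
     \<and> (s + 512) * 10000000000000 \<le> (t + 1) * 263535892666295255040
     \<and> table_ok js ((c * 17590861385161 - s * 215883184573) div 17592186044416)
                   ((c * 215883184573 + s * 17590861385161) div 17592186044416))"

section \<open>Correctness of the sine table\<close>

lemma table_ok_sin_trie: "table_ok [1..128] 17590861385161 215883184573"
  by code_simp

abbreviation rot :: complex where
  "rot \<equiv> Complex (17590861385161 / 2 ^ 44) (215883184573 / 2 ^ 44)"

text \<open>The rounded rotation does not expand: an earlier error is carried along without growth,
  and errors merely add up.\<close>

lemma norm_rot_le: "norm rot \<le> 1"
  by (simp add: cmod_def power2_eq_square)

text \<open>\<open>\<pi> / 256\<close> is enclosed up to \<open>2 * 10^-14\<close>, which is less
  than one unit \<open>2^-44\<close>, and the Taylor remainders are far smaller still. Each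
  coordinate is thus off by at most one unit.\<close>

lemma cis_rot: "norm (cis (pi / 256) - rot) \<le> 2 / 2 ^ 44"
proof -
  define x where "x = pi / 256"
  have x: "0.01227184630307 \<le> x" "x \<le> 0.01227184630309"
    using pi_approx by (simp_all add: x_def)
  have "\<exists>t. sin x = (\<Sum>m<7. sin_coeff m * x ^ m) + sin (t + 1/2 * real 7 * pi) / fact 7 * x ^ 7"
    using Maclaurin_sin_expansion2[of x 7] by blast
  then obtain t where t: "sin x = (\<Sum>m<7. sin_coeff m * x ^ m) + sin (t + 1/2 * real 7 * pi) / fact 7 * x ^ 7" ..
  have "\<exists>t. cos x = (\<Sum>m<8. cos_coeff m * x ^ m) + cos (t + 1/2 * real 8 * pi) / fact 8 * x ^ 8"
    using Maclaurin_cos_expansion[of x 8] by blast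
  then obtain u where u: "cos x = (\<Sum>m<8. cos_coeff m * x ^ m) + cos (u + 1/2 * real 8 * pi) / fact 8 * x ^ 8" ..
  have sum7: "(\<Sum>m<7. g m) = g 0 + g 1 + g 2 + g 3 + g 4 + g 5 + g 6"
    and sum8: "(\<Sum>m<8. g m) = g 0 + g 1 + g 2 + g 3 + g 4 + g 5 + g 6 + g 7" for g :: "nat \<Rightarrow> real"
    by (simp_all add: eval_nat_numeral)
  define e where "e = sin (t + 1/2 * real 7 * pi) / fact 7 * x ^ 7"
  define d where "d = cos (u + 1/2 * real 8 * pi) / fact 8 * x ^ 8"
  have s: "sin x = x - x ^ 3 / 6 + x ^ 5 / 120 + e"
    unfolding t sum7 e_def by (simp add: sin_coeff_def fact_numeral)
  have c: "cos x = 1 - x ^ 2 / 2 + x ^ 4 / 24 - x ^ 6 / 720 + d"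
    unfolding u sum8 d_def by (simp add: cos_coeff_def fact_numeral)
  have x0: "0 \<le> x" using x by simp
  have ed: "\<bar>e\<bar> \<le> x ^ 7 / 5040" "\<bar>d\<bar> \<le> x ^ 8 / 40320"
    using x0 mult_right_mono[OF abs_sin_le_one[of "t + 1/2 * real 7 * pi"], of "x ^ 7"]
      mult_right_mono[OF abs_cos_le_one[of "u + 1/2 * real 8 * pi"], of "x ^ 8"]
    by (simp_all add: e_def d_def abs_mult fact_numeral)
  note pw = x(2)[THEN power_mono, OF x0] power_mono[OF x(1), simplified]
  have "\<bar>sin x - 215883184573 / 2 ^ 44\<bar> \<le> 1 / 2 ^ 44"
    using ed(1) x pw[of 3] pw[of 5] pw[of 7] unfolding s by (simp add: power_divide)
  moreover have "\<bar>cos x - 17590861385161 / 2 ^ 44\<bar> \<le> 1 / 2 ^ 44"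
    using ed(2) x pw[of 2] pw[of 4] pw[of 6] pw[of 8] unfolding c by (simp add: power_divide)
  moreover have "norm (cis (pi / 256) - rot) \<le>
     \<bar>cos x - 17590861385161 / 2 ^ 44\<bar> + \<bar>sin x - 215883184573 / 2 ^ 44\<bar>"
    using cmod_le[of "cis (pi / 256) - rot"] by (simp add: x_def)
  ultimately show ?thesis by simp
qed

definition sin_scaled :: "int \<Rightarrow> real" where
  "sin_scaled j = 2 ^ 22 * sin (2 * pi * (of_int j / 512)) / (2 * pi)"

text \<open>The four new units: rounding the product down costs one in each coordinate, and
  replacing \<open>cis (pi / 256)\<close> by \<open>rot\<close> costs two.\<close>

lemma table_ok_step:
  assumes "norm (cis (real j * (pi / 256)) - Complex (of_int c / 2 ^ 44) (of_int s / 2 ^ 44)) \<le> 4 * real j / 2 ^ 44"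
  shows "norm (cis (real (Suc j) * (pi / 256))
    - Complex (of_int ((c * 17590861385161 - s * 215883184573) div 17592186044416) / 2 ^ 44)
        (of_int ((c * 215883184573 + s * 17590861385161) div 17592186044416) / 2 ^ 44))
    \<le> 4 * real (Suc j) / 2 ^ 44" (is "norm (?w - ?z') \<le> _")
proof -
  define z where "z = Complex (of_int c / 2 ^ 44) (of_int s / 2 ^ 44)"
  have r: "\<bar>of_int n / 2 ^ 44 / 2 ^ 44 - of_int (n div 17592186044416) / 2 ^ 44\<bar> \<le> (1 / 2 ^ 44 :: real)" for n :: int
  proof -
    have "17592186044416 * (n div 17592186044416) \<le> n"
        "n \<le> 17592186044416 * (n div 17592186044416) + 17592186044416" by linarith+
    then have "17592186044416 * real_of_int (n div 17592186044416) \<le> real_of_int n"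
        "real_of_int n \<le> 17592186044416 * real_of_int (n div 17592186044416) + 17592186044416"
      by linarith+
    then show ?thesis by (simp add: abs_le_iff field_simps)
  qed
  have "norm (z * rot - ?z') \<le> 2 / 2 ^ 44"
  proof -
    have "\<bar>Re (z * rot - ?z')\<bar> \<le> 1 / 2 ^ 44" "\<bar>Im (z * rot - ?z')\<bar> \<le> 1 / 2 ^ 44"
      using r[of "c * 17590861385161 - s * 215883184573"] r[of "c * 215883184573 + s * 17590861385161"]
      by (simp_all add: z_def field_simps)
    then show ?thesis using cmod_le[of "z * rot - ?z'"] by simp
  qed
  moreover have "norm ((cis (real j * (pi / 256)) - z) * rot) \<le> 4 * real j / 2 ^ 44"
    using mult_mono[OF assms norm_rot_le] by (simp add: norm_mult z_def)
  moreover have "norm (cis (real j * (pi / 256)) * (cis (pi / 256) - rot)) \<le> 2 / 2 ^ 44"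
    using cis_rot by (simp add: norm_mult)
  moreover have "?w - ?z' = cis (real j * (pi / 256)) * (cis (pi / 256) - rot)
      + (cis (real j * (pi / 256)) - z) * rot + (z * rot - ?z')"
    by (simp add: algebra_simps cis_mult add_divide_distrib)
  ultimately have "norm (?w - ?z') \<le> 2 / 2 ^ 44 + 4 * real j / 2 ^ 44 + 2 / 2 ^ 44"
    by (simp only:) (intro norm_triangle_mono)
  then show ?thesis by (simp add: field_simps)
qed

lemma table_ok_imp:
  assumes "table_ok js c s" "js = map int [n..<n + length js]" "n + length js \<le> 129"
    and "norm (cis (real n * (pi / 256)) - Complex (of_int c / 2 ^ 44) (of_int s / 2 ^ 44)) \<le> 4 * real n / 2 ^ 44"
    and "j \<in> set js"
  shows "of_int (look sin_trie (j + 1)) \<le> sin_scaled j \<and> sin_scaled j \<le> of_int (look sin_trie (j + 1)) + 1"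
  using assms
proof (induction js arbitrary: n c s)
  case Nil
  then show ?case by simp
next
  case (Cons i js)
  have i: "i = int n" and js: "js = map int [Suc n..<Suc n + length js]"
    using Cons.prems(2) by (auto simp: upt_conv_Cons simp del: upt_Suc)
  show ?case
  proof (cases "j = i")
    case True
    define t where "t = look sin_trie (j + 1)"
    have t: "0 \<le> t" "t * 263535892666454638592 \<le> (s - 512) * 10000000000000"
        "(s + 512) * 10000000000000 \<le> (t + 1) * 263535892666295255040"
      using Cons.prems(1) by (auto simp: t_def True Let_def)
    have "real_of_int (t * 263535892666454638592) \<le> of_int ((s - 512) * 10000000000000)"
      "real_of_int ((s + 512) * 10000000000000) \<le> of_int ((t + 1) * 263535892666295255040)"
      using t(2,3) by (simp_all only: of_int_le_iff)
    with t(1) have t': "0 \<le> real_of_int t" "real_of_int t * 263535892666454638592 \<le> (of_int s - 512) * 10000000000000"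
        "(of_int s + 512) * 10000000000000 \<le> (real_of_int t + 1) * 263535892666295255040"
      by simp_all
    have "\<bar>Im (cis (real n * (pi / 256)) - Complex (of_int c / 2 ^ 44) (of_int s / 2 ^ 44))\<bar> \<le> 4 * real n / 2 ^ 44"
      using Cons.prems(4) abs_Im_le_cmod order_trans by blast
    moreover have "real n \<le> 128" using Cons.prems(3) by simp
    ultimately have "\<bar>sin (real n * (pi / 256)) - of_int s / 2 ^ 44\<bar> \<le> 512 / 2 ^ 44"
      by (simp add: field_simps)
    moreover have "sin (2 * pi * (of_int j / 512)) = sin (real n * (pi / 256))"
      by (simp add: True i field_simps)
    ultimately have sb: "(of_int s - 512) / 2 ^ 44 \<le> sin (2 * pi * (of_int j / 512))"
      "sin (2 * pi * (of_int j / 512)) \<le> (of_int s + 512) / 2 ^ 44"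
      by (simp_all add: abs_le_iff field_simps)
    \<comment> \<open>The table entry is a lower bound for a quotient by \<open>2 * pi\<close>, so
      \<open>pi\<close> is replaced by an upper bound here, and by a lower bound in the second
      chain.\<close>
    have "of_int t * (2 * pi) \<le> of_int t * (2 * 3.1415926535899)"
      using t'(1) pi_approx by (intro mult_left_mono) auto
    also have "\<dots> \<le> (of_int s - 512) / 2 ^ 22" using t'(2) by simp
    also have "\<dots> \<le> 2 ^ 22 * sin (2 * pi * (of_int j / 512))" using sb(1) by simp
    finally have 1: "of_int t * (2 * pi) \<le> 2 ^ 22 * sin (2 * pi * (of_int j / 512))" .
    have "2 ^ 22 * sin (2 * pi * (of_int j / 512)) \<le> (of_int s + 512) / 2 ^ 22" using sb(2) by simp
    also have "\<dots> \<le> (of_int t + 1) * (2 * 3.141592653588)" using t'(3) by simp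
    also have "\<dots> \<le> (of_int t + 1) * (2 * pi)"
      using t'(1) pi_approx by (intro mult_left_mono) auto
    finally have 2: "2 ^ 22 * sin (2 * pi * (of_int j / 512)) \<le> (of_int t + 1) * (2 * pi)" .
    show ?thesis unfolding t_def[symmetric] using 1 2 by (simp add: sin_scaled_def field_simps)
  next
    case False
    show ?thesis
    proof (rule Cons.IH[OF _ js])
      show "norm (cis (real (Suc n) * (pi / 256))
        - Complex (of_int ((c * 17590861385161 - s * 215883184573) div 17592186044416) / 2 ^ 44)
            (of_int ((c * 215883184573 + s * 17590861385161) div 17592186044416) / 2 ^ 44))
        \<le> 4 * real (Suc n) / 2 ^ 44"
        by (rule table_ok_step[OF Cons.prems(4)])
      show "Suc n + length js \<le> 129" using Cons.prems(3) by simp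
      show "j \<in> set js" using Cons.prems(5) False by simp
    qed (use Cons.prems(1) in \<open>simp add: Let_def\<close>)
  qed
qed

lemma sin_trie_bounds:
  assumes "0 \<le> j" "j \<le> 128"
  shows "of_int (look sin_trie (j + 1)) \<le> sin_scaled j" "sin_scaled j \<le> of_int (look sin_trie (j + 1)) + 1"
proof -
  \<comment> \<open>The check by rotations starts with the angle number 1; the entry for the angle
    0, at position 1, is exact.\<close>
  have "look sin_trie 1 = 0" by code_simp
  moreover have "[1..128] = map int [1..<1 + length [1..128]]" by code_simp
  moreover have "norm (cis (real 1 * (pi / 256))
      - Complex (of_int 17590861385161 / 2 ^ 44) (of_int 215883184573 / 2 ^ 44)) \<le> 4 * real 1 / 2 ^ 44"
    using cis_rot by simp
  ultimately have "of_int (look sin_trie (j + 1)) \<le> sin_scaled j \<and> sin_scaled j \<le> of_int (look sin_trie (j + 1)) + 1"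
  proof (cases "j = 0")
    case False
    then have "j \<in> set [1..128]" "1 + length [1..128] \<le> 129" using assms by auto
    with \<open>[1..128] = _\<close> \<open>norm _ \<le> _\<close> show ?thesis
      by (intro table_ok_imp[OF table_ok_sin_trie])
  qed (simp add: sin_scaled_def)
  then show "of_int (look sin_trie (j + 1)) \<le> sin_scaled j" "sin_scaled j \<le> of_int (look sin_trie (j + 1)) + 1"
    by auto
qed

lemma kappa_lb_le:
  assumes "\<bar>i\<bar> \<le> 256"
  shows "of_int (kappa_lb i) / 2 ^ 22 \<le> kappa (of_int i / 512)"
proof -
  have mirror: "sin_scaled (256 - i) = sin_scaled i" for i
    using sin_pi_minus[of "2 * pi * (of_int i / 512)"]
    by (simp add: sin_scaled_def right_diff_distrib diff_divide_distrib)
  have neg: "sin_scaled (- i) = - sin_scaled i" for i by (simp add: sin_scaled_def)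
  have k: "kappa (of_int i / 512) = (8192 * of_int i + 2097152 + sin_scaled i) / 2 ^ 22"
    by (simp add: kappa_def sin_scaled_def)
  consider "0 \<le> i" "i \<le> 128" | "128 < i" "i \<le> 256" | "-128 \<le> i" "i < 0" | "-256 \<le> i" "i < -128"
    using assms by linarith
  then have "of_int (kappa_lb i) \<le> 8192 * of_int i + 2097152 + sin_scaled i"
  proof cases
    case 1
    then show ?thesis using sin_trie_bounds(1)[of i] by (simp add: kappa_lb_def)
  next
    case 2
    then show ?thesis using sin_trie_bounds(1)[of "256 - i"] mirror[of i] by (simp add: kappa_lb_def)
  next
    case 3
    then show ?thesis using sin_trie_bounds(2)[of "- i"] neg[of i] by (simp add: kappa_lb_def)
  next
    case 4
    then show ?thesis using sin_trie_bounds(2)[of "256 + i"] neg[of i] mirror[of "-i"] by (simp add: kappa_lb_def add.commute)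
  qed
  then show ?thesis by (simp add: k divide_right_mono)
qed

lemma kappa_mono:
  assumes "a \<le> b" shows "kappa a \<le> kappa b"
proof (rule DERIV_nonneg_imp_nondecreasing[OF assms])
  fix x
  have "(kappa has_real_derivative 1 + cos (2 * pi * x)) (at x)"
    unfolding kappa_def[abs_def] by (auto intro!: derivative_eq_intros)
  moreover have "0 \<le> 1 + cos (2 * pi * x)" using cos_ge_minus_one[of "2 * pi * x"] by linarith
  ultimately show "\<exists>y. (kappa has_real_derivative y) (at x) \<and> 0 \<le> y" by blast
qed

lemma kappa_nonneg: "- (1 / 2) \<le> x \<Longrightarrow> 0 \<le> kappa x"
  using kappa_mono[of "- (1 / 2)" x] by (simp add: kappa_def)

section \<open>From the checker to integrals over rectangles\<close>

text \<open>The primitive \<open>(s - a) / ((P + a * Q) * (P + s * Q))\<close> vanishes at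
  \<open>a\<close> and avoids a division by \<open>Q\<close>, so that \<open>Q = 0\<close> is
  covered too.\<close>

lemma nn_integral_inverse_affine_square:
  fixes P Q a b :: real
  assumes "a \<le> b" "0 \<le> Q" "0 < P + a * Q"
  shows "(\<integral>\<^sup>+s. ennreal (1 / (P + s * Q)\<^sup>2) * indicator {a..b} s \<partial>lborel)
    = ennreal ((b - a) / ((P + a * Q) * (P + b * Q)))"
proof -
  have pos: "0 < P + s * Q" if "a \<le> s" for s
    using mult_right_mono[OF that assms(2)] assms(3) by linarith
  have "(\<integral>\<^sup>+s. ennreal (1 / (P + s * Q)\<^sup>2) * indicator {a..b} s \<partial>lborel)
    = ennreal ((b - a) / ((P + a * Q) * (P + b * Q)) - (a - a) / ((P + a * Q) * (P + a * Q)))"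
  proof (rule nn_integral_FTC_Icc)
    fix s assume s: "s \<in> {a..b}"
    have "((\<lambda>s. (s - a) / ((P + a * Q) * (P + s * Q))) has_real_derivative
       (1 * ((P + a * Q) * (P + s * Q)) - (s - a) * ((P + a * Q) * Q)) / ((P + a * Q) * (P + s * Q))\<^sup>2) (at s)"
      using pos[of s] pos[of a] s by (auto intro!: derivative_eq_intros simp: power2_eq_square)
    also have "(1 * ((P + a * Q) * (P + s * Q)) - (s - a) * ((P + a * Q) * Q)) / ((P + a * Q) * (P + s * Q))\<^sup>2
      = (P + a * Q)\<^sup>2 / ((P + a * Q) * (P + s * Q))\<^sup>2"
      by (simp add: power2_eq_square algebra_simps)
    also have "\<dots> = 1 / (P + s * Q)\<^sup>2"
      using pos[of a] by (simp add: power_mult_distrib)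
    finally show "((\<lambda>s. (s - a) / ((P + a * Q) * (P + s * Q))) has_real_derivative 1 / (P + s * Q)\<^sup>2) (at s)" .
  qed (use assms in auto)
  then show ?thesis by simp
qed

lemma node_bound:
  fixes p q :: real
  assumes "0 < node P y s0 s1" "0 \<le> s0" "s0 \<le> s1"
    and "of_int P / 2 ^ 22 \<le> p" "of_int y / 2 ^ 22 \<le> q"
  shows "0 < p + of_int s0 / 1024 * q" "0 < p + of_int s1 / 1024 * q"
    "1 / ((p + of_int s0 / 1024 * q) * (p + of_int s1 / 1024 * q)) \<le> 2 ^ 64 / of_int (node P y s0 s1)"
proof -
  define A where "A = 1024 * P + s0 * y"
  define B where "B = 1024 * P + s1 * y"
  have w: "0 < A" "0 < B" "node P y s0 s1 = A * B"
    using assms(1) by (auto simp: node_def A_def B_def Let_def split: if_splits)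
  have lin: "of_int (1024 * P + t * y) / 2 ^ 32 \<le> p + of_int t / 1024 * q" if "0 \<le> t" for t
  proof -
    have "of_int (1024 * P + t * y) / 2 ^ 32 = of_int P / 2 ^ 22 + of_int t / 1024 * (of_int y / 2 ^ 22 :: real)"
      by (simp add: field_simps)
    also have "\<dots> \<le> p + of_int t / 1024 * q"
      using assms that by (intro add_mono mult_left_mono) auto
    finally show ?thesis .
  qed
  have A: "of_int A / 2 ^ 32 \<le> p + of_int s0 / 1024 * q" and B: "of_int B / 2 ^ 32 \<le> p + of_int s1 / 1024 * q"
    using lin assms(2,3) by (simp_all add: A_def B_def)
  have A0: "0 < real_of_int A / 2 ^ 32" and B0: "0 < real_of_int B / 2 ^ 32" using w by simp_all
  show pos: "0 < p + of_int s0 / 1024 * q" "0 < p + of_int s1 / 1024 * q" using A A0 B B0 by linarith+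
  have "1 / ((p + of_int s0 / 1024 * q) * (p + of_int s1 / 1024 * q)) \<le> 1 / (of_int A / 2 ^ 32 * (of_int B / 2 ^ 32))"
    using A A0 B B0 pos by (intro divide_left_mono mult_mono mult_pos_pos) linarith+
  also have "\<dots> = 2 ^ 64 / of_int (node P y s0 s1)" by (simp add: w)
  finally show "1 / ((p + of_int s0 / 1024 * q) * (p + of_int s1 / 1024 * q)) \<le> 2 ^ 64 / of_int (node P y s0 s1)" .
qed

lemma line_simpson_nn:
  fixes v x r s k :: real
  defines "ph \<equiv> \<lambda>t. kappa (v + r * t) + s * kappa (x + (1 - r) * t)"
  assumes k: "0 < k" and r: "0 \<le> r" "r \<le> 1" and s: "0 \<le> s" "s \<le> 1" and lb: "31 / 32 \<le> ph (- k)"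
  shows "(\<integral>\<^sup>+t. ennreal (1 / (ph t)\<^sup>2) * indicator {-k..k} t \<partial>lborel)
    \<le> ennreal (k / 3 * (1 / (ph (-k))\<^sup>2 + 4 / (ph 0)\<^sup>2 + 1 / (ph k)\<^sup>2) + 82 * (r + s * (1 - r)) * k ^ 5)"
proof -
  have mono: "ph a \<le> ph b" if "a \<le> b" for a b
    unfolding ph_def using that r s by (intro add_mono mult_left_mono kappa_mono) auto
  have pos: "0 < ph t" if "t \<in> {-k..k}" for t
    using mono[of "-k" t] lb that by auto
  have "continuous_on {-k..k} (\<lambda>t. 1 / (ph t)\<^sup>2)"
    using pos unfolding ph_def kappa_def by (intro continuous_intros) fastforce+
  then have "((\<lambda>t. 1 / (ph t)\<^sup>2) has_integral integral {-k..k} (\<lambda>t. 1 / (ph t)\<^sup>2)) {-k..k}"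
    using integrable_continuous_real integrable_integral by blast
  then have "(\<integral>\<^sup>+t. ennreal (indicator {-k..k} t * (1 / (ph t)\<^sup>2)) \<partial>lborel)
    = ennreal (integral {-k..k} (\<lambda>t. 1 / (ph t)\<^sup>2))"
    by (intro nn_integral_has_integral_lebesgue) auto
  also have "(\<lambda>t. ennreal (indicator {-k..k} t * (1 / (ph t)\<^sup>2))) = (\<lambda>t. ennreal (1 / (ph t)\<^sup>2) * indicator {-k..k} t)"
    by (auto simp: fun_eq_iff split: split_indicator)
  finally show ?thesis
    using line_simpson[OF k r s, of v x] lb unfolding ph_def by (simp add: ennreal_leI)
qed

text \<open>\<open>B s u\<close> stands for the normalised area of the union of two discs through the origin, with squared
  radii in the ratio \<open>s\<close> and with centres seen at the angle \<open>\<pi> u\<close>; cutting the union along a ray at the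
  angle \<open>\<pi> v\<close> gives the lower bounds.\<close>
definition above_lines :: "(real \<Rightarrow> real \<Rightarrow> real) \<Rightarrow> bool" where
  "above_lines B \<longleftrightarrow> (\<forall>s u v. 0 \<le> s \<longrightarrow> s \<le> 1 \<longrightarrow> 0 \<le> u \<longrightarrow> u \<le> 1 \<longrightarrow> \<bar>v\<bar> \<le> 1 / 2 \<longrightarrow> \<bar>u - v\<bar> \<le> 1 / 2
    \<longrightarrow> kappa v + s * kappa (u - v) \<le> B s u)"

lemma above_linesD:
  assumes "above_lines B" "0 \<le> s" "s \<le> 1" "0 \<le> u" "u \<le> 1" "\<bar>v\<bar> \<le> 1 / 2" "\<bar>u - v\<bar> \<le> 1 / 2"
  shows "kappa v + s * kappa (u - v) \<le> B s u"
  using assms unfolding above_lines_def by blast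

definition rect_integral :: "(real \<Rightarrow> real \<Rightarrow> real) \<Rightarrow> real \<Rightarrow> real \<Rightarrow> real \<Rightarrow> real \<Rightarrow> ennreal" where
  "rect_integral B a b c d =
    (\<integral>\<^sup>+s. (\<integral>\<^sup>+u. ennreal (1 / (B s u)\<^sup>2) * indicator {c..d} u \<partial>lborel) * indicator {a..b} s \<partial>lborel)"

lemma ennreal_weighted_sum:
  assumes "0 \<le> p" "0 \<le> x" "0 \<le> y" "0 \<le> z" "0 \<le> e"
  shows "ennreal (p * x + p * 4 * y + p * z + e)
    = ennreal p * ennreal x + ennreal p * 4 * ennreal y + ennreal p * ennreal z + ennreal e"
  using assms by (simp flip: ennreal_plus ennreal_mult ennreal_numeral)

text \<open>For fixed \<open>s\<close>, Simpson's rule in \<open>u\<close> along the cut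
  \<open>v + r * (u - c)\<close> leaves three nodes. As the cut does not involve \<open>s\<close>,
  each node is the inverse square of an affine function of \<open>s\<close> and is integrated
  exactly; \<open>w1\<close>, \<open>w2\<close>, \<open>w3\<close> bound these integrals divided by
  \<open>b - a\<close>. The range conditions keep the angles on both sides of the cut within
  \<open>1 / 2\<close> for all \<open>u\<close>.\<close>

lemma leaf_bound:
  fixes a b c k v r :: real and w :: "nat \<Rightarrow> real"
  assumes B: "above_lines B" and ab: "0 \<le> a" "a \<le> b" "b \<le> 1" and k: "0 < k" "0 \<le> c - k" "c + k \<le> 1"
    and r: "0 \<le> r" "r \<le> 1"
    and range: "\<bar>v\<bar> + r * k \<le> 1 / 2" "\<bar>c - v\<bar> + (1 - r) * k \<le> 1 / 2"
    and P: "P = (\<lambda>t. kappa (v + r * t))" and Q: "Q = (\<lambda>t. kappa (c - v + (1 - r) * t))"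
    and lb: "31 / 32 \<le> P (- k) + a * Q (- k)"
    and wt: "1 / ((P (- k) + a * Q (- k)) * (P (- k) + b * Q (- k))) \<le> w1"
      "1 / ((P 0 + a * Q 0) * (P 0 + b * Q 0)) \<le> w2"
      "1 / ((P k + a * Q k) * (P k + b * Q k)) \<le> w3"
  shows "rect_integral B a b (c - k) (c + k)
    \<le> ennreal ((b - a) * (k / 3 * (w1 + 4 * w2 + w3) + 82 * (r + b * (1 - r)) * k ^ 5))"
proof -
  have Q0: "0 \<le> Q t" if "-k \<le> t" "t \<le> k" for t
  proof -
    have "\<bar>(1 - r) * t\<bar> \<le> (1 - r) * k" using that r by (auto simp: abs_mult intro!: mult_left_mono)
    then show ?thesis unfolding Q using range(2) by (intro kappa_nonneg) linarith
  qed
  have pos: "31 / 32 \<le> P t + s * Q t" if "-k \<le> t" "t \<le> k" "a \<le> s" for s t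
  proof -
    have "P (-k) + a * Q (-k) \<le> P t + a * Q t"
      unfolding P Q using that r ab by (intro add_mono mult_left_mono kappa_mono) auto
    also have "\<dots> \<le> P t + s * Q t" using that Q0 by (intro add_left_mono mult_right_mono) auto
    finally show ?thesis using lb by simp
  qed
  have inner: "(\<integral>\<^sup>+u. ennreal (1 / (B s u)\<^sup>2) * indicator {c - k..c + k} u \<partial>lborel)
     \<le> ennreal (k / 3) * ennreal (1 / (P (-k) + s * Q (-k))\<^sup>2) + ennreal (k / 3) * 4 * ennreal (1 / (P 0 + s * Q 0)\<^sup>2)
       + ennreal (k / 3) * ennreal (1 / (P k + s * Q k)\<^sup>2) + ennreal (82 * (r + b * (1 - r)) * k ^ 5)"
    if s: "s \<in> {a..b}" for s
  proof -
    have "(\<integral>\<^sup>+u. ennreal (1 / (B s u)\<^sup>2) * indicator {c - k..c + k} u \<partial>lborel)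
      \<le> (\<integral>\<^sup>+u. ennreal (1 / (P (u - c) + s * Q (u - c))\<^sup>2) * indicator {-k..k} (u - c) \<partial>lborel)"
    proof (rule nn_integral_mono)
      fix u
      show "ennreal (1 / (B s u)\<^sup>2) * indicator {c - k..c + k} u
        \<le> ennreal (1 / (P (u - c) + s * Q (u - c))\<^sup>2) * indicator {-k..k} (u - c)"
      proof (cases "u \<in> {c - k..c + k}")
        case True
        have "\<bar>r * (u - c)\<bar> \<le> r * k" "\<bar>(1 - r) * (u - c)\<bar> \<le> (1 - r) * k"
          using True r by (auto simp: abs_mult intro!: mult_left_mono)
        moreover have u: "u - (v + r * (u - c)) = c - v + (1 - r) * (u - c)" by (simp add: algebra_simps)
        ultimately have "\<bar>v + r * (u - c)\<bar> \<le> 1 / 2" "\<bar>u - (v + r * (u - c))\<bar> \<le> 1 / 2"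
          using range by linarith+
        moreover have "0 \<le> s" "s \<le> 1" "0 \<le> u" "u \<le> 1" using True s ab k by auto
        ultimately have "kappa (v + r * (u - c)) + s * kappa (u - (v + r * (u - c))) \<le> B s u"
          by (intro above_linesD[OF B])
        then have "P (u - c) + s * Q (u - c) \<le> B s u" unfolding P Q u by simp
        moreover have "31 / 32 \<le> P (u - c) + s * Q (u - c)" using pos True s by auto
        ultimately have "1 / (B s u)\<^sup>2 \<le> 1 / (P (u - c) + s * Q (u - c))\<^sup>2"
          by (intro divide_left_mono power_mono mult_pos_pos zero_less_power) auto
        then show ?thesis using True by (auto intro!: ennreal_leI)
      qed simp
    qed
    also have "\<dots> = (\<integral>\<^sup>+t. ennreal (1 / (P t + s * Q t)\<^sup>2) * indicator {-k..k} t \<partial>lborel)"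
      using nn_integral_real_affine[of "\<lambda>u. ennreal (1 / (P (u - c) + s * Q (u - c))\<^sup>2) * indicator {-k..k} (u - c)" 1 c]
      unfolding P Q kappa_def by simp
    also have "\<dots> \<le> ennreal (k / 3 * (1 / (P (-k) + s * Q (-k))\<^sup>2 + 4 / (P 0 + s * Q 0)\<^sup>2 + 1 / (P k + s * Q k)\<^sup>2)
        + 82 * (r + s * (1 - r)) * k ^ 5)"
      using line_simpson_nn[OF k(1) r, of s v "c - v"] s ab pos[of "-k" s] k unfolding P Q by auto
    also have "\<dots> \<le> ennreal (k / 3 * (1 / (P (-k) + s * Q (-k))\<^sup>2 + 4 / (P 0 + s * Q 0)\<^sup>2 + 1 / (P k + s * Q k)\<^sup>2)
        + 82 * (r + b * (1 - r)) * k ^ 5)"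
      using s r k by (intro ennreal_leI add_left_mono mult_left_mono mult_right_mono) auto
    also have "\<dots> = ennreal (k / 3 * (1 / (P (-k) + s * Q (-k))\<^sup>2) + k / 3 * 4 * (1 / (P 0 + s * Q 0)\<^sup>2)
        + k / 3 * (1 / (P k + s * Q k)\<^sup>2) + 82 * (r + b * (1 - r)) * k ^ 5)"
      by (simp add: algebra_simps)
    also have "\<dots> = ennreal (k / 3) * ennreal (1 / (P (-k) + s * Q (-k))\<^sup>2) + ennreal (k / 3) * 4 * ennreal (1 / (P 0 + s * Q 0)\<^sup>2)
       + ennreal (k / 3) * ennreal (1 / (P k + s * Q k)\<^sup>2) + ennreal (82 * (r + b * (1 - r)) * k ^ 5)"
      using k r ab by (intro ennreal_weighted_sum) auto
    finally show ?thesis .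
  qed
  define I where "I t = (\<integral>\<^sup>+s. ennreal (1 / (P t + s * Q t)\<^sup>2) * indicator {a..b} s \<partial>lborel)" for t
  have I: "I t \<le> ennreal ((b - a) * w)" if "-k \<le> t" "t \<le> k" "1 / ((P t + a * Q t) * (P t + b * Q t)) \<le> w" for t w
  proof -
    have "I t = ennreal ((b - a) * (1 / ((P t + a * Q t) * (P t + b * Q t))))"
      unfolding I_def using pos[OF that(1,2), of a] Q0[OF that(1,2)] ab
      by (subst nn_integral_inverse_affine_square) auto
    also have "\<dots> \<le> ennreal ((b - a) * w)" using that(3) ab by (intro ennreal_leI mult_left_mono) auto
    finally show ?thesis .
  qed
  have "rect_integral B a b (c - k) (c + k) \<le> (\<integral>\<^sup>+s.
      (ennreal (k / 3) * ennreal (1 / (P (-k) + s * Q (-k))\<^sup>2) + ennreal (k / 3) * 4 * ennreal (1 / (P 0 + s * Q 0)\<^sup>2)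
       + ennreal (k / 3) * ennreal (1 / (P k + s * Q k)\<^sup>2) + ennreal (82 * (r + b * (1 - r)) * k ^ 5)) * indicator {a..b} s \<partial>lborel)"
    unfolding rect_integral_def using inner by (intro nn_integral_mono) (auto split: split_indicator)
  also have "\<dots> = (\<integral>\<^sup>+s.
      ennreal (k / 3) * (ennreal (1 / (P (-k) + s * Q (-k))\<^sup>2) * indicator {a..b} s)
      + ennreal (k / 3) * 4 * (ennreal (1 / (P 0 + s * Q 0)\<^sup>2) * indicator {a..b} s)
      + ennreal (k / 3) * (ennreal (1 / (P k + s * Q k)\<^sup>2) * indicator {a..b} s)
      + ennreal (82 * (r + b * (1 - r)) * k ^ 5) * indicator {a..b} s \<partial>lborel)"
    by (intro nn_integral_cong) (simp add: distrib_right mult.assoc)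
  also have "\<dots> = ennreal (k / 3) * I (-k) + ennreal (k / 3) * 4 * I 0 + ennreal (k / 3) * I k
      + ennreal (82 * (r + b * (1 - r)) * k ^ 5) * ennreal (b - a)"
    using ab by (simp add: nn_integral_add nn_integral_cmult I_def)
  also have "\<dots> \<le> ennreal (k / 3) * ennreal ((b - a) * w1) + ennreal (k / 3) * 4 * ennreal ((b - a) * w2)
      + ennreal (k / 3) * ennreal ((b - a) * w3) + ennreal (82 * (r + b * (1 - r)) * k ^ 5) * ennreal (b - a)"
    using I wt k by (intro add_mono mult_left_mono order_refl) auto
  also have "\<dots> = ennreal ((b - a) * (k / 3 * (w1 + 4 * w2 + w3) + 82 * (r + b * (1 - r)) * k ^ 5))"
  proof -
    have "0 \<le> w1" "0 \<le> w2" "0 \<le> w3"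
      using wt pos[of "-k" a] pos[of "-k" b] pos[of 0 a] pos[of 0 b] pos[of k a] pos[of k b] k ab
      by (auto elim!: order_trans[rotated])
    then have "ennreal (k / 3) * ennreal ((b - a) * w1) + ennreal (k / 3) * 4 * ennreal ((b - a) * w2)
      + ennreal (k / 3) * ennreal ((b - a) * w3) + ennreal (82 * (r + b * (1 - r)) * k ^ 5) * ennreal (b - a)
      = ennreal (k / 3 * ((b - a) * w1) + k / 3 * 4 * ((b - a) * w2) + k / 3 * ((b - a) * w3)
        + 82 * (r + b * (1 - r)) * k ^ 5 * (b - a))"
      using ab k r by (subst ennreal_weighted_sum) (auto simp flip: ennreal_mult)
    also have "k / 3 * ((b - a) * w1) + k / 3 * 4 * ((b - a) * w2) + k / 3 * ((b - a) * w3)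
        + 82 * (r + b * (1 - r)) * k ^ 5 * (b - a)
      = (b - a) * (k / 3 * (w1 + 4 * w2 + w3) + 82 * (r + b * (1 - r)) * k ^ 5)"
      by (simp add: field_simps)
    finally show ?thesis .
  qed
  finally show ?thesis .
qed

text \<open>The two closed pieces share an edge, which is counted twice; for adding up upper bounds
  the inequality suffices.\<close>

lemma rect_integral_split:
  assumes [measurable]: "(\<lambda>p. B (fst p) (snd p)) \<in> borel_measurable (lborel \<Otimes>\<^sub>M lborel)"
  shows "rect_integral B a b c d \<le> rect_integral B a m c d + rect_integral B m b c d"
    and "rect_integral B a b c d \<le> rect_integral B a b c m + rect_integral B a b m d"
proof -
  have [measurable]: "(\<lambda>s. \<integral>\<^sup>+u. ennreal (1 / (B s u)\<^sup>2) * indicator {c..d} u \<partial>lborel) \<in> borel_measurable lborel" for c d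
    using lborel.borel_measurable_nn_integral[of "\<lambda>s u. ennreal (1 / (B s u)\<^sup>2) * indicator {c..d} u" lborel]
    by (simp add: case_prod_beta)
  have [measurable]: "(\<lambda>u. ennreal (1 / (B s u)\<^sup>2) * indicator {c..d} u) \<in> borel_measurable lborel" for s c d
    using measurable_compose[OF measurable_Pair1'[of s lborel lborel],
      of "\<lambda>p. ennreal (1 / (B (fst p) (snd p))\<^sup>2) * indicator {c..d} (snd p)"] by simp
  show "rect_integral B a b c d \<le> rect_integral B a m c d + rect_integral B m b c d"
    unfolding rect_integral_def
    by (subst nn_integral_add[symmetric]) (auto intro!: nn_integral_mono split: split_indicator)
  have "(\<integral>\<^sup>+u. ennreal (1 / (B s u)\<^sup>2) * indicator {c..d} u \<partial>lborel) \<le>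
      (\<integral>\<^sup>+u. ennreal (1 / (B s u)\<^sup>2) * indicator {c..m} u \<partial>lborel)
      + (\<integral>\<^sup>+u. ennreal (1 / (B s u)\<^sup>2) * indicator {m..d} u \<partial>lborel)" for s
    by (subst nn_integral_add[symmetric]) (auto intro!: nn_integral_mono split: split_indicator)
  then show "rect_integral B a b c d \<le> rect_integral B a b c m + rect_integral B a b m d"
    unfolding rect_integral_def
    by (subst nn_integral_add[symmetric]) (auto intro!: nn_integral_mono split: split_indicator)
qed

definition grid_integral :: "(real \<Rightarrow> real \<Rightarrow> real) \<Rightarrow> int \<Rightarrow> int \<Rightarrow> int \<Rightarrow> int \<Rightarrow> ennreal" where
  "grid_integral B s0 s1 lo hi =
    rect_integral B (of_int s0 / 1024) (of_int s1 / 1024) (of_int lo / 512) (of_int hi / 512)"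

lemma le_div_succ_mult: "0 < d \<Longrightarrow> n \<le> (n div d + 1) * (d :: int)"
  using div_mult_mod_eq[of n d] pos_mod_bound[of d n] unfolding distrib_right mult_1 by linarith

lemma if_Some_eq: "(if b then Some x else None) = Some y \<longleftrightarrow> b \<and> x = y"
  by simp

text \<open>\<open>B\<close> may be any measurable function above the cut bounds. Thus one
  certificate serves both for \<open>s \<le> 1\<close> and, after \<open>s\<close> has been replaced
  by \<open>1 / s\<close>, for the outer region.\<close>

lemma cert_val_sound:
  assumes B: "above_lines B" and meas: "(\<lambda>p. B (fst p) (snd p)) \<in> borel_measurable (lborel \<Otimes>\<^sub>M lborel)"
    and "cert_val t s0 s1 lo hi = Some n" "0 \<le> s0" "s0 \<le> s1" "s1 \<le> 1024" "0 \<le> lo" "lo \<le> hi" "hi \<le> 512"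
  shows "0 \<le> n \<and> grid_integral B s0 s1 lo hi \<le> ennreal (of_int n / (6 * 2 ^ 39))"
  using assms(3-)
proof (induction t arbitrary: s0 s1 lo hi n)
  case (Lf m q)
  define c where "c = (lo + hi) div 2"
  define h where "h = hi - c"
  define x where "x = c - m"
  define D1 where "D1 = node (kappa_lb (m - q)) (kappa_lb (x - (h - q))) s0 s1"
  define D2 where "D2 = node (kappa_lb m) (kappa_lb x) s0 s1"
  define D3 where "D3 = node (kappa_lb (m + q)) (kappa_lb (x + (h - q))) s0 s1"
  define w where "w = 19342813113834066795298816 * (D2 * D3 + 4 * (D1 * D3) + D1 * D2) div (D1 * (D2 * D3)) + 1"
  have chk: "c - lo = h" "0 < h" "0 \<le> q" "q \<le> h" "\<bar>m\<bar> + q \<le> 256" "\<bar>x\<bar> + (h - q) \<le> 256"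
      "4160749568 \<le> 1024 * kappa_lb (m - q) + s0 * kappa_lb (x - (h - q))"
    and D: "0 < D1" "0 < D2" "0 < D3"
    and n: "n = (s1 - s0) * (hi - lo) *
        (w + (123 * (h * h * h) * (1024 * q + s1 * (h - q))) div 33554432 + 1)"
    using Lf.prems(1) unfolding cert_val.simps Let_def c_def[symmetric] h_def[symmetric] x_def[symmetric]
      D1_def[symmetric] D2_def[symmetric] D3_def[symmetric] w_def[symmetric] if_Some_eq
    by blast+
  define a where "a = real_of_int s0 / 1024"
  define b where "b = real_of_int s1 / 1024"
  define k where "k = real_of_int h / 512"
  \<comment> \<open>The slope of the cut: while \<open>u\<close> runs through \<open>2 * h\<close>
    units, the cut runs through \<open>2 * q\<close>.\<close>
  define r where "r = real_of_int q / of_int h"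
  define C where "C = real_of_int c / 512"
  define v where "v = real_of_int m / 512"
  have rk: "r * k = of_int q / 512" "(1 - r) * k = of_int (h - q) / 512"
    using chk(2) by (simp_all add: r_def k_def field_simps)
  have r: "0 \<le> r" "r \<le> 1" using chk by (simp_all add: r_def)
  define P where "P t = kappa (v + r * t)" for t
  define Q where "Q t = kappa (C - v + (1 - r) * t)" for t
  have nodes: "P (-k) = kappa (of_int (m - q) / 512)" "P 0 = kappa (of_int m / 512)" "P k = kappa (of_int (m + q) / 512)"
    "Q (-k) = kappa (of_int (x - (h - q)) / 512)" "Q 0 = kappa (of_int x / 512)" "Q k = kappa (of_int (x + (h - q)) / 512)"
    unfolding P_def Q_def mult_minus_right rk
    by (simp_all add: v_def C_def x_def add_divide_distrib diff_divide_distrib algebra_simps)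
  have nodes_lb: "of_int (kappa_lb (m - q)) / 2 ^ 22 \<le> P (-k)" "of_int (kappa_lb m) / 2 ^ 22 \<le> P 0" "of_int (kappa_lb (m + q)) / 2 ^ 22 \<le> P k"
    "of_int (kappa_lb (x - (h - q))) / 2 ^ 22 \<le> Q (-k)" "of_int (kappa_lb x) / 2 ^ 22 \<le> Q 0" "of_int (kappa_lb (x + (h - q))) / 2 ^ 22 \<le> Q k"
  proof -
    have bds: "\<bar>m - q\<bar> \<le> 256" "\<bar>m\<bar> \<le> 256" "\<bar>m + q\<bar> \<le> 256"
      "\<bar>x - (h - q)\<bar> \<le> 256" "\<bar>x\<bar> \<le> 256" "\<bar>x + (h - q)\<bar> \<le> 256"
      using chk(3-6) by simp_all
    show "of_int (kappa_lb (m - q)) / 2 ^ 22 \<le> P (-k)" "of_int (kappa_lb m) / 2 ^ 22 \<le> P 0" "of_int (kappa_lb (m + q)) / 2 ^ 22 \<le> P k"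
      "of_int (kappa_lb (x - (h - q))) / 2 ^ 22 \<le> Q (-k)" "of_int (kappa_lb x) / 2 ^ 22 \<le> Q 0" "of_int (kappa_lb (x + (h - q))) / 2 ^ 22 \<le> Q k"
      unfolding nodes by (intro kappa_lb_le bds)+
  qed
  have s: "0 \<le> s0" "s0 \<le> s1" using Lf.prems(2-) by auto
  note W1 = node_bound[OF D(1)[unfolded D1_def] s nodes_lb(1,4), folded D1_def]
    and W2 = node_bound[OF D(2)[unfolded D2_def] s nodes_lb(2,5), folded D2_def]
    and W3 = node_bound[OF D(3)[unfolded D3_def] s nodes_lb(3,6), folded D3_def]
  \<comment> \<open>The reciprocals of the nodes carry the factor \<open>2 ^ 64\<close>;
    \<open>2 ^ 84\<close> in the numerator keeps 20 further bits, and the added 1 turns the integer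
    quotient into an upper bound.\<close>
  have w: "2 ^ 64 / of_int D1 + 4 * (2 ^ 64 / of_int D2) + 2 ^ 64 / of_int D3 \<le> real_of_int w / 2 ^ 20"
  proof -
    have "0 < D1 * (D2 * D3)" using D by simp
    then have "19342813113834066795298816 * (D2 * D3 + 4 * (D1 * D3) + D1 * D2) \<le> w * (D1 * (D2 * D3))"
      unfolding w_def by (rule le_div_succ_mult)
    then have "real_of_int (19342813113834066795298816 * (D2 * D3 + 4 * (D1 * D3) + D1 * D2)) \<le> of_int (w * (D1 * (D2 * D3)))"
      by (simp only: of_int_le_iff)
    then have "19342813113834066795298816 * (of_int D2 * of_int D3 + 4 * (of_int D1 * of_int D3) + of_int D1 * of_int D2)
        \<le> real_of_int w * (of_int D1 * (of_int D2 * of_int D3))" by (simp only: of_int_mult of_int_add of_int_numeral)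
    moreover have "2 ^ 64 / y1 + 4 * (2 ^ 64 / y2) + 2 ^ 64 / y3 \<le> z / 2 ^ 20"
      if "19342813113834066795298816 * (y2 * y3 + 4 * (y1 * y3) + y1 * y2) \<le> z * (y1 * (y2 * y3))" "0 < y1" "0 < y2" "0 < y3"
      for y1 y2 y3 z :: real
    proof -
      have "2 ^ 64 / y1 + 4 * (2 ^ 64 / y2) + 2 ^ 64 / y3 = 2 ^ 64 * ((y2 * y3 + 4 * (y1 * y3) + y1 * y2) / (y1 * (y2 * y3)))"
        using that(2-4) by (simp add: field_simps)
      also have "\<dots> \<le> 2 ^ 64 * (z / 19342813113834066795298816)"
        using that by (intro mult_left_mono) (simp_all add: divide_le_eq mult_ac)
      finally show ?thesis by simp
    qed
    ultimately show ?thesis using D(1-3) by simp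
  qed
  have lb: "31 / 32 \<le> P (- k) + a * Q (- k)"
  proof -
    have "real_of_int 4160749568 \<le> of_int (1024 * kappa_lb (m - q) + s0 * kappa_lb (x - (h - q)))"
      using chk(7) by (simp only: of_int_le_iff)
    then have "31 / 32 \<le> of_int (kappa_lb (m - q)) / 2 ^ 22 + a * (of_int (kappa_lb (x - (h - q))) / 2 ^ 22)"
      by (simp add: a_def field_simps)
    also have "\<dots> \<le> P (- k) + a * Q (- k)"
      using nodes_lb s by (intro add_mono mult_left_mono) (auto simp: a_def)
    finally show ?thesis .
  qed
  have "rect_integral B a b (C - k) (C + k)
    \<le> ennreal ((b - a) * (k / 3 * (2 ^ 64 / of_int D1 + 4 * (2 ^ 64 / of_int D2) + 2 ^ 64 / of_int D3)
      + 82 * (r + b * (1 - r)) * k ^ 5))"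
  proof (rule leaf_bound[OF B])
    show "0 \<le> a" "a \<le> b" "b \<le> 1" using Lf.prems(2-) by (simp_all add: a_def b_def)
    show "0 < k" using chk by (simp add: k_def)
    have "C - k = of_int lo / 512" "C + k = of_int hi / 512"
      using chk(1) by (simp_all add: C_def k_def h_def flip: diff_divide_distrib add_divide_distrib of_int_diff of_int_add)
    then show "0 \<le> C - k" "C + k \<le> 1" using Lf.prems(2-) by simp_all
    have "real_of_int (\<bar>m\<bar> + q) \<le> of_int 256" "real_of_int (\<bar>x\<bar> + (h - q)) \<le> of_int 256"
      using chk(5,6) by (simp_all only: of_int_le_iff)
    moreover have Cv: "C - v = of_int x / 512" by (simp add: C_def v_def x_def diff_divide_distrib)
    ultimately show "\<bar>v\<bar> + r * k \<le> 1 / 2" "\<bar>C - v\<bar> + (1 - r) * k \<le> 1 / 2"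
      unfolding rk Cv by (simp_all add: v_def field_simps)
    show "P = (\<lambda>t. kappa (v + r * t))" "Q = (\<lambda>t. kappa (C - v + (1 - r) * t))"
      by (simp_all add: P_def[abs_def] Q_def[abs_def])
  qed (use r lb W1 W2 W3 in \<open>simp_all add: a_def b_def\<close>)
  also have "(b - a) * (k / 3 * (2 ^ 64 / of_int D1 + 4 * (2 ^ 64 / of_int D2) + 2 ^ 64 / of_int D3)
      + 82 * (r + b * (1 - r)) * k ^ 5) \<le> of_int n / (6 * 2 ^ 39)"
  proof -
    \<comment> \<open>With \<open>r * k = q / 512\<close>, \<open>b = s1 / 1024\<close> and
      \<open>k ^ 4 = k * (h / 512) ^ 3\<close> the error term becomes
      \<open>k / 3 * e / 2 ^ 45\<close>, where \<open>123 = 3 * 82 / 2\<close>. Division by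
      \<open>33554432 = 2 ^ 25\<close> brings it to the 20 bits of \<open>w\<close>.\<close>
    define e where "e = 123 * (h * h * h) * (1024 * q + s1 * (h - q))"
    have "82 * (r + b * (1 - r)) * k ^ 5 = 82 * (r * k + b * ((1 - r) * k)) * k ^ 4"
      by (simp add: algebra_simps eval_nat_numeral)
    also have "\<dots> = k / 3 * (of_int e / 2 ^ 45)"
      unfolding rk by (simp add: b_def k_def e_def field_simps eval_nat_numeral)
    also have "\<dots> \<le> k / 3 * (of_int (e div 33554432 + 1) / 2 ^ 20)"
    proof -
      have "e \<le> 33554432 * (e div 33554432) + 33554432"
        using div_mult_mod_eq[of e 33554432] pos_mod_bound[of 33554432 e] by linarith
      then have "e \<le> 33554432 * (e div 33554432 + 1)" by simp
      then have "real_of_int e \<le> of_int (33554432 * (e div 33554432 + 1))" by (simp only: of_int_le_iff)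
      then show ?thesis using chk by (intro mult_left_mono) (simp_all add: k_def)
    qed
    finally have "(b - a) * (k / 3 * (2 ^ 64 / of_int D1 + 4 * (2 ^ 64 / of_int D2) + 2 ^ 64 / of_int D3)
      + 82 * (r + b * (1 - r)) * k ^ 5)
      \<le> (b - a) * (k / 3 * (of_int w / 2 ^ 20) + k / 3 * (of_int (e div 33554432 + 1) / 2 ^ 20))"
      using s chk w by (intro mult_left_mono add_mono) (simp_all add: a_def b_def k_def)
    also have "\<dots> = of_int n / (6 * 2 ^ 39)"
    proof -
      \<comment> \<open>The scale \<open>6 * 2 ^ 39\<close> is made up of \<open>1024\<close> for
        \<open>s\<close>, \<open>512\<close> for \<open>u\<close>, \<open>2 ^ 20\<close> for the
        weights, the \<open>3\<close> of Simpson's rule and the \<open>2\<close> from this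
        equation.\<close>
      have "hi - lo = 2 * h" using chk(1) by (simp add: h_def)
      then show ?thesis unfolding n e_def[symmetric] by (simp add: a_def b_def k_def field_simps)
    qed
    finally show ?thesis .
  qed
  finally have "rect_integral B a b (C - k) (C + k) \<le> ennreal (of_int n / (6 * 2 ^ 39))"
    by (simp add: ennreal_leI)
  moreover have "C - k = of_int lo / 512" "C + k = of_int hi / 512"
    using chk(1) by (simp_all add: C_def k_def h_def flip: diff_divide_distrib add_divide_distrib of_int_diff of_int_add)
  moreover have "0 \<le> n"
  proof -
    have "0 \<le> real_of_int w / 2 ^ 20" using D by (intro order_trans[OF _ w] add_nonneg_nonneg) simp_all
    then have "0 \<le> w" by (simp add: zero_le_divide_iff)
    moreover have "0 \<le> 123 * (h * h * h) * (1024 * q + s1 * (h - q))"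
      using chk s by simp
    ultimately show ?thesis unfolding n using s Lf.prems(2-) by (intro mult_nonneg_nonneg) (auto intro!: add_nonneg_nonneg pos_imp_zdiv_nonneg_iff[THEN iffD2])
  qed
  ultimately show ?case by (simp add: grid_integral_def a_def b_def)
next
  case (Sx t1 t2)
  define m where "m = (s0 + s1) div 2"
  obtain n1 n2 where n: "cert_val t1 s0 m lo hi = Some n1" "cert_val t2 m s1 lo hi = Some n2" "n = n1 + n2"
    using Sx.prems(1) by (auto simp: Let_def m_def split: option.splits)
  have m: "s0 \<le> m" "m \<le> s1" using Sx.prems(2-) by (auto simp: m_def)
  have "grid_integral B s0 s1 lo hi \<le> grid_integral B s0 m lo hi + grid_integral B m s1 lo hi"
    unfolding grid_integral_def by (rule rect_integral_split[OF meas])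
  also have "\<dots> \<le> ennreal (of_int n1 / (6 * 2 ^ 39)) + ennreal (of_int n2 / (6 * 2 ^ 39))"
    using Sx.IH(1)[OF n(1)] Sx.IH(2)[OF n(2)] m Sx.prems(2-) by (intro add_mono) auto
  also have "\<dots> = ennreal (of_int n / (6 * 2 ^ 39))"
    using Sx.IH(1)[OF n(1)] Sx.IH(2)[OF n(2)] m Sx.prems(2-) by (simp add: n add_divide_distrib flip: ennreal_plus)
  finally show ?case using Sx.IH(1)[OF n(1)] Sx.IH(2)[OF n(2)] m Sx.prems(2-) n by auto
next
  case (Ux t1 t2)
  define m where "m = (lo + hi) div 2"
  obtain n1 n2 where n: "cert_val t1 s0 s1 lo m = Some n1" "cert_val t2 s0 s1 m hi = Some n2" "n = n1 + n2"
    using Ux.prems(1) by (auto simp: Let_def m_def split: option.splits)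
  have m: "lo \<le> m" "m \<le> hi" using Ux.prems(2-) by (auto simp: m_def)
  have "grid_integral B s0 s1 lo hi \<le> grid_integral B s0 s1 lo m + grid_integral B s0 s1 m hi"
    unfolding grid_integral_def by (rule rect_integral_split[OF meas])
  also have "\<dots> \<le> ennreal (of_int n1 / (6 * 2 ^ 39)) + ennreal (of_int n2 / (6 * 2 ^ 39))"
    using Ux.IH(1)[OF n(1)] Ux.IH(2)[OF n(2)] m Ux.prems(2-) by (intro add_mono) auto
  also have "\<dots> = ennreal (of_int n / (6 * 2 ^ 39))"
    using Ux.IH(1)[OF n(1)] Ux.IH(2)[OF n(2)] m Ux.prems(2-) by (simp add: n add_divide_distrib flip: ennreal_plus)
  finally show ?case using Ux.IH(1)[OF n(1)] Ux.IH(2)[OF n(2)] m Ux.prems(2-) n by auto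
qed

section \<open>Evaluation of the certificate, one subtree at a time\<close>

text \<open>Forgetting the tree keeps terms small: every subtree is evaluated on its own, and
  joining the pieces handles only their totals.\<close>

definition certified :: "int \<Rightarrow> int \<Rightarrow> int \<Rightarrow> int \<Rightarrow> int \<Rightarrow> bool" where
  "certified s0 s1 lo hi n \<longleftrightarrow> (\<exists>t. cert_val t s0 s1 lo hi = Some n)"

lemma certifiedI: "cert_val t s0 s1 lo hi = Some n \<Longrightarrow> certified s0 s1 lo hi n"
  by (auto simp: certified_def)

lemma certified_S:
  assumes "certified s0 m lo hi a" "certified m s1 lo hi b" "(s0 + s1) div 2 = m"
  shows "certified s0 s1 lo hi (a + b)"
proof -
  obtain t u where "cert_val t s0 m lo hi = Some a" "cert_val u m s1 lo hi = Some b"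
    using assms(1,2) by (auto simp: certified_def)
  then have "cert_val (Sx t u) s0 s1 lo hi = Some (a + b)" using assms(3) by (simp add: Let_def)
  then show ?thesis by (rule certifiedI)
qed

lemma certified_U:
  assumes "certified s0 s1 lo m a" "certified s0 s1 m hi b" "(lo + hi) div 2 = m"
  shows "certified s0 s1 lo hi (a + b)"
proof -
  obtain t u where "cert_val t s0 s1 lo m = Some a" "cert_val u s0 s1 m hi = Some b"
    using assms(1,2) by (auto simp: certified_def)
  then have "cert_val (Ux t u) s0 s1 lo hi = Some (a + b)" using assms(3) by (simp add: Let_def)
  then show ?thesis by (rule certifiedI)
qed

text \<open>The value \<open>m\<close> on a leaf approximates 512 times the best cut, where both
  discs have the same chord: \<open>cos (\<pi> v) = sqrt s * cos (\<pi> (u - v))\<close>. For small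
  \<open>s\<close> or small \<open>u\<close> this is close to \<open>v = 1 / 2\<close>, that is
  \<open>m = 256\<close>, so that nearly the whole unit disc lies on its side of the cut.\<close>

lemma chunk_0: "certified 0 256 0 64 102862437760"
proof (rule certifiedI)
  show "cert_val (Ux (Ux (Ux (Lf 254 0) (Sx (Lf 252 0) (Lf 247 0))) (Sx (Sx (Lf 251 0) (Ux (Lf 247 0) (Lf 244 0))) (Ux (Sx (Lf 243 0) (Lf
    239 0)) (Sx (Lf 238 0) (Ux (Lf 234 0) (Lf 230 0)))))) (Sx (Sx (Sx (Sx (Lf 251 0) (Lf 247 0)) (Ux (Lf 245 0) (Lf 241 0))) (Ux
    (Sx (Lf 241 0) (Ux (Lf 239 0) (Lf 235 0))) (Sx (Sx (Lf 237 0) (Lf 234 0)) (Ux (Lf 231 0) (Lf 228 0))))) (Ux (Sx (Ux (Sx (Lf 235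
    0) (Lf 231 0)) (Sx (Lf 231 0) (Lf 226 0))) (Ux (Sx (Lf 228 0) (Lf 224 0)) (Sx (Lf 222 0) (Lf 217 0)))) (Sx (Sx (Ux (Lf 227 0)
    (Lf 223 0)) (Ux (Lf 222 0) (Lf 217 0))) (Sx (Ux (Lf 216 0) (Sx (Lf 213 0) (Lf 210 0))) (Ux (Lf 211 0) (Lf 206 0))))))) 0
    256 0 64 = Some 102862437760"
    by code_simp
qed

lemma chunk_1: "certified 256 512 0 32 51434298624"
proof (rule certifiedI)
  show "cert_val (Ux (Ux (Ux (Lf 253 0) (Sx (Lf 248 0) (Lf 244 0))) (Sx (Ux (Lf 243 0) (Sx (Lf 240 0) (Lf 236 0))) (Ux (Lf 237 0) (Sx (Lf
    232 0) (Lf 226 0))))) (Sx (Ux (Sx (Ux (Lf 236 0) (Lf 232 0)) (Ux (Lf 231 0) (Lf 226 0))) (Sx (Ux (Lf 227 0) (Lf 223 0)) (Ux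
    (Lf 221 0) (Sx (Lf 218 0) (Lf 213 0))))) (Ux (Sx (Ux (Lf 225 0) (Lf 219 0)) (Ux (Lf 218 0) (Sx (Lf 213 0) (Lf 208 0)))) (Sx
    (Ux (Sx (Lf 215 0) (Lf 210 0)) (Sx (Lf 209 0) (Lf 204 0))) (Ux (Sx (Lf 206 0) (Lf 201 0)) (Sx (Lf 199 0) (Lf 193 0)))))))
    256 512 0 32 = Some 51434298624"
    by code_simp
qed

lemma chunk_2: "certified 256 384 32 64 25353786496"
proof (rule certifiedI)
  show "cert_val (Ux (Sx (Ux (Sx (Ux (Lf 221 0) (Lf 218 0)) (Ux (Lf 217 0) (Lf 213 0))) (Sx (Ux (Lf 214 0) (Lf 211 0)) (Ux (Lf 209 0) (Lf
    206 0)))) (Ux (Sx (Ux (Lf 213 0) (Lf 209 0)) (Ux (Lf 208 0) (Lf 204 0))) (Sx (Ux (Lf 204 0) (Lf 200 0)) (Ux (Lf 199 0) (Lf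
    195 0))))) (Sx (Ux (Sx (Ux (Lf 208 0) (Lf 204 0)) (Ux (Lf 202 0) (Lf 199 0))) (Sx (Sx (Lf 202 0) (Lf 199 0)) (Ux (Lf 196 0)
    (Lf 193 0)))) (Ux (Sx (Ux (Lf 197 0) (Lf 193 0)) (Ux (Lf 191 0) (Lf 187 0))) (Sx (Ux (Lf 190 0) (Lf 187 0)) (Ux (Lf 183 0) (Lf
    180 0)))))) 256 384 32 64 = Some 25353786496"
    by code_simp
qed

lemma chunk_3: "certified 384 512 32 64 24919859136"
proof (rule certifiedI)
  show "cert_val (Ux (Sx (Ux (Sx (Ux (Lf 204 0) (Lf 198 0)) (Ux (Lf 198 0) (Lf 193 0))) (Sx (Ux (Lf 194 0) (Lf 189 0)) (Ux (Lf 188 0) (Lf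
    183 0)))) (Ux (Sx (Ux (Lf 193 0) (Lf 187 0)) (Ux (Lf 187 0) (Lf 181 0))) (Sx (Ux (Lf 182 0) (Lf 177 0)) (Ux (Lf 175 0) (Lf
    170 0))))) (Sx (Ux (Sx (Ux (Lf 185 0) (Lf 181 0)) (Ux (Lf 178 0) (Lf 174 0))) (Sx (Ux (Lf 177 0) (Lf 174 0)) (Ux (Lf 171 0)
    (Lf 167 0)))) (Ux (Sx (Ux (Lf 172 0) (Lf 168 0)) (Ux (Lf 165 0) (Lf 161 0))) (Sx (Ux (Lf 164 0) (Lf 160 0)) (Ux (Lf 157 0) (Sx
    (Lf 155 0) (Lf 151 0))))))) 384 512 32 64 = Some 24919859136"
    by code_simp
qed

lemma chunk_4: "certified 0 128 64 128 51052747008"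
proof (rule certifiedI)
  show "cert_val (Sx (Sx (Sx (Sx (Lf 250 0) (Ux (Lf 247 0) (Lf 244 0))) (Ux (Lf 242 0) (Sx (Lf 240 0) (Lf 236 0)))) (Ux (Sx (Ux (Lf 239 0)
    (Lf 236 0)) (Ux (Lf 235 0) (Lf 232 0))) (Sx (Sx (Lf 233 0) (Lf 231 0)) (Ux (Lf 228 0) (Lf 225 0))))) (Ux (Sx (Ux (Sx (Lf 232
    0) (Lf 228 0)) (Sx (Lf 228 0) (Lf 224 0))) (Ux (Sx (Lf 225 0) (Lf 222 0)) (Sx (Lf 220 0) (Lf 216 0)))) (Sx (Sx (Ux (Lf 224 0)
    (Lf 220 0)) (Ux (Lf 219 0) (Lf 216 0))) (Ux (Sx (Lf 215 0) (Lf 211 0)) (Sx (Lf 212 0) (Lf 207 0)))))) 0 128 64 128 = Some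
    51052747008"
    by code_simp
qed

lemma chunk_5: "certified 128 256 64 128 49547736960"
proof (rule certifiedI)
  show "cert_val (Sx (Ux (Ux (Sx (Ux (Lf 219 0) (Sx (Lf 217 0) (Lf 214 0))) (Ux (Lf 213 0) (Sx (Lf 211 0) (Lf 208 0)))) (Sx (Sx (Ux (Lf 214
    0) (Lf 211 0)) (Ux (Lf 211 0) (Lf 208 0))) (Sx (Ux (Lf 207 0) (Lf 204 0)) (Ux (Lf 204 0) (Lf 201 0))))) (Sx (Ux (Sx (Lf 207
    0) (Lf 204 0)) (Sx (Lf 203 0) (Lf 199 0))) (Ux (Sx (Ux (Lf 201 0) (Lf 199 0)) (Ux (Lf 198 0) (Lf 195 0))) (Sx (Lf 196 0) (Lf
    192 0))))) (Ux (Ux (Sx (Ux (Sx (Lf 208 0) (Lf 205 0)) (Sx (Lf 204 0) (Lf 201 0))) (Ux (Sx (Lf 202 0) (Lf 199 0)) (Sx (Lf 198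
    0) (Lf 195 0)))) (Sx (Ux (Sx (Lf 201 0) (Lf 197 0)) (Sx (Lf 197 0) (Lf 194 0))) (Ux (Sx (Lf 194 0) (Lf 191 0)) (Sx (Lf 190 0)
    (Lf 187 0))))) (Sx (Ux (Sx (Ux (Lf 194 0) (Lf 192 0)) (Ux (Lf 191 0) (Lf 188 0))) (Sx (Lf 188 0) (Lf 185 0))) (Ux (Sx (Ux (Lf
    187 0) (Lf 185 0)) (Ux (Lf 184 0) (Lf 181 0))) (Sx (Lf 181 0) (Lf 178 0)))))) 128 256 64 128 = Some 49547736960"
    by code_simp
qed

lemma chunk_6: "certified 256 384 64 128 47320678400"
proof (rule certifiedI)
  show "cert_val (Ux (Sx (Ux (Sx (Ux (Sx (Lf 196 0) (Lf 193 0)) (Sx (Lf 192 0) (Lf 188 0))) (Ux (Sx (Lf 190 0) (Lf 187 0)) (Sx (Lf 185 0) (Lf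
    182 0)))) (Sx (Ux (Sx (Lf 187 0) (Lf 184 0)) (Sx (Lf 184 0) (Lf 180 0))) (Ux (Sx (Lf 181 0) (Lf 177 0)) (Sx (Lf 177 0) (Lf
    174 0))))) (Ux (Sx (Ux (Sx (Lf 184 0) (Lf 181 0)) (Sx (Lf 179 0) (Lf 175 0))) (Ux (Sx (Lf 177 0) (Lf 174 0)) (Sx (Lf 172 0)
    (Lf 169 0)))) (Sx (Ux (Sx (Lf 174 0) (Lf 171 0)) (Sx (Lf 170 0) (Lf 167 0))) (Ux (Sx (Lf 168 0) (Lf 164 0)) (Sx (Lf 164 0) (Lf
    160 0)))))) (Sx (Sx (Ux (Sx (Ux (Lf 180 0) (Lf 178 0)) (Ux (Lf 177 0) (Lf 174 0))) (Sx (Lf 175 0) (Lf 171 0))) (Ux (Sx (Ux (Lf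
    174 0) (Lf 171 0)) (Ux (Lf 170 0) (Lf 168 0))) (Sx (Lf 168 0) (Lf 165 0)))) (Sx (Ux (Sx (Ux (Lf 167 0) (Lf 165 0)) (Ux (Lf
    164 0) (Lf 161 0))) (Sx (Lf 162 0) (Lf 158 0))) (Ux (Sx (Ux (Lf 161 0) (Lf 158 0)) (Ux (Lf 157 0) (Lf 155 0))) (Sx (Lf 155
    0) (Lf 152 0)))))) 256 384 64 128 = Some 47320678400"
    by code_simp
qed

lemma chunk_7: "certified 384 512 64 128 44442007168"
proof (rule certifiedI)
  show "cert_val (Ux (Sx (Ux (Sx (Ux (Sx (Lf 171 0) (Lf 167 0)) (Sx (Lf 165 0) (Lf 162 0))) (Ux (Sx (Lf 164 0) (Lf 161 0)) (Sx (Lf 159 0) (Lf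
    155 0)))) (Sx (Ux (Sx (Lf 161 0) (Lf 158 0)) (Sx (Lf 157 0) (Lf 154 0))) (Ux (Sx (Lf 154 0) (Lf 151 0)) (Sx (Lf 151 0) (Lf
    147 0))))) (Ux (Sx (Ux (Sx (Lf 157 0) (Lf 154 0)) (Sx (Lf 152 0) (Lf 149 0))) (Ux (Sx (Lf 150 0) (Lf 147 0)) (Sx (Lf 145 0)
    (Lf 142 0)))) (Sx (Ux (Sx (Lf 148 0) (Lf 144 0)) (Sx (Lf 144 0) (Lf 141 0))) (Sx (Ux (Lf 141 0) (Lf 138 0)) (Ux (Lf 138 0) (Lf
    135 0)))))) (Sx (Sx (Ux (Sx (Ux (Lf 154 0) (Lf 152 0)) (Ux (Lf 151 0) (Lf 149 0))) (Sx (Lf 149 0) (Lf 146 0))) (Ux (Sx (Ux (Lf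
    148 0) (Lf 146 0)) (Ux (Lf 145 0) (Lf 143 0))) (Sx (Lf 144 0) (Lf 141 0)))) (Sx (Ux (Sx (Lf 141 0) (Lf 138 0)) (Sx (Lf 138
    0) (Lf 135 0))) (Ux (Sx (Lf 135 0) (Lf 132 0)) (Sx (Lf 132 0) (Lf 130 0)))))) 384 512 64 128 = Some 44442007168"
    by code_simp
qed

lemma chunk_8: "certified 0 64 128 256 50461553152"
proof (rule certifiedI)
  show "cert_val (Ux (Sx (Sx (Sx (Sx (Lf 250 0) (Lf 245 0)) (Ux (Lf 241 0) (Lf 240 0))) (Ux (Sx (Lf 237 0) (Lf 233 0)) (Sx (Lf 235 0) (Lf
    230 0)))) (Sx (Ux (Sx (Lf 229 0) (Lf 226 0)) (Sx (Lf 227 0) (Lf 223 0))) (Ux (Sx (Lf 223 0) (Lf 221 0)) (Sx (Lf 220 0) (Lf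
    218 0))))) (Sx (Sx (Sx (Sx (Lf 249 0) (Lf 244 0)) (Sx (Lf 240 0) (Lf 237 0))) (Sx (Ux (Lf 233 0) (Lf 233 0)) (Ux (Lf 229 0)
    (Lf 229 0)))) (Sx (Ux (Sx (Lf 225 0) (Lf 222 0)) (Sx (Lf 225 0) (Lf 222 0))) (Ux (Sx (Lf 219 0) (Lf 216 0)) (Sx (Lf 219 0) (Lf
    217 0)))))) 0 64 128 256 = Some 50461553152"
    by code_simp
qed

lemma chunk_9: "certified 64 128 128 256 48034945024"
proof (rule certifiedI)
  show "cert_val (Ux (Sx (Ux (Sx (Sx (Lf 218 0) (Lf 215 0)) (Ux (Lf 213 0) (Lf 211 0))) (Sx (Sx (Lf 215 0) (Lf 212 0)) (Sx (Lf 210 0) (Lf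
    207 0)))) (Ux (Sx (Ux (Lf 208 0) (Lf 206 0)) (Ux (Lf 204 0) (Lf 202 0))) (Sx (Sx (Lf 205 0) (Lf 203 0)) (Sx (Lf 201 0) (Lf
    199 0))))) (Sx (Sx (Ux (Sx (Lf 214 0) (Lf 211 0)) (Sx (Lf 214 0) (Lf 212 0))) (Ux (Sx (Lf 209 0) (Lf 206 0)) (Sx (Lf 210 1)
    (Lf 207 1)))) (Ux (Sx (Sx (Lf 204 0) (Lf 202 0)) (Sx (Lf 200 0) (Lf 198 0))) (Sx (Sx (Lf 205 1) (Lf 204 1)) (Sx (Lf 202 1) (Lf
    200 1)))))) 64 128 128 256 = Some 48034945024"
    by code_simp
qed

lemma chunk_10: "certified 128 256 128 192 45963685120"
proof (rule certifiedI)
  show "cert_val (Sx (Sx (Ux (Sx (Ux (Lf 200 0) (Lf 198 0)) (Ux (Lf 196 0) (Lf 194 0))) (Sx (Sx (Lf 197 0) (Lf 195 0)) (Sx (Lf 193 0) (Lf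
    191 0)))) (Ux (Sx (Ux (Lf 192 0) (Lf 190 0)) (Ux (Lf 189 0) (Lf 186 0))) (Sx (Sx (Lf 189 0) (Lf 187 0)) (Sx (Lf 186 0) (Lf
    184 0))))) (Sx (Ux (Sx (Ux (Lf 185 0) (Lf 183 0)) (Ux (Lf 182 0) (Lf 179 0))) (Sx (Sx (Lf 182 0) (Lf 181 0)) (Sx (Lf 179 0)
    (Lf 178 0)))) (Ux (Sx (Ux (Lf 178 0) (Lf 176 0)) (Ux (Lf 175 0) (Lf 173 0))) (Sx (Sx (Lf 176 0) (Lf 175 0)) (Sx (Lf 173 0) (Lf
    172 0)))))) 128 256 128 192 = Some 45963685120"
    by code_simp
qed

lemma chunk_11: "certified 128 256 192 256 42283140608"
proof (rule certifiedI)
  show "cert_val (Sx (Sx (Ux (Sx (Sx (Lf 196 0) (Lf 195 0)) (Sx (Lf 193 0) (Lf 191 0))) (Sx (Sx (Lf 198 1) (Lf 197 1)) (Ux (Lf 193 1) (Lf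
    195 1)))) (Ux (Sx (Sx (Lf 189 1) (Lf 188 1)) (Sx (Lf 186 1) (Lf 185 1))) (Sx (Ux (Lf 190 1) (Lf 192 1)) (Ux (Lf 188 1) (Lf
    190 1))))) (Ux (Sx (Sx (Ux (Lf 182 0) (Lf 183 1)) (Ux (Lf 179 0) (Lf 180 1))) (Sx (Ux (Lf 176 1) (Lf 178 1)) (Ux (Lf 173 1)
    (Lf 175 1)))) (Sx (Sx (Ux (Lf 185 1) (Lf 187 1)) (Ux (Lf 182 1) (Lf 185 1))) (Sx (Ux (Lf 180 1) (Lf 182 1)) (Ux (Lf 177 1) (Lf
    180 1)))))) 128 256 192 256 = Some 42283140608"
    by code_simp
qed

lemma chunk_12: "certified 256 384 128 192 41447670784"
proof (rule certifiedI)
  show "cert_val (Sx (Ux (Sx (Sx (Ux (Lf 172 0) (Lf 170 0)) (Ux (Lf 168 0) (Lf 167 0))) (Sx (Ux (Lf 165 0) (Lf 164 0)) (Ux (Lf 162 0) (Lf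
    161 0)))) (Sx (Sx (Ux (Lf 169 0) (Lf 170 0)) (Ux (Lf 166 0) (Lf 167 0))) (Sx (Ux (Lf 164 0) (Lf 164 1)) (Ux (Lf 161 0) (Lf
    162 1))))) (Ux (Sx (Sx (Ux (Lf 159 0) (Lf 158 0)) (Ux (Lf 156 0) (Lf 155 0))) (Sx (Ux (Lf 153 0) (Lf 153 0)) (Ux (Lf 150 0)
    (Lf 150 0)))) (Sx (Sx (Ux (Lf 158 0) (Lf 159 1)) (Ux (Lf 156 0) (Lf 157 1))) (Sx (Ux (Lf 153 0) (Lf 155 1)) (Ux (Lf 151 1) (Lf
    152 1)))))) 256 384 128 192 = Some 41447670784"
    by code_simp
qed

lemma chunk_13: "certified 384 512 128 192 36899399168"
proof (rule certifiedI)
  show "cert_val (Sx (Ux (Sx (Sx (Ux (Lf 148 0) (Lf 147 0)) (Ux (Lf 145 0) (Lf 145 0))) (Sx (Ux (Lf 142 0) (Lf 142 0)) (Ux (Lf 140 0) (Lf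
    140 0)))) (Sx (Sx (Ux (Lf 148 1) (Lf 150 1)) (Ux (Lf 146 1) (Lf 148 1))) (Sx (Ux (Lf 144 1) (Lf 146 1)) (Ux (Lf 141 1) (Lf
    144 1))))) (Ux (Sx (Sx (Ux (Lf 137 0) (Lf 138 1)) (Ux (Lf 134 0) (Lf 135 1))) (Sx (Ux (Lf 132 0) (Lf 133 1)) (Ux (Lf 129 0)
    (Lf 131 1)))) (Sx (Ux (Sx (Lf 139 1) (Lf 137 1)) (Sx (Lf 142 1) (Lf 140 2))) (Ux (Sx (Lf 135 1) (Lf 133 1)) (Sx (Lf 138 2) (Lf
    136 2)))))) 384 512 128 192 = Some 36899399168"
    by code_simp
qed

lemma chunk_14: "certified 256 512 192 256 67886180352"
proof (rule certifiedI)
  show "cert_val (Sx (Sx (Ux (Sx (Sx (Ux (Lf 171 1) (Lf 173 1)) (Ux (Lf 168 1) (Lf 170 1))) (Sx (Ux (Lf 166 1) (Lf 168 1)) (Ux (Lf 163 1) (Lf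
    166 1)))) (Sx (Sx (Ux (Lf 175 1) (Lf 178 2)) (Ux (Lf 173 1) (Lf 176 2))) (Ux (Sx (Lf 171 1) (Lf 169 2)) (Sx (Lf 174 2) (Lf
    172 2))))) (Ux (Sx (Sx (Ux (Lf 161 1) (Lf 164 1)) (Ux (Lf 159 1) (Lf 162 1))) (Ux (Sx (Lf 157 1) (Lf 155 1)) (Sx (Lf 160 2)
    (Lf 158 2)))) (Sx (Ux (Sx (Lf 167 2) (Lf 165 2)) (Sx (Lf 170 2) (Lf 168 2))) (Ux (Sx (Lf 163 2) (Lf 161 2)) (Sx (Lf 167 2) (Lf
    165 2)))))) (Ux (Sx (Sx (Ux (Sx (Lf 153 1) (Lf 151 2)) (Sx (Lf 156 2) (Lf 154 2))) (Ux (Sx (Lf 149 2) (Lf 147 2)) (Sx (Lf 152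
    2) (Lf 150 2)))) (Sx (Ux (Sx (Lf 145 2) (Lf 143 2)) (Sx (Lf 149 2) (Lf 147 2))) (Ux (Sx (Lf 141 2) (Lf 140 2)) (Lf 145 2))))
    (Sx (Sx (Ux (Sx (Lf 159 2) (Lf 158 2)) (Lf 163 2)) (Ux (Sx (Lf 156 2) (Lf 155 2)) (Lf 160 2))) (Sx (Ux (Lf 152 2) (Lf 157 2))
    (Ux (Sx (Lf 150 2) (Lf 149 2)) (Lf 154 3)))))) 256 512 192 256 = Some 67886180352"
    by code_simp
qed

lemma chunk_15: "certified 0 128 256 320 47283060224"
proof (rule certifiedI)
  show "cert_val (Sx (Sx (Sx (Sx (Sx (Lf 249 0) (Lf 244 0)) (Sx (Lf 241 0) (Lf 238 0))) (Sx (Ux (Lf 234 0) (Lf 235 0)) (Ux (Lf 230 0) (Lf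
    232 1)))) (Sx (Ux (Sx (Lf 227 0) (Lf 224 1)) (Sx (Lf 229 1) (Lf 226 1))) (Ux (Sx (Lf 221 1) (Lf 218 1)) (Sx (Lf 223 1) (Lf
    221 1))))) (Sx (Ux (Sx (Sx (Lf 216 1) (Lf 214 1)) (Sx (Lf 212 1) (Lf 210 1))) (Sx (Sx (Lf 219 2) (Lf 217 2)) (Lf 215 2))) (Ux
    (Sx (Sx (Lf 208 1) (Lf 207 2)) (Ux (Lf 203 1) (Lf 205 1))) (Sx (Ux (Lf 210 1) (Lf 213 1)) (Ux (Lf 208 1) (Lf 210 1)))))) 0
    128 256 320 = Some 47283060224"
    by code_simp
qed

lemma chunk_16: "certified 128 256 256 320 39482277632"
proof (rule certifiedI)
  show "cert_val (Sx (Ux (Sx (Sx (Ux (Lf 200 1) (Lf 202 1)) (Ux (Lf 197 1) (Lf 200 1))) (Sx (Ux (Lf 194 1) (Lf 197 1)) (Ux (Lf 192 1) (Lf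
    195 1)))) (Sx (Sx (Ux (Lf 205 1) (Lf 208 1)) (Ux (Lf 202 1) (Lf 205 2))) (Sx (Ux (Lf 200 2) (Lf 203 2)) (Ux (Lf 198 2) (Lf
    201 2))))) (Ux (Sx (Sx (Ux (Lf 190 1) (Lf 193 2)) (Ux (Lf 187 1) (Lf 190 2))) (Sx (Ux (Lf 185 2) (Lf 188 2)) (Ux (Lf 183 2)
    (Lf 187 2)))) (Sx (Ux (Sx (Lf 196 2) (Lf 194 2)) (Sx (Lf 199 2) (Lf 198 2))) (Ux (Sx (Lf 192 2) (Lf 190 2)) (Lf 195 2)))))
    128 256 256 320 = Some 39482277632"
    by code_simp
qed

lemma chunk_17: "certified 256 512 256 320 61110876672"
proof (rule certifiedI)
  show "cert_val (Ux (Sx (Sx (Sx (Ux (Sx (Lf 181 2) (Lf 179 2)) (Sx (Lf 185 2) (Lf 183 2))) (Ux (Sx (Lf 177 2) (Lf 176 2)) (Sx (Lf 181 2) (Lf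
    180 2)))) (Sx (Ux (Sx (Lf 174 2) (Lf 172 2)) (Sx (Lf 178 2) (Lf 177 2))) (Ux (Lf 170 2) (Lf 175 2)))) (Sx (Sx (Ux (Lf 167 2)
    (Lf 172 2)) (Ux (Sx (Lf 165 2) (Lf 164 2)) (Lf 170 3))) (Ux (Sx (Lf 162 3) (Lf 160 3)) (Sx (Lf 167 3) (Lf 165 3))))) (Sx (Sx
    (Sx (Ux (Lf 188 2) (Lf 192 2)) (Ux (Lf 185 2) (Lf 189 2))) (Ux (Sx (Lf 182 2) (Lf 179 2)) (Sx (Lf 187 2) (Lf 184 3)))) (Sx (Ux
    (Sx (Lf 177 3) (Lf 175 3)) (Sx (Lf 182 3) (Lf 180 3))) (Ux (Sx (Lf 173 3) (Lf 171 3)) (Sx (Lf 178 3) (Lf 176 3)))))) 256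
    512 256 320 = Some 61110876672"
    by code_simp
qed

lemma chunk_18: "certified 0 256 320 384 84155346176"
proof (rule certifiedI)
  show "cert_val (Sx (Sx (Sx (Sx (Sx (Sx (Lf 250 0) (Lf 246 0)) (Ux (Lf 241 0) (Lf 243 0))) (Ux (Sx (Lf 237 1) (Lf 234 1)) (Sx (Lf 240 1) (Lf
    237 1)))) (Ux (Sx (Sx (Lf 231 1) (Lf 229 1)) (Lf 226 2)) (Sx (Lf 234 2) (Lf 231 2)))) (Ux (Sx (Sx (Lf 223 2) (Ux (Lf 218 1)
    (Lf 221 1))) (Sx (Lf 217 3) (Ux (Lf 213 1) (Lf 216 2)))) (Sx (Sx (Ux (Lf 226 1) (Lf 229 1)) (Ux (Lf 224 1) (Lf 227 2))) (Ux
    (Sx (Lf 221 1) (Lf 219 2)) (Lf 224 2))))) (Ux (Sx (Sx (Ux (Sx (Lf 211 2) (Lf 209 2)) (Sx (Lf 214 2) (Lf 212 2))) (Ux (Sx (Lf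
    207 2) (Lf 205 2)) (Sx (Lf 210 2) (Lf 209 2)))) (Sx (Ux (Lf 202 2) (Lf 206 2)) (Ux (Lf 199 2) (Lf 204 2)))) (Sx (Sx (Ux (Lf
    217 2) (Lf 220 2)) (Ux (Lf 213 2) (Lf 218 2))) (Ux (Sx (Lf 211 2) (Lf 208 2)) (Sx (Lf 215 2) (Lf 213 2)))))) 0 256 320
    384 = Some 84155346176"
    by code_simp
qed

lemma chunk_19: "certified 256 512 320 384 57273911296"
proof (rule certifiedI)
  show "cert_val (Ux (Sx (Sx (Ux (Sx (Lf 197 2) (Lf 194 2)) (Sx (Lf 201 2) (Lf 199 2))) (Ux (Sx (Lf 192 2) (Lf 190 3)) (Sx (Lf 197 3) (Lf
    195 3)))) (Sx (Ux (Sx (Lf 188 3) (Lf 186 3)) (Sx (Lf 193 3) (Lf 192 3))) (Ux (Sx (Lf 184 3) (Lf 182 3)) (Sx (Lf 190 3) (Lf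
    189 3))))) (Sx (Sx (Ux (Sx (Lf 206 2) (Lf 204 3)) (Sx (Lf 211 2) (Lf 209 3))) (Ux (Sx (Lf 202 3) (Lf 200 3)) (Sx (Lf 208 3)
    (Lf 206 3)))) (Ux (Sx (Sx (Lf 199 3) (Lf 197 3)) (Sx (Lf 196 3) (Lf 195 3))) (Sx (Lf 204 3) (Sx (Lf 202 3) (Lf 201 3))))))
    256 512 320 384 = Some 57273911296"
    by code_simp
qed

lemma chunk_20: "certified 0 512 384 448 138383173120"
proof (rule certifiedI)
  show "cert_val (Ux (Sx (Sx (Sx (Sx (Sx (Sx (Lf 250 0) (Lf 246 0)) (Lf 242 1)) (Sx (Lf 238 2) (Lf 236 2))) (Sx (Ux (Lf 231 1) (Lf 234 2))
    (Ux (Lf 227 2) (Lf 231 2)))) (Sx (Ux (Sx (Lf 224 2) (Lf 222 2)) (Sx (Lf 228 2) (Lf 226 2))) (Ux (Sx (Lf 220 2) (Lf 218 2)) (Sx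
    (Lf 224 2) (Lf 223 2))))) (Sx (Ux (Sx (Sx (Lf 216 3) (Lf 214 3)) (Sx (Lf 213 3) (Lf 212 3))) (Sx (Sx (Lf 221 3) (Lf 220 3))
    (Lf 218 3))) (Ux (Sx (Lf 210 3) (Lf 208 3)) (Sx (Lf 216 3) (Lf 214 3))))) (Sx (Sx (Sx (Sx (Sx (Lf 250 0) (Lf 246 1)) (Ux (Lf
    241 1) (Lf 243 1))) (Ux (Sx (Lf 237 2) (Lf 235 2)) (Sx (Lf 241 2) (Lf 238 2)))) (Ux (Sx (Sx (Lf 232 2) (Lf 231 2)) (Lf 228
    2)) (Sx (Lf 236 2) (Lf 233 2)))) (Ux (Sx (Sx (Lf 226 3) (Lf 224 3)) (Sx (Lf 222 3) (Lf 220 3))) (Sx (Sx (Lf 231 3) (Lf 230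
    3)) (Sx (Lf 228 3) (Lf 227 3)))))) 0 512 384 448 = Some 138383173120"
    by code_simp
qed

lemma chunk_21: "certified 0 512 448 512 137503386112"
proof (rule certifiedI)
  show "cert_val (Ux (Sx (Sx (Sx (Sx (Lf 251 0) (Ux (Lf 246 1) (Lf 249 1))) (Ux (Lf 243 2) (Lf 247 2))) (Ux (Sx (Lf 240 2) (Lf 238 2)) (Lf
    244 2))) (Ux (Sx (Lf 236 3) (Lf 234 3)) (Sx (Lf 242 3) (Lf 240 3)))) (Ux (Sx (Sx (Lf 251 1) (Lf 249 2)) (Ux (Lf 245 1) (Lf
    248 1))) (Ux (Lf 252 1) (Lf 255 1)))) 0 512 448 512 = Some 137503386112"
    by code_simp
qed

lemma chunk_22: "certified 512 768 0 16 25730185088"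
proof (rule certifiedI)
  show "cert_val (Ux (Ux (Ux (Lf 252 0) (Lf 244 0)) (Sx (Ux (Lf 241 0) (Lf 235 0)) (Ux (Lf 232 0) (Sx (Lf 227 0) (Lf 218 0))))) (Sx (Ux (Sx
    (Lf 229 0) (Ux (Lf 226 0) (Lf 220 0))) (Sx (Ux (Lf 222 0) (Lf 217 0)) (Ux (Lf 214 0) (Lf 208 0)))) (Ux (Sx (Ux (Lf 218 0) (Lf
    211 0)) (Ux (Lf 208 0) (Sx (Lf 202 0) (Lf 194 0)))) (Sx (Ux (Lf 203 0) (Sx (Lf 199 0) (Lf 193 0))) (Sx (Ux (Lf 193 0) (Lf 185
    0)) (Ux (Lf 185 0) (Lf 176 0))))))) 512 768 0 16 = Some 25730185088"
    by code_simp
qed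

lemma chunk_23: "certified 512 768 16 32 25300505792"
proof (rule certifiedI)
  show "cert_val (Sx (Ux (Sx (Ux (Sx (Lf 212 0) (Lf 207 0)) (Sx (Lf 203 0) (Lf 198 0))) (Ux (Sx (Lf 202 0) (Ux (Lf 199 0) (Lf 193 0))) (Sx
    (Lf 192 0) (Ux (Lf 188 0) (Lf 183 0))))) (Sx (Ux (Sx (Lf 195 0) (Lf 189 0)) (Sx (Lf 187 0) (Lf 181 0))) (Ux (Sx (Lf 182 0) (Lf
    175 0)) (Sx (Lf 174 0) (Lf 166 0))))) (Ux (Sx (Ux (Sx (Ux (Lf 193 0) (Lf 187 0)) (Ux (Lf 186 0) (Lf 179 0))) (Sx (Ux (Lf 181
    0) (Lf 175 0)) (Ux (Lf 172 0) (Lf 167 0)))) (Ux (Sx (Ux (Lf 177 0) (Lf 170 0)) (Ux (Lf 167 0) (Lf 160 0))) (Sx (Ux (Lf 163 0)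
    (Lf 157 0)) (Ux (Lf 153 0) (Lf 147 0))))) (Sx (Ux (Sx (Ux (Lf 170 0) (Lf 165 0)) (Ux (Lf 161 0) (Lf 156 0))) (Sx (Lf 158 0)
    (Sx (Lf 151 0) (Lf 146 0)))) (Sx (Ux (Ux (Lf 151 0) (Lf 146 0)) (Sx (Lf 142 0) (Lf 136 0))) (Ux (Sx (Lf 141 0) (Lf 135 0)) (Sx
    (Lf 131 0) (Lf 126 0))))))) 512 768 16 32 = Some 25300505792"
    by code_simp
qed

lemma chunk_24: "certified 512 640 32 64 24204656384"
proof (rule certifiedI)
  show "cert_val (Ux (Sx (Ux (Sx (Ux (Lf 180 0) (Lf 174 0)) (Ux (Lf 174 0) (Lf 167 0))) (Sx (Ux (Lf 168 0) (Lf 163 0)) (Ux (Lf 161 0) (Sx (Lf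
    157 0) (Lf 153 0))))) (Ux (Sx (Ux (Lf 166 0) (Lf 159 0)) (Ux (Lf 158 0) (Sx (Lf 153 0) (Lf 149 0)))) (Sx (Ux (Sx (Lf 155 0)
    (Lf 151 0)) (Sx (Lf 150 0) (Lf 146 0))) (Ux (Sx (Lf 147 0) (Lf 143 0)) (Sx (Lf 141 0) (Lf 137 0)))))) (Sx (Ux (Sx (Ux (Lf 158
    0) (Sx (Lf 155 0) (Lf 152 0))) (Ux (Sx (Lf 152 0) (Lf 148 0)) (Sx (Lf 148 0) (Lf 144 0)))) (Sx (Sx (Ux (Lf 151 0) (Lf 148 0))
    (Ux (Lf 148 0) (Lf 144 0))) (Sx (Ux (Lf 144 0) (Lf 141 0)) (Ux (Lf 140 0) (Lf 137 0))))) (Sx (Ux (Ux (Sx (Lf 145 0) (Lf 141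
    0)) (Sx (Lf 140 0) (Lf 136 0))) (Sx (Lf 135 0) (Lf 131 0))) (Ux (Ux (Sx (Lf 137 0) (Lf 133 0)) (Sx (Lf 132 0) (Lf 128 0)))
    (Sx (Lf 127 0) (Lf 123 0)))))) 512 640 32 64 = Some 24204656384"
    by code_simp
qed

lemma chunk_25: "certified 640 768 32 64 23096212416"
proof (rule certifiedI)
  show "cert_val (Sx (Ux (Ux (Sx (Ux (Sx (Lf 152 0) (Lf 147 0)) (Sx (Lf 145 0) (Lf 140 0))) (Ux (Sx (Lf 143 0) (Lf 138 0)) (Sx (Lf 136 0) (Lf
    131 0)))) (Sx (Ux (Sx (Lf 139 0) (Lf 134 0)) (Sx (Lf 133 0) (Lf 129 0))) (Ux (Sx (Lf 130 0) (Lf 125 0)) (Sx (Lf 124 0) (Lf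
    120 0))))) (Sx (Ux (Sx (Ux (Lf 128 0) (Lf 124 0)) (Ux (Lf 124 0) (Lf 120 0))) (Sx (Lf 120 0) (Lf 116 0))) (Ux (Sx (Ux (Lf 120
    0) (Lf 116 0)) (Ux (Lf 116 0) (Lf 112 0))) (Sx (Lf 112 0) (Lf 108 0))))) (Ux (Ux (Sx (Ux (Sx (Lf 133 0) (Lf 128 0)) (Sx (Lf
    126 0) (Lf 121 0))) (Ux (Sx (Lf 123 0) (Lf 118 0)) (Sx (Lf 116 0) (Lf 111 0)))) (Sx (Ux (Sx (Lf 120 0) (Lf 116 0)) (Sx (Lf
    116 0) (Lf 111 0))) (Sx (Ux (Lf 111 0) (Lf 106 0)) (Ux (Lf 106 0) (Lf 102 0))))) (Sx (Ux (Sx (Lf 110 0) (Lf 105 0)) (Sx (Lf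
    104 0) (Lf 100 0))) (Ux (Sx (Lf 101 0) (Lf 97 0)) (Sx (Lf 96 0) (Lf 92 0)))))) 640 768 32 64 = Some 23096212416"
    by code_simp
qed

lemma chunk_26: "certified 768 896 0 16 12798863392"
proof (rule certifiedI)
  show "cert_val (Ux (Ux (Ux (Lf 247 0) (Sx (Lf 233 0) (Lf 223 0))) (Sx (Ux (Lf 219 0) (Lf 205 0)) (Ux (Sx (Lf 207 0) (Lf 196 0)) (Sx (Lf
    190 0) (Lf 175 0))))) (Sx (Ux (Ux (Sx (Lf 196 0) (Lf 187 0)) (Sx (Lf 185 0) (Lf 174 0))) (Sx (Ux (Lf 175 0) (Lf 165 0)) (Ux
    (Lf 163 0) (Lf 152 0)))) (Ux (Sx (Ux (Lf 174 0) (Lf 160 0)) (Ux (Lf 158 0) (Sx (Lf 148 0) (Lf 138 0)))) (Sx (Ux (Lf 148 0) (Lf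
    137 0)) (Ux (Sx (Lf 135 0) (Lf 125 0)) (Sx (Lf 124 0) (Lf 115 0))))))) 768 896 0 16 = Some 12798863392"
    by code_simp
qed

text \<open>At the corner \<open>s = 1\<close>, \<open>u = 0\<close> the discs coincide and every
  cut is best; nearby, the best cut varies over almost the whole range from \<open>0\<close> to
  \<open>1 / 2\<close>. This explains the fine subdivision and the values of \<open>m\<close>
  between 236 and 10.\<close>

lemma chunk_27: "certified 896 1024 0 16 12522319392"
proof (rule certifiedI)
  show "cert_val (Sx (Ux (Ux (Ux (Lf 236 0) (Sx (Lf 207 0) (Lf 188 0))) (Sx (Ux (Lf 179 0) (Sx (Lf 161 0) (Lf 149 0))) (Ux (Sx (Lf 161 0) (Lf
    144 0)) (Sx (Lf 135 0) (Lf 118 0))))) (Sx (Ux (Ux (Sx (Lf 142 0) (Lf 130 0)) (Sx (Lf 127 0) (Lf 115 0))) (Sx (Ux (Lf 115 0)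
    (Lf 104 0)) (Ux (Lf 103 0) (Lf 93 0)))) (Ux (Sx (Ux (Lf 116 0) (Lf 101 0)) (Ux (Lf 100 0) (Lf 86 0))) (Sx (Ux (Lf 90 0) (Lf 81
    0)) (Lf 72 0))))) (Ux (Sx (Ux (Ux (Lf 216 0) (Sx (Lf 163 0) (Lf 136 0))) (Sx (Ux (Lf 124 0) (Lf 98 0)) (Ux (Lf 96 0) (Lf 74
    0)))) (Ux (Ux (Sx (Lf 178 0) (Sx (Lf 126 0) (Lf 50 0))) (Sx (Sx (Lf 107 0) (Lf 82 0)) (Sx (Lf 52 0) (Lf 19 0)))) (Sx (Sx (Lf 62
    0) (Lf 46 0)) (Sx (Lf 29 0) (Lf 12 0))))) (Sx (Sx (Ux (Ux (Lf 81 0) (Lf 70 0)) (Lf 59 0)) (Ux (Lf 56 0) (Lf 44 0))) (Sx (Sx (Lf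
    37 0) (Lf 28 0)) (Sx (Lf 19 0) (Lf 10 1)))))) 896 1024 0 16 = Some 12522319392"
    by code_simp
qed

lemma chunk_28: "certified 768 1024 16 32 23548005472"
proof (rule certifiedI)
  show "cert_val (Sx (Sx (Ux (Ux (Sx (Ux (Lf 156 0) (Lf 148 0)) (Ux (Lf 143 0) (Lf 135 0))) (Sx (Ux (Lf 141 0) (Lf 135 0)) (Sx (Lf 128 0) (Lf
    121 0)))) (Sx (Ux (Sx (Lf 129 0) (Lf 123 0)) (Sx (Lf 120 0) (Lf 114 0))) (Ux (Sx (Lf 117 0) (Lf 110 0)) (Sx (Lf 108 0) (Lf
    102 0))))) (Ux (Sx (Ux (Sx (Ux (Lf 132 0) (Lf 124 0)) (Ux (Lf 124 0) (Lf 116 0))) (Sx (Lf 114 0) (Lf 106 0))) (Ux (Sx (Ux (Lf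
    115 0) (Lf 108 0)) (Lf 102 0)) (Sx (Lf 98 0) (Lf 90 0)))) (Sx (Ux (Sx (Lf 103 0) (Lf 96 0)) (Sx (Lf 95 0) (Lf 89 0))) (Sx (Ux
    (Lf 89 0) (Lf 82 0)) (Ux (Lf 81 0) (Lf 75 0)))))) (Sx (Sx (Ux (Ux (Sx (Lf 93 0) (Lf 83 0)) (Sx (Lf 81 0) (Lf 73 0))) (Sx (Ux (Lf
    74 0) (Lf 68 0)) (Ux (Lf 66 0) (Lf 61 0)))) (Ux (Sx (Ux (Lf 72 0) (Lf 63 0)) (Ux (Lf 61 0) (Lf 54 0))) (Sx (Lf 56 0) (Lf 48
    0)))) (Sx (Sx (Ux (Lf 47 0) (Lf 40 0)) (Sx (Lf 37 0) (Lf 32 0))) (Sx (Sx (Lf 28 0) (Lf 23 0)) (Sx (Lf 19 2) (Lf 14 3))))))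
    768 1024 16 32 = Some 23548005472"
    by code_simp
qed

lemma chunk_29: "certified 768 1024 32 64 41000353344"
proof (rule certifiedI)
  show "cert_val (Sx (Sx (Ux (Sx (Ux (Ux (Sx (Lf 112 0) (Lf 107 0)) (Sx (Lf 106 0) (Lf 101 0))) (Sx (Ux (Lf 101 0) (Lf 97 0)) (Ux (Lf 96 0)
    (Lf 92 0)))) (Ux (Sx (Ux (Lf 101 0) (Lf 95 0)) (Ux (Lf 95 0) (Lf 90 0))) (Sx (Lf 89 0) (Lf 84 0)))) (Sx (Sx (Ux (Lf 92 0) (Lf
    88 0)) (Ux (Lf 88 0) (Lf 84 0))) (Sx (Ux (Lf 83 0) (Lf 80 0)) (Ux (Lf 79 0) (Lf 76 0))))) (Sx (Ux (Ux (Sx (Ux (Lf 89 0) (Lf 84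
    0)) (Ux (Lf 83 0) (Lf 79 0))) (Sx (Lf 79 0) (Lf 74 0))) (Sx (Ux (Lf 75 0) (Lf 72 0)) (Lf 69 0))) (Ux (Sx (Ux (Lf 75 0) (Lf 69
    0)) (Ux (Lf 69 0) (Lf 64 0))) (Sx (Lf 65 0) (Lf 61 0))))) (Sx (Sx (Sx (Ux (Ux (Lf 63 0) (Lf 59 0)) (Lf 57 0)) (Ux (Ux (Lf 57 0)
    (Lf 54 0)) (Lf 53 0))) (Sx (Ux (Lf 50 0) (Lf 49 1)) (Ux (Lf 44 0) (Lf 45 2)))) (Sx (Sx (Ux (Lf 39 0) (Lf 41 2)) (Ux (Lf 33 1)
    (Lf 37 3))) (Sx (Ux (Lf 28 2) (Lf 34 3)) (Ux (Lf 23 3) (Lf 30 4)))))) 768 1024 32 64 = Some 41000353344"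
    by code_simp
qed

lemma chunk_30: "certified 512 640 64 128 41041084544"
proof (rule certifiedI)
  show "cert_val (Sx (Ux (Ux (Sx (Ux (Sx (Lf 143 0) (Lf 140 0)) (Sx (Lf 138 0) (Lf 135 0))) (Ux (Sx (Lf 136 0) (Lf 133 0)) (Sx (Lf 131 0) (Lf
    128 0)))) (Sx (Sx (Ux (Lf 134 0) (Lf 132 0)) (Ux (Lf 131 0) (Lf 128 0))) (Sx (Ux (Lf 128 0) (Lf 125 0)) (Ux (Lf 125 0) (Lf
    122 0))))) (Sx (Sx (Ux (Lf 129 0) (Lf 127 0)) (Ux (Lf 126 0) (Lf 124 0))) (Sx (Ux (Lf 123 0) (Lf 122 0)) (Ux (Lf 120 0) (Lf
    119 0))))) (Ux (Sx (Ux (Ux (Sx (Lf 129 0) (Lf 125 0)) (Sx (Lf 125 0) (Lf 121 0))) (Sx (Ux (Lf 121 0) (Lf 119 0)) (Lf 117 0)))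
    (Ux (Ux (Sx (Lf 122 0) (Lf 118 0)) (Sx (Lf 118 0) (Lf 114 0))) (Sx (Lf 114 0) (Lf 111 0)))) (Sx (Sx (Ux (Lf 117 0) (Lf 117 0))
    (Ux (Lf 114 0) (Lf 114 0))) (Sx (Ux (Lf 112 0) (Lf 112 0)) (Ux (Lf 109 0) (Lf 109 1)))))) 512 640 64 128 = Some
    41041084544"
    by code_simp
qed

lemma chunk_31: "certified 640 768 64 128 37308867968"
proof (rule certifiedI)
  show "cert_val (Sx (Ux (Sx (Ux (Sx (Ux (Lf 114 0) (Lf 111 0)) (Ux (Lf 111 0) (Lf 108 0))) (Sx (Lf 108 0) (Lf 105 0))) (Ux (Sx (Ux (Lf 107
    0) (Lf 104 0)) (Ux (Lf 104 0) (Lf 101 0))) (Sx (Lf 102 0) (Lf 99 0)))) (Sx (Ux (Sx (Lf 106 0) (Lf 104 0)) (Sx (Lf 107 1) (Lf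
    105 1))) (Ux (Sx (Lf 101 0) (Lf 98 0)) (Sx (Lf 102 1) (Lf 100 1))))) (Ux (Sx (Ux (Sx (Ux (Lf 100 0) (Lf 97 0)) (Lf 95 0)) (Sx
    (Lf 96 0) (Lf 93 0))) (Ux (Sx (Lf 92 0) (Lf 88 0)) (Sx (Lf 90 0) (Lf 87 0)))) (Sx (Ux (Sx (Lf 96 1) (Lf 93 1)) (Sx (Lf 98 1)
    (Lf 95 1))) (Ux (Sx (Lf 91 1) (Lf 88 1)) (Sx (Lf 93 2) (Lf 91 2)))))) 640 768 64 128 = Some 37308867968"
    by code_simp
qed

lemma chunk_32: "certified 768 896 64 128 33467481088"
proof (rule certifiedI)
  show "cert_val (Ux (Sx (Sx (Sx (Ux (Lf 85 0) (Lf 84 0)) (Ux (Lf 81 0) (Lf 81 1))) (Ux (Sx (Lf 78 0) (Lf 75 0)) (Sx (Lf 78 1) (Lf 76 1))))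
    (Sx (Ux (Sx (Lf 71 0) (Lf 68 0)) (Sx (Lf 73 1) (Lf 70 2))) (Ux (Sx (Lf 65 1) (Lf 62 1)) (Sx (Lf 68 2) (Lf 65 2))))) (Sx (Sx (Ux
    (Sx (Lf 86 1) (Lf 83 1)) (Sx (Lf 89 2) (Lf 87 2))) (Ux (Sx (Lf 81 2) (Lf 79 2)) (Sx (Lf 85 2) (Lf 83 2)))) (Sx (Ux (Sx (Lf 76
    2) (Lf 74 2)) (Sx (Lf 81 2) (Lf 79 3))) (Ux (Sx (Lf 72 2) (Lf 70 3)) (Sx (Lf 77 3) (Lf 75 3)))))) 768 896 64 128 = Some
    33467481088"
    by code_simp
qed

lemma chunk_33: "certified 896 1024 64 128 29726174976"
proof (rule certifiedI)
  show "cert_val (Ux (Sx (Sx (Ux (Sx (Lf 59 1) (Lf 55 2)) (Sx (Lf 62 2) (Lf 60 3))) (Ux (Sx (Lf 52 2) (Lf 49 2)) (Sx (Lf 57 3) (Lf 55 3))))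
    (Sx (Ux (Sx (Lf 46 3) (Lf 43 3)) (Sx (Lf 52 3) (Lf 50 3))) (Ux (Sx (Lf 40 3) (Lf 37 4)) (Sx (Lf 48 4) (Lf 45 4))))) (Sx (Sx (Ux
    (Sx (Lf 67 3) (Lf 65 3)) (Sx (Lf 73 3) (Lf 71 3))) (Ux (Sx (Lf 63 3) (Lf 61 3)) (Sx (Lf 70 3) (Lf 68 3)))) (Ux (Sx (Sx (Lf 59
    3) (Lf 57 4)) (Sx (Lf 55 4) (Lf 53 4))) (Sx (Lf 65 4) (Lf 62 4))))) 896 1024 64 128 = Some 29726174976"
    by code_simp
qed

lemma chunk_34: "certified 512 768 128 192 61293739776"
proof (rule certifiedI)
  show "cert_val (Sx (Ux (Sx (Sx (Ux (Sx (Lf 127 0) (Lf 125 1)) (Sx (Lf 128 1) (Lf 126 1))) (Ux (Sx (Lf 122 1) (Lf 120 1)) (Sx (Lf 124 1) (Lf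
    122 1)))) (Sx (Ux (Sx (Lf 118 1) (Lf 116 1)) (Sx (Lf 120 1) (Lf 118 2))) (Ux (Sx (Lf 113 1) (Lf 111 1)) (Sx (Lf 116 2) (Lf
    114 2))))) (Sx (Sx (Ux (Sx (Lf 131 1) (Lf 129 2)) (Sx (Lf 134 2) (Lf 132 2))) (Ux (Sx (Lf 127 2) (Lf 125 2)) (Sx (Lf 131 2)
    (Lf 129 2)))) (Sx (Ux (Sx (Lf 123 2) (Lf 122 2)) (Sx (Lf 127 2) (Lf 126 2))) (Ux (Sx (Lf 120 2) (Lf 118 2)) (Sx (Lf 124 2) (Lf
    123 2)))))) (Ux (Sx (Sx (Ux (Sx (Lf 109 1) (Lf 107 1)) (Sx (Lf 112 2) (Lf 110 2))) (Ux (Sx (Lf 105 2) (Lf 103 2)) (Sx (Lf 109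
    2) (Lf 107 2)))) (Sx (Ux (Sx (Lf 101 2) (Lf 99 2)) (Sx (Lf 105 2) (Lf 103 2))) (Ux (Sx (Lf 97 2) (Lf 95 2)) (Sx (Lf 102 2) (Lf
    100 3))))) (Sx (Sx (Ux (Sx (Lf 116 2) (Lf 115 2)) (Lf 120 2)) (Ux (Sx (Lf 113 2) (Lf 111 2)) (Lf 117 3))) (Ux (Sx (Lf 109 3)
    (Lf 106 3)) (Sx (Sx (Lf 115 3) (Lf 114 3)) (Lf 112 3)))))) 512 768 128 192 = Some 61293739776"
    by code_simp
qed

lemma chunk_35: "certified 768 1024 128 192 47446646528"
proof (rule certifiedI)
  show "cert_val (Ux (Sx (Sx (Sx (Ux (Sx (Lf 93 2) (Lf 91 2)) (Sx (Lf 98 3) (Lf 97 3))) (Ux (Sx (Lf 90 3) (Lf 88 3)) (Lf 94 3))) (Ux (Sx (Sx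
    (Lf 86 3) (Lf 84 3)) (Lf 82 3)) (Sx (Lf 91 3) (Lf 88 3)))) (Sx (Ux (Sx (Lf 79 3) (Sx (Lf 76 3) (Lf 75 4))) (Sx (Lf 85 3) (Lf
    83 4))) (Ux (Sx (Lf 72 4) (Lf 69 4)) (Sx (Lf 80 4) (Lf 77 4))))) (Sx (Sx (Ux (Sx (Lf 103 3) (Lf 100 3)) (Sx (Lf 109 3) (Lf 107
    3))) (Ux (Sx (Lf 98 3) (Lf 95 3)) (Sx (Lf 104 3) (Lf 102 3)))) (Sx (Ux (Sx (Lf 92 4) (Lf 90 4)) (Sx (Lf 99 4) (Lf 97 4))) (Ux
    (Sx (Lf 87 4) (Lf 85 4)) (Sx (Lf 95 4) (Lf 93 4)))))) 768 1024 128 192 = Some 47446646528"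
    by code_simp
qed

lemma chunk_36: "certified 512 768 192 256 50686304000"
proof (rule certifiedI)
  show "cert_val (Ux (Sx (Sx (Sx (Ux (Sx (Lf 138 2) (Lf 137 2)) (Lf 142 2)) (Ux (Lf 134 2) (Lf 139 2))) (Ux (Sx (Lf 131 2) (Lf 128 3)) (Sx
    (Lf 136 3) (Lf 134 3)))) (Sx (Ux (Sx (Sx (Lf 126 3) (Lf 125 3)) (Lf 123 3)) (Sx (Lf 131 3) (Lf 129 3))) (Ux (Sx (Lf 120 3) (Lf
    118 3)) (Sx (Lf 126 3) (Lf 124 3))))) (Sx (Sx (Ux (Sx (Lf 147 2) (Lf 144 3)) (Sx (Lf 152 3) (Lf 149 3))) (Ux (Sx (Lf 142 3)
    (Lf 139 3)) (Sx (Lf 147 3) (Lf 145 3)))) (Sx (Ux (Sx (Lf 137 3) (Lf 135 3)) (Sx (Lf 143 3) (Lf 141 3))) (Ux (Sx (Lf 133 3) (Lf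
    131 3)) (Sx (Lf 139 3) (Lf 137 3)))))) 512 768 192 256 = Some 50686304000"
    by code_simp
qed

lemma chunk_37: "certified 768 1024 192 256 38568073216"
proof (rule certifiedI)
  show "cert_val (Ux (Sx (Sx (Ux (Sx (Lf 115 3) (Lf 113 3)) (Sx (Lf 122 3) (Lf 120 3))) (Ux (Sx (Lf 111 3) (Lf 109 4)) (Sx (Lf 118 3) (Lf
    116 4)))) (Ux (Sx (Sx (Lf 107 4) (Lf 105 4)) (Sx (Lf 103 4) (Lf 101 4))) (Sx (Sx (Lf 114 4) (Lf 112 4)) (Sx (Lf 111 4) (Lf
    109 4))))) (Sx (Ux (Sx (Sx (Lf 129 3) (Lf 127 3)) (Sx (Lf 125 4) (Lf 123 4))) (Sx (Sx (Lf 135 3) (Lf 134 4)) (Sx (Lf 132 4)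
    (Lf 130 4)))) (Ux (Sx (Sx (Lf 121 4) (Lf 120 4)) (Sx (Lf 118 4) (Lf 117 4))) (Sx (Sx (Lf 129 4) (Lf 127 4)) (Sx (Lf 126 4) (Lf
    125 4)))))) 768 1024 192 256 = Some 38568073216"
    by code_simp
qed

lemma chunk_38: "certified 512 1024 256 320 78100530688"
proof (rule certifiedI)
  show "cert_val (Ux (Sx (Sx (Sx (Ux (Sx (Lf 157 3) (Lf 155 3)) (Sx (Lf 163 3) (Lf 161 3))) (Ux (Sx (Lf 153 3) (Lf 151 3)) (Sx (Lf 159 3) (Lf
    157 3)))) (Ux (Sx (Sx (Lf 149 3) (Lf 147 3)) (Sx (Lf 146 3) (Lf 144 3))) (Sx (Sx (Lf 156 3) (Lf 154 3)) (Sx (Lf 152 3) (Lf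
    151 3))))) (Sx (Ux (Sx (Sx (Lf 142 3) (Lf 141 4)) (Sx (Lf 139 4) (Lf 138 4))) (Sx (Sx (Lf 149 4) (Lf 148 4)) (Lf 146 4))) (Ux
    (Sx (Lf 136 4) (Lf 133 4)) (Sx (Sx (Lf 144 4) (Lf 143 4)) (Lf 141 4))))) (Sx (Sx (Sx (Ux (Sx (Lf 169 3) (Lf 167 3)) (Sx (Lf 175
    3) (Lf 173 3))) (Ux (Sx (Lf 165 3) (Lf 164 3)) (Sx (Lf 172 3) (Lf 170 3)))) (Ux (Sx (Sx (Lf 162 3) (Lf 161 3)) (Sx (Lf 159 3)
    (Lf 158 3))) (Sx (Lf 168 3) (Sx (Lf 166 3) (Lf 165 4))))) (Sx (Ux (Sx (Lf 156 4) (Sx (Lf 154 4) (Lf 153 4))) (Sx (Lf 163 4)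
    (Lf 161 4))) (Ux (Sx (Lf 151 4) (Lf 149 4)) (Sx (Lf 159 4) (Lf 157 4)))))) 512 1024 256 320 = Some 78100530688"
    by code_simp
qed

lemma chunk_39: "certified 512 1024 320 384 72160296960"
proof (rule certifiedI)
  show "cert_val (Ux (Sx (Sx (Ux (Sx (Sx (Lf 181 3) (Lf 179 3)) (Sx (Lf 178 3) (Lf 177 3))) (Sx (Sx (Lf 187 3) (Lf 186 3)) (Lf 184 3))) (Ux
    (Sx (Lf 175 3) (Sx (Lf 173 3) (Lf 172 4))) (Sx (Lf 182 3) (Lf 180 4)))) (Ux (Sx (Sx (Lf 170 4) (Lf 168 4)) (Sx (Lf 167 4) (Lf
    165 4))) (Sx (Sx (Lf 178 4) (Lf 176 4)) (Sx (Lf 174 4) (Lf 173 4))))) (Sx (Ux (Sx (Sx (Lf 193 3) (Lf 191 3)) (Sx (Lf 189 3)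
    (Lf 187 4))) (Sx (Sx (Lf 199 3) (Lf 197 3)) (Sx (Lf 196 4) (Lf 194 4)))) (Ux (Sx (Sx (Lf 185 4) (Lf 183 4)) (Sx (Lf 182 4) (Lf
    181 4))) (Sx (Sx (Lf 192 4) (Lf 191 4)) (Ux (Lf 187 2) (Lf 191 2)))))) 512 1024 320 384 = Some 72160296960"
    by code_simp
qed

lemma chunk_40: "certified 512 1024 384 512 138288925696"
proof (rule certifiedI)
  show "cert_val (Ux (Ux (Ux (Sx (Sx (Sx (Lf 206 3) (Lf 204 3)) (Sx (Lf 203 4) (Lf 201 4))) (Sx (Ux (Lf 197 2) (Lf 201 2)) (Ux (Lf 195 2) (Lf
    199 2)))) (Sx (Sx (Sx (Lf 212 3) (Lf 211 3)) (Lf 209 4)) (Sx (Ux (Lf 205 2) (Lf 209 2)) (Ux (Lf 203 2) (Lf 207 2))))) (Ux (Sx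
    (Sx (Sx (Lf 219 3) (Lf 218 3)) (Ux (Lf 214 2) (Lf 218 2))) (Sx (Ux (Lf 212 2) (Lf 216 2)) (Ux (Lf 211 2) (Lf 215 2)))) (Sx (Sx
    (Lf 225 3) (Ux (Lf 222 2) (Lf 225 2))) (Ux (Lf 219 2) (Lf 223 2))))) (Ux (Ux (Sx (Ux (Lf 230 2) (Lf 233 2)) (Ux (Lf 227 2) (Lf
    231 2))) (Ux (Sx (Lf 237 2) (Lf 235 2)) (Sx (Lf 240 2) (Lf 239 2)))) (Ux (Ux (Lf 243 2) (Lf 247 2)) (Ux (Lf 251 2) (Lf 254
    2))))) 512 1024 384 512 = Some 138288925696"
    by code_simp
qed

text \<open>The nesting repeats the bisections of the unit square. The total divided by
  \<open>6 * 2 ^ 39\<close> is about \<open>0.6400998\<close>, just below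
  \<open>0.6401\<close>.\<close>

lemma certified_square: "certified 0 1024 0 512 2111391383712"
  using certified_S[OF certified_U[OF certified_U[OF certified_U[OF certified_S[OF chunk_0 certified_U[OF chunk_1
    certified_S[OF chunk_2 chunk_3]]] certified_S[OF certified_S[OF chunk_4 chunk_5] certified_S[OF chunk_6
    chunk_7]]] certified_S[OF certified_S[OF certified_S[OF chunk_8 chunk_9] certified_U[OF chunk_10 chunk_11]]
    certified_U[OF certified_S[OF chunk_12 chunk_13] chunk_14]]] certified_U[OF certified_U[OF certified_S[OF
    certified_S[OF chunk_15 chunk_16] chunk_17] certified_S[OF chunk_18 chunk_19]] certified_U[OF chunk_20
    chunk_21]]] certified_U[OF certified_U[OF certified_U[OF certified_S[OF certified_U[OF certified_U[OF chunk_22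
    chunk_23] certified_S[OF chunk_24 chunk_25]] certified_U[OF certified_U[OF certified_S[OF chunk_26 chunk_27]
    chunk_28] chunk_29]] certified_S[OF certified_S[OF chunk_30 chunk_31] certified_S[OF chunk_32 chunk_33]]]
    certified_U[OF certified_S[OF chunk_34 chunk_35] certified_S[OF chunk_36 chunk_37]]] certified_U[OF
    certified_U[OF chunk_38 chunk_39] chunk_40]]]
  by simp

lemma inverse_square_integral_le:
  assumes "above_lines B" "(\<lambda>p. B (fst p) (snd p)) \<in> borel_measurable (lborel \<Otimes>\<^sub>M lborel)"
  shows "rect_integral B 0 1 0 1 \<le> ennreal 0.6401"
proof -
  obtain t where "cert_val t 0 1024 0 512 = Some 2111391383712"
    using certified_square by (auto simp: certified_def)
  from cert_val_sound[OF assms this] have "rect_integral B 0 1 0 1 \<le> ennreal (of_int 2111391383712 / (6 * 2 ^ 39))"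
    by (simp add: grid_integral_def)
  also have "\<dots> \<le> ennreal 0.6401" by (intro ennreal_leI) simp
  finally show ?thesis .
qed

subsection \<open>Polar coordinates\<close>

text \<open>Preimages of boxes are boxes of the same volume, and this determines Lebesgue measure.
  The space is left open because the lemma serves for the complex plane and for
  \<open>real ^ 2\<close>.\<close>

lemma distr_lborel_basis2:
  fixes b1 b2 :: "'a::euclidean_space"
  assumes "Basis = {b1, b2}" "b1 \<noteq> b2"
  shows "distr (lborel :: (real \<times> real) measure) borel (\<lambda>(x, y). x *\<^sub>R b1 + y *\<^sub>R b2) = lborel"
proof (rule lborel_eqI[symmetric])
  show "sets (distr lborel borel (\<lambda>(x, y). x *\<^sub>R b1 + y *\<^sub>R b2)) = sets borel" by simp
next
  fix l u :: 'a assume lu: "\<And>b. b \<in> Basis \<Longrightarrow> l \<bullet> b \<le> u \<bullet> b"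
  have le: "l \<bullet> b1 \<le> u \<bullet> b1" "l \<bullet> b2 \<le> u \<bullet> b2" by (simp_all add: lu assms(1))
  have inner: "(x *\<^sub>R b1 + y *\<^sub>R b2) \<bullet> b1 = x" "(x *\<^sub>R b1 + y *\<^sub>R b2) \<bullet> b2 = y" for x y
    using inner_not_same_Basis[of b1 b2] inner_not_same_Basis[of b2 b1] inner_same_Basis[of b1] inner_same_Basis[of b2]
    using assms(2) assms(2)[symmetric] by (simp_all add: assms(1) inner_left_distrib)
  have meas[measurable]: "(\<lambda>(x, y). x *\<^sub>R b1 + y *\<^sub>R b2) \<in> (borel :: (real \<times> real) measure) \<rightarrow>\<^sub>M (borel :: 'a measure)"
    by (intro borel_measurable_continuous_onI) (auto simp: case_prod_beta intro!: continuous_intros)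
  have "(\<lambda>(x, y). x *\<^sub>R b1 + y *\<^sub>R b2) -` box l u = box (l \<bullet> b1, l \<bullet> b2) (u \<bullet> b1, u \<bullet> b2)"
    by (auto simp: mem_box assms(1) inner Basis_prod_def)
  then have "emeasure (distr lborel borel (\<lambda>(x, y). x *\<^sub>R b1 + y *\<^sub>R b2)) (box l u)
    = emeasure lborel (box (l \<bullet> b1, l \<bullet> b2) (u \<bullet> b1, u \<bullet> b2))"
    by (subst emeasure_distr) auto
  also have "\<dots> = (\<Prod>b\<in>Basis. ((u \<bullet> b1, u \<bullet> b2) - (l \<bullet> b1, l \<bullet> b2)) \<bullet> b)"
    using le assms(1) by (subst emeasure_lborel_box) (auto simp: Basis_prod_def)
  also have "(\<Prod>b\<in>Basis. ((u \<bullet> b1, u \<bullet> b2) - (l \<bullet> b1, l \<bullet> b2)) \<bullet> b) = (u - l) \<bullet> b1 * ((u - l) \<bullet> b2)"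
    by (simp add: Basis_prod_def prod.union_disjoint inner_diff_left)
  also have "\<dots> = (\<Prod>b\<in>Basis. (u - l) \<bullet> b)" using assms(2) by (simp add: assms(1))
  finally show "emeasure (distr lborel borel (\<lambda>(x, y). x *\<^sub>R b1 + y *\<^sub>R b2)) (box l u) = (\<Prod>b\<in>Basis. (u - l) \<bullet> b)" .
qed

lemma measurable_Complex [measurable]:
  "(\<lambda>p. Complex (fst p) (snd p)) \<in> borel_measurable (borel \<Otimes>\<^sub>M borel)"
  unfolding Complex_eq by measurable

lemma nn_integral_lborel_complex:
  assumes [measurable]: "f \<in> borel_measurable borel"
  shows "(\<integral>\<^sup>+z. f z \<partial>(lborel :: complex measure)) = (\<integral>\<^sup>+x. \<integral>\<^sup>+y. f (Complex x y) \<partial>lborel \<partial>lborel)"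
proof -
  have eq: "(\<lambda>(x, y). x *\<^sub>R 1 + y *\<^sub>R \<i>) = (\<lambda>p. Complex (fst p) (snd p))"
    by (auto simp: fun_eq_iff complex_eq_iff)
  have "lborel = distr (lborel :: (real \<times> real) measure) borel (\<lambda>p. Complex (fst p) (snd p))"
    using distr_lborel_basis2[of 1 \<i>] by (simp add: Basis_complex_def complex_eq_iff eq)
  then have "(\<integral>\<^sup>+z. f z \<partial>(lborel :: complex measure))
      = (\<integral>\<^sup>+z. f z \<partial>distr (lborel \<Otimes>\<^sub>M lborel) borel (\<lambda>p. Complex (fst p) (snd p)))"
    by (simp add: lborel_prod)
  also have "\<dots> = (\<integral>\<^sup>+p. f (Complex (fst p) (snd p)) \<partial>(lborel \<Otimes>\<^sub>M lborel))"
    by (subst nn_integral_distr) simp_all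
  also have "\<dots> = (\<integral>\<^sup>+x. \<integral>\<^sup>+y. f (Complex x y) \<partial>lborel \<partial>lborel)"
    by (subst lborel.nn_integral_fst[symmetric]) simp_all
  finally show ?thesis .
qed

lemma measurable_Complex_pair [measurable (raw)]:
  assumes [measurable]: "f \<in> borel_measurable M" "g \<in> borel_measurable M"
  shows "(\<lambda>x. Complex (f x) (g x)) \<in> borel_measurable M"
  unfolding Complex_eq by measurable

text \<open>With \<open>a = p + i q\<close>, the multiplication is composed of affine substitutions
  in one real variable at a time, with factors \<open>(p^2 + q^2) / p\<close> and \<open>p\<close>,
  whose product is \<open>|a|^2\<close>. The case \<open>p = 0\<close> only scales and exchanges the
  coordinates.\<close>

lemma nn_integral_mult_complex:
  assumes [measurable]: "f \<in> borel_measurable borel" and "a \<noteq> 0"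
  shows "(\<integral>\<^sup>+z. f z \<partial>(lborel :: complex measure)) = ennreal ((norm a)\<^sup>2) * (\<integral>\<^sup>+z. f (a * z) \<partial>lborel)"
proof -
  obtain p q where a: "a = Complex p q" by (cases a)
  have na: "(norm a)\<^sup>2 = p\<^sup>2 + q\<^sup>2" by (simp add: a cmod_def)
  have R: "(\<integral>\<^sup>+z. f (a * z) \<partial>lborel) = (\<integral>\<^sup>+y. \<integral>\<^sup>+x. f (Complex (p * x - q * y) (p * y + q * x)) \<partial>lborel \<partial>lborel)"
    by (subst nn_integral_lborel_complex, simp, subst lborel_pair.Fubini') (simp_all add: a complex_mult)
  show ?thesis
  proof (cases "p = 0")
    case True
    then have q: "q \<noteq> 0" using \<open>a \<noteq> 0\<close> by (auto simp: a complex_eq_iff)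
    have "(\<integral>\<^sup>+z. f z \<partial>(lborel :: complex measure)) = (\<integral>\<^sup>+x. \<integral>\<^sup>+y. f (Complex x y) \<partial>lborel \<partial>lborel)"
      by (rule nn_integral_lborel_complex) simp
    also have "\<dots> = (\<integral>\<^sup>+x. ennreal \<bar>q\<bar> * (\<integral>\<^sup>+y. f (Complex x (q * y)) \<partial>lborel) \<partial>lborel)"
      using q by (intro nn_integral_cong, subst nn_integral_real_affine[where c = q and t = 0]) simp_all
    also have "\<dots> = ennreal \<bar>-q\<bar> * (\<integral>\<^sup>+x. ennreal \<bar>q\<bar> * (\<integral>\<^sup>+y. f (Complex (- q * x) (q * y)) \<partial>lborel) \<partial>lborel)"
      using q by (subst nn_integral_real_affine[where c = "-q" and t = 0]) simp_all
    also have "\<dots> = ennreal \<bar>-q\<bar> * (ennreal \<bar>q\<bar> * (\<integral>\<^sup>+y. \<integral>\<^sup>+x. f (Complex (- q * y) (q * x)) \<partial>lborel \<partial>lborel))"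
      by (subst nn_integral_cmult) simp_all
    finally show ?thesis unfolding R na using True
      by (simp add: mult.assoc[symmetric] power2_eq_square flip: ennreal_mult)
  next
    case False
    have pos: "0 < (p\<^sup>2 + q\<^sup>2)" using False by (simp add: add_pos_nonneg)
    have "(\<integral>\<^sup>+z. f z \<partial>(lborel :: complex measure)) = (\<integral>\<^sup>+x. \<integral>\<^sup>+y. f (Complex x y) \<partial>lborel \<partial>lborel)"
      by (rule nn_integral_lborel_complex) simp
    also have "\<dots> = (\<integral>\<^sup>+x. ennreal \<bar>(p\<^sup>2 + q\<^sup>2) / p\<bar> * (\<integral>\<^sup>+y. f (Complex x (q / p * x + (p\<^sup>2 + q\<^sup>2) / p * y)) \<partial>lborel) \<partial>lborel)"
      using False pos by (intro nn_integral_cong, subst nn_integral_real_affine[where c = "(p\<^sup>2 + q\<^sup>2) / p" and t = "q / p * _"]) simp_all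
    also have "\<dots> = ennreal \<bar>(p\<^sup>2 + q\<^sup>2) / p\<bar> * (\<integral>\<^sup>+y. (\<integral>\<^sup>+x. f (Complex x (q / p * x + (p\<^sup>2 + q\<^sup>2) / p * y)) \<partial>lborel) \<partial>lborel)"
      by (subst nn_integral_cmult, simp, subst lborel_pair.Fubini') simp_all
    also have "\<dots> = ennreal \<bar>(p\<^sup>2 + q\<^sup>2) / p\<bar> * (\<integral>\<^sup>+y. ennreal \<bar>p\<bar> *
       (\<integral>\<^sup>+x. f (Complex (- q * y + p * x) (q / p * (- q * y + p * x) + (p\<^sup>2 + q\<^sup>2) / p * y)) \<partial>lborel) \<partial>lborel)"
      using False by (intro arg_cong2[where f = "(*)"] refl nn_integral_cong, subst nn_integral_real_affine[where c = p and t = "- q * _"]) simp_all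
    also have "\<dots> = ennreal \<bar>(p\<^sup>2 + q\<^sup>2) / p\<bar> * (ennreal \<bar>p\<bar> * (\<integral>\<^sup>+y. (\<integral>\<^sup>+x. f (Complex (p * x - q * y) (p * y + q * x)) \<partial>lborel) \<partial>lborel))"
    proof -
      have "q / p * (- q * y + p * x) + (p\<^sup>2 + q\<^sup>2) / p * y = p * y + q * x" for x y
        using False by (simp add: field_simps power2_eq_square)
      then show ?thesis by (subst nn_integral_cmult) simp_all
    qed
    finally show ?thesis unfolding R na using False pos
      by (simp add: mult.assoc[symmetric] flip: ennreal_mult)
  qed
qed

section \<open>Substitution on the line and polar coordinates\<close>

lemma nn_integral_indicator_Union:
  assumes "incseq A" "range A \<subseteq> sets M" "f \<in> borel_measurable M"
  shows "(\<integral>\<^sup>+x. f x * indicator (\<Union>n. A n) x \<partial>M) = (SUP n. \<integral>\<^sup>+x. f x * indicator (A n) x \<partial>M)"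
proof -
  have "(SUP n. emeasure (density M f) (A n)) = emeasure (density M f) (\<Union>n. A n)"
    using assms by (intro SUP_emeasure_incseq) auto
  moreover have "emeasure (density M f) (A n) = (\<integral>\<^sup>+x. f x * indicator (A n) x \<partial>M)" for n
    using assms by (intro emeasure_density) auto
  moreover have "emeasure (density M f) (\<Union>n. A n) = (\<integral>\<^sup>+x. f x * indicator (\<Union>n. A n) x \<partial>M)"
    using assms by (intro emeasure_density) auto
  ultimately show ?thesis by simp
qed

text \<open>Monotone convergence carries the rule from compact intervals to increasing unions, and
  so to the open, half-open and unbounded ranges on which the tangent, the inversion and the square
  are used.\<close>

lemma nn_integral_substitution_exhaust:
  fixes g g' :: "real \<Rightarrow> real" and f :: "real \<Rightarrow> ennreal"
  assumes f: "f \<in> borel_measurable borel"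
    and g: "\<And>x. x \<in> (\<Union>n. {a n..b n}) \<Longrightarrow> (g has_real_derivative g' x) (at x)"
    and g': "continuous_on (\<Union>n. {a n..b n}) g'" "\<And>x. x \<in> (\<Union>n. {a n..b n}) \<Longrightarrow> 0 \<le> g' x"
    and meas: "g \<in> borel_measurable borel" "g' \<in> borel_measurable borel"
    and ab: "decseq a" "incseq b" "\<And>n. a n < b n" "decseq (g \<circ> a)" "incseq (g \<circ> b)"
  shows "(\<integral>\<^sup>+x. f x * indicator (\<Union>n. {g (a n)..g (b n)}) x \<partial>lborel)
    = (\<integral>\<^sup>+x. f (g x) * ennreal (g' x) * indicator (\<Union>n. {a n..b n}) x \<partial>lborel)"
proof -
  note [measurable] = f meas
  have "(\<integral>\<^sup>+x. f x * indicator {g (a n)..g (b n)} x \<partial>lborel) = (\<integral>\<^sup>+x. f (g x) * ennreal (g' x) * indicator {a n..b n} x \<partial>lborel)" for n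
    using nn_integral_substitution_aux[of f "a n" "b n" g g'] f g g' ab(3)
    by (auto intro: continuous_on_subset)
  moreover have "incseq (\<lambda>n. {g (a n)..g (b n)})" "incseq (\<lambda>n. {a n..b n})"
    using ab by (auto simp: incseq_def decseq_def intro: order_trans)
  ultimately show ?thesis
    by (subst (1 2) nn_integral_indicator_Union) auto
qed

lemma nn_integral_tan:
  assumes [measurable]: "f \<in> borel_measurable borel"
  shows "(\<integral>\<^sup>+x. f x \<partial>lborel)
    = (\<integral>\<^sup>+t. f (tan t) * ennreal (inverse ((cos t)\<^sup>2)) * indicator {-pi/2<..<pi/2} t \<partial>lborel)"
proof -
  define a where "a n = - arctan (real (Suc n))" for n
  define b where "b n = arctan (real (Suc n))" for n
  have U: "(\<Union>n. {a n..b n}) = {-pi/2<..<pi/2}"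
  proof (intro equalityI subsetI)
    fix t assume "t \<in> (\<Union>n. {a n..b n})"
    then obtain n where "- arctan (real (Suc n)) \<le> t" "t \<le> arctan (real (Suc n))" by (auto simp: a_def b_def)
    then show "t \<in> {-pi/2<..<pi/2}"
      using arctan_ubound[of "real (Suc n)"] by auto
  next
    fix t assume t: "t \<in> {-pi/2<..<pi/2}"
    obtain n where n: "\<bar>tan t\<bar> \<le> real n" using real_arch_simple by blast
    have "arctan (tan t) = t" using t by (intro arctan_tan) auto
    moreover have "- real (Suc n) \<le> tan t" "tan t \<le> real (Suc n)" using n by linarith+
    then have "- arctan (real (Suc n)) \<le> arctan (tan t)" "arctan (tan t) \<le> arctan (real (Suc n))"
      using arctan_monotone' arctan_minus by metis+
    ultimately have "t \<in> {a n..b n}" by (simp only: a_def b_def atLeastAtMost_iff)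
    then show "t \<in> (\<Union>n. {a n..b n})" by blast
  qed
  have cos: "cos t \<noteq> 0" if "t \<in> (\<Union>n. {a n..b n})" for t
    using that cos_gt_zero_pi[of t] unfolding U by auto
  have V: "(\<Union>n. {tan (a n)..tan (b n)}) = UNIV"
  proof (intro equalityI subsetI UNIV_I)
    fix x :: real
    obtain n where "\<bar>x\<bar> \<le> real n" using real_arch_simple by blast
    then show "x \<in> (\<Union>n. {tan (a n)..tan (b n)})"
      by (auto simp: a_def b_def tan_arctan intro!: exI[of _ n])
  qed
  have "(\<integral>\<^sup>+x. f x * indicator (\<Union>n. {tan (a n)..tan (b n)}) x \<partial>lborel)
    = (\<integral>\<^sup>+x. f (tan x) * ennreal (inverse ((cos x)\<^sup>2)) * indicator (\<Union>n. {a n..b n}) x \<partial>lborel)"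
  proof (rule nn_integral_substitution_exhaust)
    show "tan \<in> borel_measurable (borel :: real measure)" unfolding tan_def[abs_def] by measurable
    show "decseq a" "incseq b" "decseq (tan \<circ> a)" "incseq (tan \<circ> b)"
      by (auto simp: decseq_def incseq_def a_def b_def tan_arctan intro!: arctan_monotone')
    show "a n < b n" for n using zero_less_arctan_iff[of "real (Suc n)"] by (simp add: a_def b_def)
    show "continuous_on (\<Union>n. {a n..b n}) (\<lambda>x. inverse ((cos x)\<^sup>2))"
      using cos by (intro continuous_intros) auto
  qed (use cos in \<open>auto intro!: DERIV_tan\<close>)
  then show ?thesis by (simp only: U V indicator_UNIV mult_1_right)
qed

text \<open>The radius is signed and the angle stays in \<open>(-\<pi>/2, \<pi>/2)\<close>, whence
  \<open>|r|\<close>: the substitutions \<open>y = x tan t\<close> and \<open>x = r cos t\<close>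
  reach everything off the imaginary axis without a choice of the argument.\<close>

theorem nn_integral_polar:
  assumes [measurable]: "f \<in> borel_measurable borel"
  shows "(\<integral>\<^sup>+z. f z \<partial>(lborel :: complex measure))
    = (\<integral>\<^sup>+t. (\<integral>\<^sup>+r. f (of_real r * cis t) * ennreal \<bar>r\<bar> \<partial>lborel) * indicator {-pi/2<..<pi/2} t \<partial>lborel)"
proof -
  have [measurable]: "tan \<in> borel_measurable (borel :: real measure)" unfolding tan_def[abs_def] by measurable
  have [measurable]: "cis \<in> borel_measurable borel" unfolding cis_conv_exp by measurable
  have "(\<integral>\<^sup>+z. f z \<partial>(lborel :: complex measure)) = (\<integral>\<^sup>+x. \<integral>\<^sup>+y. f (Complex x y) \<partial>lborel \<partial>lborel)"
    by (rule nn_integral_lborel_complex) simp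
  also have "\<dots> = (\<integral>\<^sup>+x. \<integral>\<^sup>+m. f (Complex x (x * m)) * ennreal \<bar>x\<bar> \<partial>lborel \<partial>lborel)"
  proof (rule nn_integral_cong_AE)
    have "AE x in lborel. x \<noteq> (0 :: real)" by (rule AE_lborel_singleton)
    then show "AE x in lborel. (\<integral>\<^sup>+y. f (Complex x y) \<partial>lborel) = (\<integral>\<^sup>+m. f (Complex x (x * m)) * ennreal \<bar>x\<bar> \<partial>lborel)"
    proof eventually_elim
      case (elim x)
      then show ?case
        by (subst nn_integral_real_affine[where c = x and t = 0]) (simp_all add: nn_integral_cmult mult.commute)
    qed
  qed
  also have "\<dots> = (\<integral>\<^sup>+x. \<integral>\<^sup>+t. f (Complex x (x * tan t)) * ennreal \<bar>x\<bar> * ennreal (inverse ((cos t)\<^sup>2))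
      * indicator {-pi/2<..<pi/2} t \<partial>lborel \<partial>lborel)"
    by (rule nn_integral_cong, subst nn_integral_tan) simp_all
  also have "\<dots> = (\<integral>\<^sup>+t. \<integral>\<^sup>+x. f (Complex x (x * tan t)) * ennreal \<bar>x\<bar> * ennreal (inverse ((cos t)\<^sup>2))
      * indicator {-pi/2<..<pi/2} t \<partial>lborel \<partial>lborel)"
    by (subst lborel_pair.Fubini') simp_all
  also have "\<dots> = (\<integral>\<^sup>+t. (\<integral>\<^sup>+r. f (of_real r * cis t) * ennreal \<bar>r\<bar> \<partial>lborel) * indicator {-pi/2<..<pi/2} t \<partial>lborel)"
  proof (rule nn_integral_cong)
    fix t :: real
    show "(\<integral>\<^sup>+x. f (Complex x (x * tan t)) * ennreal \<bar>x\<bar> * ennreal (inverse ((cos t)\<^sup>2)) * indicator {-pi/2<..<pi/2} t \<partial>lborel)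
      = (\<integral>\<^sup>+r. f (of_real r * cis t) * ennreal \<bar>r\<bar> \<partial>lborel) * indicator {-pi/2<..<pi/2} t"
    proof (cases "t \<in> {-pi/2<..<pi/2}")
      case True
      then have c: "0 < cos t" by (intro cos_gt_zero_pi) auto
      have "(\<integral>\<^sup>+x. f (Complex x (x * tan t)) * ennreal \<bar>x\<bar> * ennreal (inverse ((cos t)\<^sup>2)) \<partial>lborel)
        = ennreal \<bar>cos t\<bar> * (\<integral>\<^sup>+r. f (Complex (cos t * r) (cos t * r * tan t)) * ennreal \<bar>cos t * r\<bar> * ennreal (inverse ((cos t)\<^sup>2)) \<partial>lborel)"
        using c by (subst nn_integral_real_affine[where c = "cos t" and t = 0]) simp_all
      also have "\<dots> = (\<integral>\<^sup>+r. ennreal \<bar>cos t\<bar> * (f (Complex (cos t * r) (cos t * r * tan t)) * ennreal \<bar>cos t * r\<bar> * ennreal (inverse ((cos t)\<^sup>2))) \<partial>lborel)"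
        by (subst nn_integral_cmult) simp_all
      also have "\<dots> = (\<integral>\<^sup>+r. f (of_real r * cis t) * ennreal \<bar>r\<bar> \<partial>lborel)"
      proof (rule nn_integral_cong)
        fix r :: real
        have "Complex (cos t * r) (cos t * r * tan t) = of_real r * cis t"
          using c by (simp add: complex_eq_iff tan_def)
        moreover have "ennreal \<bar>cos t\<bar> * (x * ennreal \<bar>cos t * r\<bar> * ennreal (inverse ((cos t)\<^sup>2))) = x * ennreal \<bar>r\<bar>" for x
        proof -
          have "ennreal \<bar>cos t\<bar> * (x * ennreal \<bar>cos t * r\<bar> * ennreal (inverse ((cos t)\<^sup>2)))
            = x * (ennreal \<bar>cos t\<bar> * ennreal \<bar>cos t * r\<bar> * ennreal (inverse ((cos t)\<^sup>2)))"
            by (simp add: mult_ac)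
          also have "ennreal \<bar>cos t\<bar> * ennreal \<bar>cos t * r\<bar> * ennreal (inverse ((cos t)\<^sup>2))
            = ennreal (\<bar>cos t\<bar> * \<bar>cos t * r\<bar> * inverse ((cos t)\<^sup>2))"
            by (simp add: ennreal_mult)
          also have "\<bar>cos t\<bar> * \<bar>cos t * r\<bar> * inverse ((cos t)\<^sup>2) = \<bar>r\<bar>"
            using c by (simp add: abs_mult field_simps power2_eq_square)
          finally show ?thesis .
        qed
        ultimately show "ennreal \<bar>cos t\<bar> * (f (Complex (cos t * r) (cos t * r * tan t)) * ennreal \<bar>cos t * r\<bar> * ennreal (inverse ((cos t)\<^sup>2)))
          = f (of_real r * cis t) * ennreal \<bar>r\<bar>" by simp
      qed
      finally show ?thesis using True by simp
    qed simp
  qed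
  finally show ?thesis .
qed

lemma measurable_cis [measurable]: "cis \<in> borel_measurable borel"
  unfolding cis_conv_exp by measurable

lemma nn_integral_split_sign:
  fixes f :: "real \<Rightarrow> ennreal"
  assumes [measurable]: "f \<in> borel_measurable borel"
  shows "(\<integral>\<^sup>+r. f r \<partial>lborel) = (\<integral>\<^sup>+r. f r * indicator {0<..} r \<partial>lborel) + (\<integral>\<^sup>+r. f (- r) * indicator {0<..} r \<partial>lborel)"
proof -
  have "(\<integral>\<^sup>+r. f (- r) * indicator {0<..} r \<partial>lborel) = (\<integral>\<^sup>+r. f r * indicator {..<0} r \<partial>lborel)"
    by (subst nn_integral_real_affine[where c = "-1" and t = 0]) (simp_all add: indicator_def)
  moreover have "(\<integral>\<^sup>+r. f r \<partial>lborel) = (\<integral>\<^sup>+r. f r * indicator {0<..} r + f r * indicator {..<0} r \<partial>lborel)"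
    using AE_lborel_singleton[of 0]
    by (intro nn_integral_cong_AE) (auto elim!: eventually_mono simp: indicator_def)
  ultimately show ?thesis by (simp add: nn_integral_add)
qed

text \<open>Angles are measured in units of \<open>\<pi>\<close>, and the factor 2 for the upper and the lower half plane is kept as a sum over
  \<open>\<sigma> = 1\<close> and \<open>\<sigma> = - 1\<close>.\<close>
lemma nn_integral_half_planes:
  assumes [measurable]: "f \<in> borel_measurable borel"
  defines "H \<equiv> \<lambda>\<sigma>. \<integral>\<^sup>+u. (\<integral>\<^sup>+r. f (of_real r * cis (\<sigma> * pi * u)) * ennreal r * indicator {0<..} r \<partial>lborel)
      * indicator {0<..<1} u \<partial>lborel"
  shows "(\<integral>\<^sup>+z. f z \<partial>(lborel :: complex measure)) = ennreal pi * (H 1 + H (-1))"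
proof -
  \<comment> \<open>Multiplication by \<open>\<i>\<close> turns the angles into
    \<open>(0, \<pi>)\<close>, so that positive radii give the upper half plane.\<close>
  have "(\<integral>\<^sup>+z. f z \<partial>(lborel :: complex measure)) = (\<integral>\<^sup>+z. f (\<i> * z) \<partial>lborel)"
    by (subst nn_integral_mult_complex[of f \<i>]) simp_all
  also have "\<dots> = (\<integral>\<^sup>+t. (\<integral>\<^sup>+r. f (\<i> * (of_real r * cis t)) * ennreal \<bar>r\<bar> \<partial>lborel) * indicator {-pi/2<..<pi/2} t \<partial>lborel)"
    by (subst nn_integral_polar) simp_all
  also have "\<dots> = ennreal pi * (\<integral>\<^sup>+u. (\<integral>\<^sup>+r. f (\<i> * (of_real r * cis (- pi / 2 + pi * u))) * ennreal \<bar>r\<bar> \<partial>lborel)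
      * indicator {-pi/2<..<pi/2} (- pi / 2 + pi * u) \<partial>lborel)"
    by (subst nn_integral_real_affine[where c = pi and t = "- pi / 2"]) simp_all
  also have "(\<integral>\<^sup>+u. (\<integral>\<^sup>+r. f (\<i> * (of_real r * cis (- pi / 2 + pi * u))) * ennreal \<bar>r\<bar> \<partial>lborel)
      * indicator {-pi/2<..<pi/2} (- pi / 2 + pi * u) \<partial>lborel)
    = (\<integral>\<^sup>+u. (\<integral>\<^sup>+r. f (of_real r * cis (pi * u)) * ennreal \<bar>r\<bar> \<partial>lborel) * indicator {0<..<1} u \<partial>lborel)"
  proof (rule nn_integral_cong)
    fix u :: real
    have "\<i> * (of_real r * cis (- pi / 2 + pi * u)) = of_real r * cis (pi * u)" for r
    proof -
      have "\<i> * cis (- pi / 2 + pi * u) = cis (pi * u)"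
        unfolding cis_pi_half[symmetric] cis_mult by simp
      then show ?thesis by (metis mult.left_commute)
    qed
    moreover have "indicator {-pi/2<..<pi/2} (- pi / 2 + pi * u) = (indicator {0<..<1} u :: ennreal)"
      using mult_less_cancel_left_pos[of pi u 1] zero_less_mult_iff[of pi u] by (auto simp: indicator_def)
    ultimately show "(\<integral>\<^sup>+r. f (\<i> * (of_real r * cis (- pi / 2 + pi * u))) * ennreal \<bar>r\<bar> \<partial>lborel)
        * indicator {-pi/2<..<pi/2} (- pi / 2 + pi * u)
      = (\<integral>\<^sup>+r. f (of_real r * cis (pi * u)) * ennreal \<bar>r\<bar> \<partial>lborel) * indicator {0<..<1} u"
      by (simp only:)
  qed
  also have "\<dots> = (\<integral>\<^sup>+u. (\<integral>\<^sup>+r. f (of_real r * cis (pi * u)) * ennreal r * indicator {0<..} r \<partial>lborel) * indicator {0<..<1} u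
     + (\<integral>\<^sup>+r. f (- (of_real r * cis (pi * u))) * ennreal r * indicator {0<..} r \<partial>lborel) * indicator {0<..<1} u \<partial>lborel)"
  proof (rule nn_integral_cong)
    fix u :: real
    have "(\<integral>\<^sup>+r. f (of_real r * cis (pi * u)) * ennreal \<bar>r\<bar> \<partial>lborel)
      = (\<integral>\<^sup>+r. f (of_real r * cis (pi * u)) * ennreal \<bar>r\<bar> * indicator {0<..} r \<partial>lborel)
      + (\<integral>\<^sup>+r. f (- (of_real r * cis (pi * u))) * ennreal \<bar>r\<bar> * indicator {0<..} r \<partial>lborel)"
      by (subst nn_integral_split_sign) simp_all
    moreover have "ennreal \<bar>r\<bar> * indicator {0<..} r = ennreal r * indicator {0<..} r" for r :: real
      by (simp add: indicator_def)
    ultimately show "(\<integral>\<^sup>+r. f (of_real r * cis (pi * u)) * ennreal \<bar>r\<bar> \<partial>lborel) * indicator {0<..<1} u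
      = (\<integral>\<^sup>+r. f (of_real r * cis (pi * u)) * ennreal r * indicator {0<..} r \<partial>lborel) * indicator {0<..<1} u
     + (\<integral>\<^sup>+r. f (- (of_real r * cis (pi * u))) * ennreal r * indicator {0<..} r \<partial>lborel) * indicator {0<..<1} u"
      by (simp add: mult.assoc distrib_right)
  qed
  also have "\<dots> = H 1 + (\<integral>\<^sup>+u. (\<integral>\<^sup>+r. f (- (of_real r * cis (pi * u))) * ennreal r * indicator {0<..} r \<partial>lborel) * indicator {0<..<1} u \<partial>lborel)"
    by (subst nn_integral_add) (simp_all add: H_def)
  \<comment> \<open>Negative radii give the lower half plane, and \<open>u \<mapsto> 1 - u\<close>
    turns \<open>- cis (pi * u)\<close> into \<open>cis (- pi * u)\<close>.\<close>
  also have "(\<integral>\<^sup>+u. (\<integral>\<^sup>+r. f (- (of_real r * cis (pi * u))) * ennreal r * indicator {0<..} r \<partial>lborel) * indicator {0<..<1} u \<partial>lborel)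
    = (\<integral>\<^sup>+u. (\<integral>\<^sup>+r. f (- (of_real r * cis (pi * (1 + - 1 * u)))) * ennreal r * indicator {0<..} r \<partial>lborel) * indicator {0<..<1} (1 + - 1 * u) \<partial>lborel)"
    by (subst nn_integral_real_affine[where c = "-1" and t = 1]) simp_all
  also have "\<dots> = H (-1)"
  proof -
    have "- (of_real r * cis (pi * (1 + - 1 * u))) = of_real r * cis (- 1 * pi * u)" for r u
      by (simp add: complex_eq_iff right_diff_distrib cos_diff sin_diff)
    moreover have "indicator {0<..<1} (1 + - 1 * u) = (indicator {0<..<1} u :: ennreal)" for u :: real
      by (auto simp: indicator_def)
    ultimately show ?thesis unfolding H_def by simp
  qed
  finally show ?thesis .
qed

lemma nn_integral_square_substitution:
  fixes f :: "real \<Rightarrow> ennreal"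
  assumes [measurable]: "f \<in> borel_measurable borel"
  shows "(\<integral>\<^sup>+r. f (r\<^sup>2) * ennreal r * indicator {0<..} r \<partial>lborel) = ennreal (1 / 2) * (\<integral>\<^sup>+s. f s * indicator {0<..} s \<partial>lborel)"
proof -
  have U: "(\<Union>n. {0..real (Suc n)}) = {0..}" "(\<Union>n. {0\<^sup>2..(real (Suc n))\<^sup>2}) = {0..}"
  proof -
    have "\<exists>n. x \<le> real (Suc n)" for x by (meson le_SucI real_arch_simple of_nat_le_iff order_trans lessI less_imp_le)
    moreover have "\<exists>n. x \<le> (real (Suc n))\<^sup>2" for x
    proof -
      obtain n where "x \<le> real n" using real_arch_simple by blast
      also have "real n \<le> (real (Suc n))\<^sup>2" by (simp add: power2_eq_square algebra_simps)
      finally show ?thesis by blast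
    qed
    ultimately show "(\<Union>n. {0..real (Suc n)}) = {0..}" "(\<Union>n. {0\<^sup>2..(real (Suc n))\<^sup>2}) = {0..}"
      by auto
  qed
  have "(\<integral>\<^sup>+s. f s * indicator (\<Union>n. {0\<^sup>2..(real (Suc n))\<^sup>2}) s \<partial>lborel)
    = (\<integral>\<^sup>+r. f (r\<^sup>2) * ennreal (2 * r) * indicator (\<Union>n. {0..real (Suc n)}) r \<partial>lborel)"
    by (rule nn_integral_substitution_exhaust)
      (auto simp: decseq_def incseq_def intro!: derivative_eq_intros continuous_intros power_mono)
  then have "(\<integral>\<^sup>+s. f s * indicator {0..} s \<partial>lborel) = (\<integral>\<^sup>+r. f (r\<^sup>2) * ennreal (2 * r) * indicator {0..} r \<partial>lborel)"
    by (simp only: U)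
  also have "\<dots> = (\<integral>\<^sup>+r. 2 * (f (r\<^sup>2) * ennreal r * indicator {0..} r) \<partial>lborel)"
    by (intro nn_integral_cong) (auto simp: ennreal_mult mult_ac indicator_def)
  also have "\<dots> = 2 * (\<integral>\<^sup>+r. f (r\<^sup>2) * ennreal r * indicator {0..} r \<partial>lborel)"
    by (subst nn_integral_cmult) simp_all
  finally have "(\<integral>\<^sup>+s. f s * indicator {0..} s \<partial>lborel) = 2 * (\<integral>\<^sup>+r. f (r\<^sup>2) * ennreal r * indicator {0..} r \<partial>lborel)" .
  moreover have "(\<integral>\<^sup>+s. h s * indicator {0..} s \<partial>lborel) = (\<integral>\<^sup>+s. h s * indicator {0<..} s \<partial>lborel)" for h :: "real \<Rightarrow> ennreal"
    using AE_lborel_singleton[of 0]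
    by (intro nn_integral_cong_AE) (auto elim!: eventually_mono simp: indicator_def)
  ultimately have "(\<integral>\<^sup>+s. f s * indicator {0<..} s \<partial>lborel) = 2 * (\<integral>\<^sup>+r. f (r\<^sup>2) * ennreal r * indicator {0<..} r \<partial>lborel)"
    by simp
  moreover have "ennreal (1 / 2) * (2 * x) = x" for x
  proof -
    have "ennreal (1 / 2) * (2 * x) = ennreal (1 / 2) * ennreal 2 * x" by (simp add: mult.assoc)
    also have "ennreal (1 / 2) * ennreal 2 = 1" by (subst ennreal_mult[symmetric]) simp_all
    finally show ?thesis by simp
  qed
  ultimately show ?thesis by simp
qed

text \<open>The substitution rule is for increasing maps; so \<open>x \<mapsto> - 1 / x\<close> is
  used on \<open>[-1, 0)\<close>, followed by a reflection.\<close>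

lemma nn_integral_inversion:
  fixes f :: "real \<Rightarrow> ennreal"
  assumes [measurable]: "f \<in> borel_measurable borel"
  shows "(\<integral>\<^sup>+s. f s * indicator {1..} s \<partial>lborel) = (\<integral>\<^sup>+s. f (1 / s) * ennreal (1 / s\<^sup>2) * indicator {0<..1} s \<partial>lborel)"
proof -
  have U: "(\<Union>n. {-1..- 1 / real (Suc (Suc n))}) = {-1..<0}" "(\<Union>n. {- 1 / (-1)..- 1 / (- 1 / real (Suc (Suc n)))}) = {1..}"
  proof -
    have "\<exists>n. x \<le> - 1 / real (Suc (Suc n))" if x: "x < 0" for x
    proof -
      obtain n where "1 / (- x) \<le> real n" using real_arch_simple by blast
      then have "1 / (- x) \<le> real (Suc (Suc n))" by simp
      then show ?thesis using x by (intro exI[of _ n]) (simp add: field_simps)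
    qed
    moreover have "- 1 / real (Suc (Suc n)) < 0" for n by simp
    ultimately show "(\<Union>n. {-1..- 1 / real (Suc (Suc n))}) = {-1..<0}"
      unfolding set_eq_iff UN_iff atLeastAtMost_iff atLeastLessThan_iff by (metis UNIV_I le_less_trans)
    have "\<exists>n. x \<le> 2 + real n" for x
    proof -
      obtain n where "x \<le> real n" using real_arch_simple by blast
      then show ?thesis by (intro exI[of _ n]) simp
    qed
    then show "(\<Union>n. {- 1 / (-1)..- 1 / (- 1 / real (Suc (Suc n)))}) = {1..}" by (auto simp: add.commute)
  qed
  have "(\<integral>\<^sup>+s. f s * indicator (\<Union>n. {- 1 / (-1)..- 1 / (- 1 / real (Suc (Suc n)))}) s \<partial>lborel)
    = (\<integral>\<^sup>+x. f (- 1 / x) * ennreal (1 / x\<^sup>2) * indicator (\<Union>n. {-1..- 1 / real (Suc (Suc n))}) x \<partial>lborel)"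
  proof (rule nn_integral_substitution_exhaust)
    fix x :: real assume "x \<in> (\<Union>n. {-1..- 1 / real (Suc (Suc n))})"
    then have "x < 0" unfolding U by simp
    then show "((\<lambda>x. - 1 / x) has_real_derivative 1 / x\<^sup>2) (at x)"
      by (auto intro!: derivative_eq_intros simp: power2_eq_square)
  next
    show "continuous_on (\<Union>n. {-1..- 1 / real (Suc (Suc n))}) (\<lambda>x. 1 / x\<^sup>2)"
      unfolding U by (intro continuous_intros) auto
  qed (auto simp: decseq_def incseq_def field_simps)
  then have "(\<integral>\<^sup>+s. f s * indicator {1..} s \<partial>lborel) = (\<integral>\<^sup>+x. f (- 1 / x) * ennreal (1 / x\<^sup>2) * indicator {-1..<0} x \<partial>lborel)"
    by (simp only: U)
  also have "\<dots> = (\<integral>\<^sup>+s. f (1 / s) * ennreal (1 / s\<^sup>2) * indicator {0<..1} s \<partial>lborel)"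
    by (subst nn_integral_real_affine[where c = "-1" and t = 0]) (auto simp: indicator_def intro!: nn_integral_cong)
  finally show ?thesis .
qed

subsection \<open>The area of the union of two discs\<close>

text \<open>In polar coordinates the disc is \<open>\<rho> < 2 R sin (\<sigma> \<phi> + \<pi> v)\<close>.\<close>
lemma emeasure_half_disc:
  assumes "0 \<le> R" "\<bar>v\<bar> \<le> 1 / 2" "\<sigma> = 1 \<or> \<sigma> = -1"
  shows "ennreal (pi * R\<^sup>2 * kappa v) \<le> emeasure lborel (ball (of_real R * cis (pi / 2 - \<sigma> * pi * v)) R \<inter> {z. 0 < \<sigma> * Re z})"
    (is "_ \<le> emeasure _ ?S")
proof -
  have [measurable]: "?S \<in> sets borel"
    by (intro borel_open open_Int open_ball open_Collect_less continuous_intros)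
  \<comment> \<open>Law of cosines: the squared distance from the centre is
    \<open>r^2 + R^2 - 2 r R sin (t + \<pi> v)\<close>. The sign \<open>\<sigma>\<close> sits on
    both radius and angle, so that one computation covers both half planes.\<close>
  have inS: "of_real (\<sigma> * r) * cis (\<sigma> * t) \<in> ?S"
    if "0 < r" "r < 2 * R * sin (t + pi * v)" "-pi/2 < t" "t < pi/2" for r t
  proof -
    have s2: "\<sigma> * \<sigma> = 1" using assms by auto
    have c: "cos (\<sigma> * x) = cos x" "\<sigma> * sin (\<sigma> * x) = sin x" for x using assms(3) by auto
    have "0 < cos t" using that by (intro cos_gt_zero_pi) auto
    then have re: "0 < \<sigma> * Re (of_real (\<sigma> * r) * cis (\<sigma> * t))"
      using that(1) c s2 by (simp add: mult.assoc[symmetric])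
    have Rpos: "0 < R" using that assms(1) by (cases "R = 0") auto
    define z where "z = of_real (\<sigma> * r) * cis (\<sigma> * t)"
    define w where "w = of_real R * cis (pi / 2 - \<sigma> * pi * v)"
    have "(dist w z)\<^sup>2 = (norm z)\<^sup>2 + (norm w)\<^sup>2 - 2 * (Re z * Re w + Im z * Im w)"
      unfolding dist_norm cmod_power2 by (simp add: power2_eq_square algebra_simps)
    also have "(norm z)\<^sup>2 = r\<^sup>2" using assms(3) by (auto simp: z_def norm_mult power2_eq_square)
    also have "(norm w)\<^sup>2 = R\<^sup>2" by (simp add: w_def norm_mult)
    also have "Re z * Re w + Im z * Im w = r * R * sin (t + pi * v)"
    proof -
      have "Re z * Re w + Im z * Im w = r * R * (\<sigma> * cos (\<sigma> * t) * sin (\<sigma> * (pi * v)) + \<sigma> * sin (\<sigma> * t) * cos (\<sigma> * (pi * v)))"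
        by (simp add: z_def w_def cos_diff sin_diff algebra_simps)
      also have "\<sigma> * cos (\<sigma> * t) * sin (\<sigma> * (pi * v)) + \<sigma> * sin (\<sigma> * t) * cos (\<sigma> * (pi * v)) = sin (t + pi * v)"
        using assms(3) by (auto simp: sin_add)
      finally show ?thesis .
    qed
    also have "r\<^sup>2 + R\<^sup>2 - 2 * (r * R * sin (t + pi * v)) < R\<^sup>2"
      using mult_strict_left_mono[OF that(2,1)] by (simp add: power2_eq_square algebra_simps)
    finally have "dist w z < R" using assms(1) by (simp add: power2_less_imp_less)
    then show ?thesis using re by (simp add: z_def w_def)
  qed
  define F where "F r t = indicator ?S (of_real r * cis t) * ennreal \<bar>r\<bar>" for r t
  have F[measurable]: "(\<lambda>(r, t). F r t) \<in> borel_measurable (borel \<Otimes>\<^sub>M borel)" unfolding F_def by measurable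
  have "emeasure lborel ?S = (\<integral>\<^sup>+z. indicator ?S z \<partial>lborel)" by simp
  also have "\<dots> = (\<integral>\<^sup>+t. (\<integral>\<^sup>+r. F r t \<partial>lborel) * indicator {-pi/2<..<pi/2} t \<partial>lborel)"
    unfolding F_def by (rule nn_integral_polar) simp
  also have "\<dots> = (\<integral>\<^sup>+t. (\<integral>\<^sup>+r. F r (\<sigma> * t) \<partial>lborel) * indicator {-pi/2<..<pi/2} (\<sigma> * t) \<partial>lborel)"
    using assms(3) by (subst nn_integral_real_affine[where c = \<sigma> and t = 0]) (auto, measurable)
  \<comment> \<open>For a lower bound it is enough to keep the angles where the chord
    \<open>2 R sin (t + \<pi> v)\<close> is nonnegative and the radii up to it; the radial integral
    is half the squared chord.\<close>
  also have "\<dots> \<ge> (\<integral>\<^sup>+t. ennreal (2 * R\<^sup>2 * (sin (t + pi * v))\<^sup>2) * indicator {- pi * v..pi/2} t \<partial>lborel)"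
  proof (rule nn_integral_mono_AE)
    have "AE t in lborel. t \<noteq> - pi / 2" "AE t in lborel. t \<noteq> pi / 2" by (rule AE_lborel_singleton)+
    then show "AE t in lborel. ennreal (2 * R\<^sup>2 * (sin (t + pi * v))\<^sup>2) * indicator {- pi * v..pi/2} t
      \<le> (\<integral>\<^sup>+r. F r (\<sigma> * t) \<partial>lborel) * indicator {-pi/2<..<pi/2} (\<sigma> * t)"
    proof eventually_elim
      case (elim t)
      show ?case
      proof (cases "t \<in> {- pi * v..pi/2}")
        case True
        have "- pi / 2 \<le> - pi * v" using assms(2) by (simp add: abs_le_iff)
        moreover have "- pi * v \<le> t" "t \<le> pi / 2" using True by auto
        ultimately have t: "-pi/2 < t" "t < pi/2" using elim by linarith+
        then have ind: "\<sigma> * t \<in> {-pi/2<..<pi/2}" using assms(3) by auto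
        have "pi * v \<le> pi * (1 / 2)" using assms(2) by (intro mult_left_mono) auto
        then have "0 \<le> t + pi * v" "t + pi * v \<le> pi"
          using True unfolding atLeastAtMost_iff by linarith+
        then have s: "0 \<le> sin (t + pi * v)" by (intro sin_ge_zero)
        define m where "m = 2 * R * sin (t + pi * v)"
        have m: "0 \<le> m" using s assms(1) by (simp add: m_def)
        have "ennreal (2 * R\<^sup>2 * (sin (t + pi * v))\<^sup>2) = ennreal (m\<^sup>2 / 2 - 0\<^sup>2 / 2)"
          by (simp add: m_def power_mult_distrib)
        also have "\<dots> = (\<integral>\<^sup>+r. ennreal r * indicator {0..m} r \<partial>lborel)"
          using m by (intro nn_integral_FTC_Icc[symmetric]) (auto intro!: derivative_eq_intros)
        also have "\<dots> \<le> (\<integral>\<^sup>+r. F (\<sigma> * r) (\<sigma> * t) \<partial>lborel)"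
        proof (rule nn_integral_mono_AE)
          have "AE r in lborel. r \<noteq> m" "AE r in lborel. r \<noteq> 0" by (rule AE_lborel_singleton)+
          then show "AE r in lborel. ennreal r * indicator {0..m} r \<le> F (\<sigma> * r) (\<sigma> * t)"
          proof eventually_elim
            case (elim r)
            then show ?case
              using inS[of r t] t assms(3) by (auto simp: F_def m_def indicator_def split: if_splits)
          qed
        qed
        also have "\<dots> = (\<integral>\<^sup>+r. F r (\<sigma> * t) \<partial>lborel)"
          using assms(3) by (subst (2) nn_integral_real_affine[where c = \<sigma> and t = 0]) (auto, measurable)
        finally show ?thesis using True ind by simp
      qed simp
    qed
  qed
  also have "(\<integral>\<^sup>+t. ennreal (2 * R\<^sup>2 * (sin (t + pi * v))\<^sup>2) * indicator {- pi * v..pi/2} t \<partial>lborel)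
     = ennreal (R\<^sup>2 * (pi / 2 + pi * v - sin (pi / 2 + pi * v) * cos (pi / 2 + pi * v))
        - R\<^sup>2 * (- pi * v + pi * v - sin (- pi * v + pi * v) * cos (- pi * v + pi * v)))"
  proof (rule nn_integral_FTC_Icc)
    fix t
    have "((\<lambda>t. R\<^sup>2 * (t + pi * v - sin (t + pi * v) * cos (t + pi * v))) has_real_derivative
      R\<^sup>2 * (1 - (cos (t + pi * v) * cos (t + pi * v) - sin (t + pi * v) * sin (t + pi * v)))) (at t)"
      by (auto intro!: derivative_eq_intros)
    also have "1 - (cos (t + pi * v) * cos (t + pi * v) - sin (t + pi * v) * sin (t + pi * v)) = 2 * (sin (t + pi * v))\<^sup>2"
      using sin_cos_squared_add[of "t + pi * v"] by (simp add: power2_eq_square)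
    finally show "((\<lambda>t. R\<^sup>2 * (t + pi * v - sin (t + pi * v) * cos (t + pi * v))) has_real_derivative 2 * R\<^sup>2 * (sin (t + pi * v))\<^sup>2) (at t)"
      by (simp add: mult_ac)
  qed (use mult_left_mono[of "-v" "1 / 2" pi] assms(2) in \<open>auto simp: abs_le_iff\<close>)
  also have "R\<^sup>2 * (pi / 2 + pi * v - sin (pi / 2 + pi * v) * cos (pi / 2 + pi * v))
        - R\<^sup>2 * (- pi * v + pi * v - sin (- pi * v + pi * v) * cos (- pi * v + pi * v)) = pi * R\<^sup>2 * kappa v"
  proof -
    have "sin (pi / 2 + pi * v) = cos (pi * v)" "cos (pi / 2 + pi * v) = - sin (pi * v)"
      by (simp_all add: sin_add cos_add)
    moreover have "sin (2 * pi * v) = 2 * sin (pi * v) * cos (pi * v)"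
      using sin_double[of "pi * v"] by (simp add: mult.assoc)
    ultimately show ?thesis unfolding kappa_def by (simp only:) (simp add: field_simps)
  qed
  finally show ?thesis .
qed

section \<open>The union as a function of the second centre\<close>

definition disc_union :: "complex \<Rightarrow> complex \<Rightarrow> complex set" where
  "disc_union y w = ball y (norm y) \<union> ball w (norm w)"

lemma borel_disc_union [measurable]: "disc_union y w \<in> sets borel"
  by (auto simp: disc_union_def)

lemma emeasure_disc_union_finite: "emeasure lborel (disc_union y w) < \<infinity>"
  using emeasure_bounded_finite[of "disc_union y w"] by (simp add: disc_union_def)

lemma emeasure_disc_union_mult:
  assumes "a \<noteq> 0"
  shows "emeasure lborel (disc_union (a * y) (a * w)) = ennreal ((norm a)\<^sup>2) * emeasure lborel (disc_union y w)"
proof -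
  have dist: "dist (a * x) (a * z) = norm a * dist x z" for x z
    by (simp add: dist_norm norm_mult flip: right_diff_distrib)
  have "emeasure lborel (disc_union (a * y) (a * w)) = (\<integral>\<^sup>+z. indicator (disc_union (a * y) (a * w)) z \<partial>lborel)"
    by simp
  also have "\<dots> = ennreal ((norm a)\<^sup>2) * (\<integral>\<^sup>+z. indicator (disc_union (a * y) (a * w)) (a * z) \<partial>lborel)"
    using assms by (intro nn_integral_mult_complex) simp_all
  also have "(\<lambda>z. indicator (disc_union (a * y) (a * w)) (a * z)) = (indicator (disc_union y w) :: complex \<Rightarrow> ennreal)"
    using assms by (auto simp: fun_eq_iff disc_union_def dist norm_mult split: split_indicator)
  finally show ?thesis by simp
qed

definition union_area :: "complex \<Rightarrow> real" where
  "union_area w = measure lborel (disc_union 1 w)"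

lemma emeasure_disc_union_1: "emeasure lborel (disc_union 1 w) = ennreal (union_area w)"
  unfolding union_area_def using emeasure_disc_union_finite by (simp add: emeasure_eq_ennreal_measure less_top)

text \<open>The measure of the sections of a Borel set is measurable, and openness shows at once
  that the set is Borel in the product.\<close>

lemma measurable_measure_open:
  fixes S :: "'a::{second_countable_topology} \<Rightarrow> 'b::euclidean_space set"
  assumes "open {p. snd p \<in> S (fst p)}"
  shows "(\<lambda>x. measure lborel (S x)) \<in> borel_measurable borel"
proof -
  have "{p. snd p \<in> S (fst p)} \<in> sets (borel \<Otimes>\<^sub>M borel)"
    unfolding borel_prod using assms by (rule borel_open)
  then have "{p. snd p \<in> S (fst p)} \<in> sets (borel \<Otimes>\<^sub>M lborel)"
    by (simp only: sets_pair_measure_cong[OF refl sets_lborel])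
  then have "(\<lambda>w. emeasure lborel (Pair w -` {p. snd p \<in> S (fst p)})) \<in> borel_measurable borel"
    by (rule lborel.measurable_emeasure_Pair)
  also have "(\<lambda>w. Pair w -` {p. snd p \<in> S (fst p)}) = S" by auto
  finally show ?thesis unfolding measure_def by (simp add: borel_measurable_enn2real)
qed

lemma measurable_union_area [measurable]: "union_area \<in> borel_measurable borel"
  unfolding union_area_def[abs_def]
proof (rule measurable_measure_open)
  have "{p :: complex \<times> complex. snd p \<in> disc_union 1 (fst p)}
      = {p. dist 1 (snd p) < 1} \<union> {p. dist (fst p) (snd p) < norm (fst p)}"
    by (auto simp: disc_union_def)
  also have "open \<dots>" by (intro open_Un open_Collect_less continuous_intros)
  finally show "open {p :: complex \<times> complex. snd p \<in> disc_union 1 (fst p)}" .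
qed

text \<open>The rotation by \<open>c\<close> takes the cut to the imaginary axis. The centres then
  appear at the angles \<open>\<pi> v\<close> and \<open>\<pi> (u - v)\<close> from this axis on
  opposite sides, and the part of the one disc on its side is disjoint from the part of the other on
  the other side.\<close>

lemma union_area_ge:
  assumes "0 \<le> s" "\<bar>v\<bar> \<le> 1 / 2" "\<bar>u - v\<bar> \<le> 1 / 2" "\<sigma> = 1 \<or> \<sigma> = -1"
  shows "pi * (kappa v + s * kappa (u - v)) \<le> union_area (of_real (sqrt s) * cis (\<sigma> * pi * u))"
proof -
  define c where "c = cis (pi / 2 - \<sigma> * pi * v)"
  define w where "w = of_real (sqrt s) * cis (\<sigma> * pi * u)"
  define E where "E \<tau> = {z. 0 < \<tau> * Re z}" for \<tau> :: real
  have cw: "c * w = of_real (sqrt s) * cis (pi / 2 - (- \<sigma>) * pi * (u - v))"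
    by (simp add: c_def w_def cis_mult algebra_simps)
  have [measurable]: "E \<tau> \<in> sets borel" for \<tau>
    unfolding E_def by (intro borel_open open_Collect_less continuous_intros)
  have nonneg: "0 \<le> kappa x" if "\<bar>x\<bar> \<le> 1 / 2" for x
    using kappa_mono[of "- (1 / 2)" x] that by (simp add: kappa_def abs_le_iff)
  have "ennreal (pi * (kappa v + s * kappa (u - v))) = ennreal (pi * 1\<^sup>2 * kappa v) + ennreal (pi * (sqrt s)\<^sup>2 * kappa (u - v))"
    using assms nonneg by (simp add: distrib_left flip: ennreal_plus)
  also have "\<dots> \<le> emeasure lborel (ball c 1 \<inter> E \<sigma>) + emeasure lborel (ball (c * w) (sqrt s) \<inter> E (- \<sigma>))"
    using emeasure_half_disc[of 1 v \<sigma>] emeasure_half_disc[of "sqrt s" "u - v" "- \<sigma>"] assms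
    unfolding cw E_def by (intro add_mono) (auto simp: c_def)
  also have "\<dots> = emeasure lborel ((ball c 1 \<inter> E \<sigma>) \<union> (ball (c * w) (sqrt s) \<inter> E (- \<sigma>)))"
    by (intro plus_emeasure) (auto simp: E_def)
  also have "\<dots> \<le> emeasure lborel (disc_union (c * 1) (c * w))"
  proof (rule emeasure_mono)
    have "norm c = 1" "norm (c * w) = sqrt s" using assms(1) by (simp_all add: c_def w_def norm_mult)
    then show "(ball c 1 \<inter> E \<sigma>) \<union> (ball (c * w) (sqrt s) \<inter> E (- \<sigma>)) \<subseteq> disc_union (c * 1) (c * w)"
      by (auto simp: disc_union_def)
  qed simp
  also have "\<dots> = ennreal (union_area w)"
    by (subst emeasure_disc_union_mult) (simp_all add: emeasure_disc_union_1, simp_all add: c_def)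
  finally show ?thesis unfolding w_def by (subst (asm) ennreal_le_iff) (simp_all add: union_area_def)
qed

text \<open>The cut at \<open>1 / 2\<close> keeps the unit disc whole. The bound makes divisions by
  the area legitimate and exponential rates positive.\<close>

lemma union_area_pos: "pi \<le> union_area w"
proof -
  have "pi \<le> union_area (of_real (sqrt ((norm w)\<^sup>2)) * cis (pi * (Arg w / pi)))"
  proof (cases "0 \<le> Arg w")
    case True
    have "kappa (1 / 2) = 1" by (simp add: kappa_def)
    moreover have "0 \<le> kappa (Arg w / pi - 1 / 2)"
      using kappa_mono[of "- (1 / 2)" "Arg w / pi - 1 / 2"] True by (simp add: kappa_def)
    moreover have "\<bar>Arg w / pi - 1 / 2\<bar> \<le> 1 / 2" using True Arg_le_pi[of w] by (simp add: abs_le_iff field_simps)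
    ultimately have "pi * 1 \<le> pi * (kappa (1 / 2) + (norm w)\<^sup>2 * kappa (Arg w / pi - 1 / 2))"
      by (intro mult_left_mono) auto
    also have "\<dots> \<le> union_area (of_real (sqrt ((norm w)\<^sup>2)) * cis (1 * pi * (Arg w / pi)))"
      using \<open>\<bar>Arg w / pi - 1 / 2\<bar> \<le> 1 / 2\<close> by (intro union_area_ge) auto
    finally show ?thesis by simp
  next
    case False
    have "kappa (1 / 2) = 1" by (simp add: kappa_def)
    moreover have "0 \<le> kappa (- Arg w / pi - 1 / 2)"
      using kappa_mono[of "- (1 / 2)" "- Arg w / pi - 1 / 2"] False divide_nonpos_pos[of "Arg w" pi] by (simp add: kappa_def)
    moreover have "\<bar>- Arg w / pi - 1 / 2\<bar> \<le> 1 / 2" using False mpi_less_Arg[of w] by (simp add: abs_le_iff field_simps)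
    ultimately have "pi * 1 \<le> pi * (kappa (1 / 2) + (norm w)\<^sup>2 * kappa (- Arg w / pi - 1 / 2))"
      by (intro mult_left_mono) auto
    also have "\<dots> \<le> union_area (of_real (sqrt ((norm w)\<^sup>2)) * cis (-1 * pi * (- Arg w / pi)))"
      using \<open>\<bar>- Arg w / pi - 1 / 2\<bar> \<le> 1 / 2\<close> by (intro union_area_ge) auto
    finally show ?thesis by simp
  qed
  also have "of_real (sqrt ((norm w)\<^sup>2)) * cis (pi * (Arg w / pi)) = w"
    using rcis_cmod_Arg[of w] by (simp add: rcis_def)
  finally show ?thesis .
qed

lemma inverse_square_union_area_le:
  "(\<integral>\<^sup>+w. ennreal (1 / (union_area w)\<^sup>2) \<partial>lborel) \<le> ennreal (1.2802 / pi)"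
proof -
  have half: "(\<integral>\<^sup>+u. (\<integral>\<^sup>+r. ennreal (1 / (union_area (of_real r * cis (\<sigma> * pi * u)))\<^sup>2) * ennreal r * indicator {0<..} r \<partial>lborel)
      * indicator {0<..<1} u \<partial>lborel) \<le> ennreal (0.6401 / pi\<^sup>2)" (is "?L \<le> _") if \<sigma>: "\<sigma> = 1 \<or> \<sigma> = -1" for \<sigma>
  proof -
    define A where "A s u = union_area (of_real (sqrt s) * cis (\<sigma> * pi * u))" for s u
    have A_meas: "(\<lambda>p. A (fst p) (snd p)) \<in> borel_measurable (borel \<Otimes>\<^sub>M borel)"
      unfolding A_def by measurable
    have [measurable]: "(\<lambda>x. A (f x) (g x)) \<in> borel_measurable N" if [measurable]: "f \<in> borel_measurable N" "g \<in> borel_measurable N" for f g N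
      unfolding A_def by measurable
    have A_pos: "0 < A s u" for s u
      unfolding A_def using union_area_pos pi_gt_zero by (rule less_le_trans[rotated])
    define B1 where "B1 s u = A s u / pi" for s u
    \<comment> \<open>Replacing \<open>s\<close> by \<open>1 / s\<close> exchanges the roles of the
      discs: \<open>s * A (1 / s) u\<close> is the area after rescaling the second disc to unit
      size, and its bound at \<open>v\<close> comes from the cut \<open>u - v\<close>. The value at
      \<open>s = 0\<close> is the largest \<open>kappa v\<close>.\<close>
    define B2 where "B2 s u = (if s = 0 then 1 else s * A (1 / s) u / pi)" for s u
    have al1: "above_lines B1"
      unfolding above_lines_def
    proof (intro allI impI)
      fix s u v :: real assume "0 \<le> s" "\<bar>v\<bar> \<le> 1 / 2" "\<bar>u - v\<bar> \<le> 1 / 2"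
      then have "pi * (kappa v + s * kappa (u - v)) \<le> A s u" unfolding A_def by (intro union_area_ge \<sigma>)
      then show "kappa v + s * kappa (u - v) \<le> B1 s u" by (simp add: B1_def field_simps)
    qed
    have al2: "above_lines B2"
      unfolding above_lines_def
    proof (intro allI impI)
      fix s u v :: real assume a: "0 \<le> s" "\<bar>v\<bar> \<le> 1 / 2" "\<bar>u - v\<bar> \<le> 1 / 2"
      show "kappa v + s * kappa (u - v) \<le> B2 s u"
      proof (cases "s = 0")
        case True
        have "kappa v \<le> kappa (1 / 2)" using a by (intro kappa_mono) (simp add: abs_le_iff)
        then show ?thesis using True by (simp add: B2_def kappa_def)
      next
        case False
        then have s: "0 < s" using a by simp
        have "pi * (kappa (u - v) + 1 / s * kappa (u - (u - v))) \<le> A (1 / s) u"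
          unfolding A_def using a by (intro union_area_ge \<sigma>) auto
        then have "s * (pi * (kappa (u - v) + 1 / s * kappa v)) \<le> s * A (1 / s) u"
          using s by (intro mult_left_mono) auto
        moreover have "s * (pi * (kappa (u - v) + 1 / s * kappa v)) = pi * (kappa v + s * kappa (u - v))"
          using s by (simp add: field_simps)
        ultimately have "pi * (kappa v + s * kappa (u - v)) \<le> s * A (1 / s) u" by (simp only:)
        then show ?thesis using s by (simp add: B2_def field_simps)
      qed
    qed
    have r1: "rect_integral B1 0 1 0 1 \<le> ennreal 0.6401" and r2: "rect_integral B2 0 1 0 1 \<le> ennreal 0.6401"
      by (intro inverse_square_integral_le al1 al2; simp add: B1_def B2_def; measurable)+
    have sc: "ennreal (1 / (A s u)\<^sup>2) = ennreal (1 / pi\<^sup>2) * ennreal (1 / (B1 s u)\<^sup>2)" for s u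
      by (simp add: B1_def power_divide flip: ennreal_mult)
    \<comment> \<open>The Jacobian \<open>1 / s^2\<close> of the inversion is exactly the factor
      that turns \<open>A (1 / s) u\<close> into \<open>pi * B2 s u\<close> under the
      square.\<close>
    have sc2: "ennreal (1 / (A (1 / s) u)\<^sup>2) * ennreal (1 / s\<^sup>2) = ennreal (1 / pi\<^sup>2) * ennreal (1 / (B2 s u)\<^sup>2)" if "0 < s" for s u
      using that by (simp add: B2_def power_divide power_mult_distrib mult_ac flip: ennreal_mult)
    have inner: "(\<integral>\<^sup>+r. ennreal (1 / (union_area (of_real r * cis (\<sigma> * pi * u)))\<^sup>2) * ennreal r * indicator {0<..} r \<partial>lborel)
      \<le> ennreal (1 / (2 * pi\<^sup>2)) * ((\<integral>\<^sup>+s. ennreal (1 / (B1 s u)\<^sup>2) * indicator {0..1} s \<partial>lborel)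
         + (\<integral>\<^sup>+s. ennreal (1 / (B2 s u)\<^sup>2) * indicator {0..1} s \<partial>lborel))" for u
    proof -
      have "(\<integral>\<^sup>+r. ennreal (1 / (union_area (of_real r * cis (\<sigma> * pi * u)))\<^sup>2) * ennreal r * indicator {0<..} r \<partial>lborel)
        = (\<integral>\<^sup>+r. ennreal (1 / (A (r\<^sup>2) u)\<^sup>2) * ennreal r * indicator {0<..} r \<partial>lborel)"
        by (intro nn_integral_cong) (auto simp: A_def split: split_indicator)
      also have "\<dots> = ennreal (1 / 2) * (\<integral>\<^sup>+s. ennreal (1 / (A s u)\<^sup>2) * indicator {0<..} s \<partial>lborel)"
        by (rule nn_integral_square_substitution) simp
      also have "(\<integral>\<^sup>+s. ennreal (1 / (A s u)\<^sup>2) * indicator {0<..} s \<partial>lborel)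
        \<le> (\<integral>\<^sup>+s. ennreal (1 / (A s u)\<^sup>2) * indicator {0..1} s + ennreal (1 / (A s u)\<^sup>2) * indicator {1..} s \<partial>lborel)"
        by (intro nn_integral_mono) (auto split: split_indicator)
      also have "\<dots> = (\<integral>\<^sup>+s. ennreal (1 / (A s u)\<^sup>2) * indicator {0..1} s \<partial>lborel)
         + (\<integral>\<^sup>+s. ennreal (1 / (A (1 / s) u)\<^sup>2) * ennreal (1 / s\<^sup>2) * indicator {0<..1} s \<partial>lborel)"
        by (subst nn_integral_add, simp, simp, subst nn_integral_inversion) simp_all
      also have "\<dots> \<le> (\<integral>\<^sup>+s. ennreal (1 / pi\<^sup>2) * (ennreal (1 / (B1 s u)\<^sup>2) * indicator {0..1} s) \<partial>lborel)
         + (\<integral>\<^sup>+s. ennreal (1 / pi\<^sup>2) * (ennreal (1 / (B2 s u)\<^sup>2) * indicator {0..1} s) \<partial>lborel)"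
      proof (intro add_mono nn_integral_mono)
        fix s
        show "ennreal (1 / (A s u)\<^sup>2) * indicator {0..1} s \<le> ennreal (1 / pi\<^sup>2) * (ennreal (1 / (B1 s u)\<^sup>2) * indicator {0..1} s)"
          by (simp add: sc mult.assoc)
        show "ennreal (1 / (A (1 / s) u)\<^sup>2) * ennreal (1 / s\<^sup>2) * indicator {0<..1} s
          \<le> ennreal (1 / pi\<^sup>2) * (ennreal (1 / (B2 s u)\<^sup>2) * indicator {0..1} s)"
          using sc2[of s u] by (auto split: split_indicator)
      qed
      also have "\<dots> = ennreal (1 / pi\<^sup>2) * ((\<integral>\<^sup>+s. ennreal (1 / (B1 s u)\<^sup>2) * indicator {0..1} s \<partial>lborel)
         + (\<integral>\<^sup>+s. ennreal (1 / (B2 s u)\<^sup>2) * indicator {0..1} s \<partial>lborel))"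
        unfolding B1_def B2_def by (subst (1 2) nn_integral_cmult) (simp_all add: distrib_left)
      finally have "(\<integral>\<^sup>+r. ennreal (1 / (union_area (of_real r * cis (\<sigma> * pi * u)))\<^sup>2) * ennreal r * indicator {0<..} r \<partial>lborel)
        \<le> ennreal (1 / 2) * (ennreal (1 / pi\<^sup>2) * ((\<integral>\<^sup>+s. ennreal (1 / (B1 s u)\<^sup>2) * indicator {0..1} s \<partial>lborel)
         + (\<integral>\<^sup>+s. ennreal (1 / (B2 s u)\<^sup>2) * indicator {0..1} s \<partial>lborel)))"
        by (simp add: mult_left_mono)
      also have "ennreal (1 / 2) * (ennreal (1 / pi\<^sup>2) * x) = ennreal (1 / (2 * pi\<^sup>2)) * x" for x
      proof -
        have "ennreal (1 / 2) * ennreal (1 / pi\<^sup>2) = ennreal (1 / (2 * pi\<^sup>2))"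
          by (subst ennreal_mult[symmetric]) simp_all
        then show ?thesis by (simp only: mult.assoc[symmetric])
      qed
      finally show ?thesis .
    qed
    have "?L \<le> (\<integral>\<^sup>+u. ennreal (1 / (2 * pi\<^sup>2)) * ((\<integral>\<^sup>+s. ennreal (1 / (B1 s u)\<^sup>2) * indicator {0..1} s * indicator {0..1} u \<partial>lborel)
         + (\<integral>\<^sup>+s. ennreal (1 / (B2 s u)\<^sup>2) * indicator {0..1} s * indicator {0..1} u \<partial>lborel)) \<partial>lborel)"
      using inner by (intro nn_integral_mono) (auto split: split_indicator)
    also have "\<dots> = ennreal (1 / (2 * pi\<^sup>2)) * ((\<integral>\<^sup>+u. \<integral>\<^sup>+s. ennreal (1 / (B1 s u)\<^sup>2) * indicator {0..1} s * indicator {0..1} u \<partial>lborel \<partial>lborel)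
         + (\<integral>\<^sup>+u. \<integral>\<^sup>+s. ennreal (1 / (B2 s u)\<^sup>2) * indicator {0..1} s * indicator {0..1} u \<partial>lborel \<partial>lborel))"
      unfolding B1_def B2_def by (subst nn_integral_cmult, measurable, subst nn_integral_add, measurable)
    also have "(\<integral>\<^sup>+u. \<integral>\<^sup>+s. ennreal (1 / (B1 s u)\<^sup>2) * indicator {0..1} s * indicator {0..1} u \<partial>lborel \<partial>lborel) = rect_integral B1 0 1 0 1"
    proof -
      have "(\<integral>\<^sup>+u. \<integral>\<^sup>+s. ennreal (1 / (B1 s u)\<^sup>2) * indicator {0..1} s * indicator {0..1} u \<partial>lborel \<partial>lborel)
        = (\<integral>\<^sup>+s. \<integral>\<^sup>+u. ennreal (1 / (B1 s u)\<^sup>2) * indicator {0..1} s * indicator {0..1} u \<partial>lborel \<partial>lborel)"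
        unfolding B1_def by (rule lborel_pair.Fubini') measurable
      also have "\<dots> = rect_integral B1 0 1 0 1"
        unfolding rect_integral_def by (intro nn_integral_cong) (auto split: split_indicator)
      finally show ?thesis .
    qed
    also have "(\<integral>\<^sup>+u. \<integral>\<^sup>+s. ennreal (1 / (B2 s u)\<^sup>2) * indicator {0..1} s * indicator {0..1} u \<partial>lborel \<partial>lborel) = rect_integral B2 0 1 0 1"
    proof -
      have "(\<integral>\<^sup>+u. \<integral>\<^sup>+s. ennreal (1 / (B2 s u)\<^sup>2) * indicator {0..1} s * indicator {0..1} u \<partial>lborel \<partial>lborel)
        = (\<integral>\<^sup>+s. \<integral>\<^sup>+u. ennreal (1 / (B2 s u)\<^sup>2) * indicator {0..1} s * indicator {0..1} u \<partial>lborel \<partial>lborel)"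
        unfolding B2_def by (rule lborel_pair.Fubini') measurable
      also have "\<dots> = rect_integral B2 0 1 0 1"
        unfolding rect_integral_def by (intro nn_integral_cong) (auto split: split_indicator)
      finally show ?thesis .
    qed
    also have "ennreal (1 / (2 * pi\<^sup>2)) * (rect_integral B1 0 1 0 1 + rect_integral B2 0 1 0 1)
      \<le> ennreal (1 / (2 * pi\<^sup>2)) * (ennreal 0.6401 + ennreal 0.6401)"
      using r1 r2 by (intro mult_left_mono add_mono) auto
    also have "\<dots> = ennreal (0.6401 / pi\<^sup>2)"
      by (simp flip: ennreal_plus ennreal_mult)
    finally show ?thesis .
  qed
  have "(\<integral>\<^sup>+w. ennreal (1 / (union_area w)\<^sup>2) \<partial>lborel) \<le> ennreal pi * (ennreal (0.6401 / pi\<^sup>2) + ennreal (0.6401 / pi\<^sup>2))"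
    using half[of 1] half[of "-1"] by (subst nn_integral_half_planes) (auto intro!: mult_left_mono add_mono)
  also have "\<dots> = ennreal (1.2802 / pi)"
    by (simp add: power2_eq_square flip: ennreal_plus ennreal_mult)
  finally show ?thesis .
qed

section \<open>Integration over the positions of station and user\<close>

lemma nn_integral_radial:
  assumes [measurable]: "h \<in> borel_measurable borel"
  shows "(\<integral>\<^sup>+z. h ((norm z)\<^sup>2) \<partial>(lborel :: complex measure)) = ennreal pi * (\<integral>\<^sup>+s. h s * indicator {0<..} s \<partial>lborel)"
proof -
  have "(\<integral>\<^sup>+z. h ((norm z)\<^sup>2) \<partial>(lborel :: complex measure))
      = ennreal pi * ((\<integral>\<^sup>+u. (\<integral>\<^sup>+r. h (r\<^sup>2) * ennreal r * indicator {0<..} r \<partial>lborel) * indicator {0<..<1::real} u \<partial>lborel)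
        + (\<integral>\<^sup>+u. (\<integral>\<^sup>+r. h (r\<^sup>2) * ennreal r * indicator {0<..} r \<partial>lborel) * indicator {0<..<1::real} u \<partial>lborel))"
    by (subst nn_integral_half_planes) (simp_all add: norm_mult)
  also have "\<dots> = ennreal pi * (2 * (\<integral>\<^sup>+r. h (r\<^sup>2) * ennreal r * indicator {0<..} r \<partial>lborel))"
    by (simp add: nn_integral_cmult mult_2)
  also have "\<dots> = ennreal pi * (ennreal 2 * ennreal (1 / 2) * (\<integral>\<^sup>+s. h s * indicator {0<..} s \<partial>lborel))"
    unfolding nn_integral_square_substitution[OF assms] by (simp only: mult.assoc ennreal_numeral)
  also have "ennreal 2 * ennreal (1 / 2) = 1"
    by (subst ennreal_mult[symmetric]) simp_all
  finally show ?thesis by simp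
qed

lemma nn_integral_exp_half_line:
  assumes "0 < (c :: real)"
  shows "(\<integral>\<^sup>+s. ennreal (exp (- c * s)) * indicator {0<..} s \<partial>lborel) = ennreal (1 / c)"
    and "(\<integral>\<^sup>+s. ennreal (s * exp (- c * s)) * indicator {0<..} s \<partial>lborel) = ennreal (1 / c\<^sup>2)"
proof -
  have open_half: "(\<integral>\<^sup>+s. h s * indicator {0<..} s \<partial>lborel) = (\<integral>\<^sup>+s. h s * indicator {0..} s \<partial>lborel)" for h :: "real \<Rightarrow> ennreal"
    using AE_lborel_singleton[of 0]
    by (intro nn_integral_cong_AE) (auto elim!: eventually_mono simp: indicator_def)
  have "((\<lambda>s. - exp (- c * s) / c) \<longlongrightarrow> 0) at_top" "((\<lambda>s. - (s / c + 1 / c\<^sup>2) * exp (- c * s)) \<longlongrightarrow> 0) at_top"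
    using assms by real_asymp+
  note lim = this
  have "(\<integral>\<^sup>+s. ennreal (exp (- c * s)) * indicator {0..} s \<partial>lborel) = ennreal (0 - (- exp (- c * 0) / c))"
    using assms lim(1) by (intro nn_integral_FTC_atLeast) (auto intro!: derivative_eq_intros)
  then show "(\<integral>\<^sup>+s. ennreal (exp (- c * s)) * indicator {0<..} s \<partial>lborel) = ennreal (1 / c)"
    by (simp add: open_half)
  have "(\<integral>\<^sup>+s. ennreal (s * exp (- c * s)) * indicator {0..} s \<partial>lborel) = ennreal (0 - (- (0 / c + 1 / c\<^sup>2) * exp (- c * 0)))"
    using assms lim(2)
    by (intro nn_integral_FTC_atLeast) (auto intro!: derivative_eq_intros simp: field_simps power2_eq_square)
  then show "(\<integral>\<^sup>+s. ennreal (s * exp (- c * s)) * indicator {0<..} s \<partial>lborel) = ennreal (1 / c\<^sup>2)"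
    by (simp add: open_half)
qed

text \<open>\<open>x\<close> is the station and \<open>z\<close> the user; at \<open>e = 0\<close>
  this is the area that must be free of macro stations. Shrinking both radii by \<open>e\<close>
  gives the room that the mesh needs. The space is general because both models of the plane are
  used.\<close>

definition pair_area :: "real \<Rightarrow> 'a::euclidean_space \<Rightarrow> 'a \<Rightarrow> real" where
  "pair_area e x z = measure lborel (ball 0 (norm x - e) \<union> ball z (dist x z - e))"

lemma measurable_pair_area:
  "(\<lambda>p. pair_area e (fst p) (snd p)) \<in> borel_measurable (borel :: ('a::euclidean_space \<times> 'a) measure)"
  unfolding pair_area_def
proof (rule measurable_measure_open)
  have "{q :: ('a \<times> 'a) \<times> 'a. snd q \<in> ball 0 (norm (fst (fst q)) - e) \<union> ball (snd (fst q)) (dist (fst (fst q)) (snd (fst q)) - e)}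
    = {q. norm (snd q) < norm (fst (fst q)) - e} \<union> {q. dist (snd (fst q)) (snd q) < dist (fst (fst q)) (snd (fst q)) - e}"
    by auto
  also have "open \<dots>" by (intro open_Un open_Collect_less continuous_intros)
  finally show "open {q :: ('a \<times> 'a) \<times> 'a. snd q \<in> ball 0 (norm (fst (fst q)) - e) \<union> ball (snd (fst q)) (dist (fst (fst q)) (snd (fst q)) - e)}" .
qed

lemma emeasure_lborel_vimage_plus:
  fixes x :: "'a::euclidean_space"
  assumes "S \<in> sets borel"
  shows "emeasure lborel ((\<lambda>t. x + t) -` S) = emeasure lborel S"
proof -
  have "emeasure lborel S = emeasure (distr lborel borel ((+) x)) S" by (simp add: lborel_distr_plus)
  also have "\<dots> = emeasure lborel ((\<lambda>t. x + t) -` S)" using assms by (subst emeasure_distr) simp_all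
  finally show ?thesis by simp
qed

lemma nn_integral_exp_union_complex:
  assumes "0 < lam"
  shows "(\<integral>\<^sup>+x. \<integral>\<^sup>+z. ennreal (exp (- lam * pair_area 0 x z)) \<partial>lborel \<partial>(lborel :: complex measure))
    \<le> ennreal (1.2802 / lam\<^sup>2)"
proof -
  have inner: "(\<integral>\<^sup>+z. ennreal (exp (- lam * pair_area 0 x z)) \<partial>lborel)
      = (\<integral>\<^sup>+w. ennreal ((norm x)\<^sup>2 * exp (- (lam * union_area w) * (norm x)\<^sup>2)) \<partial>lborel)" if "x \<noteq> 0" for x :: complex
  proof -
    \<comment> \<open>Seen from \<open>x\<close>, the origin is \<open>- x * 1\<close> and
      \<open>z\<close> is \<open>- x * w\<close>. Dividing by \<open>- x\<close> puts the first
      centre at \<open>1\<close> and contributes the factor \<open>(norm x)^2\<close> to the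
      area.\<close>
    have "pair_area 0 x (x + - x * w) = (norm x)\<^sup>2 * union_area w" for w
    proof -
      have "(\<lambda>t. x + t) -` (ball 0 (norm x) \<union> ball (x + - x * w) (dist x (x + - x * w))) = disc_union (- x * 1) (- x * w)"
      proof (rule set_eqI)
        fix t
        have "dist 0 (x + t) = dist (- x * 1) t" "norm (- x * 1) = norm x"
          using norm_minus_cancel[of "x + t"] by (simp_all add: dist_norm)
        moreover have "dist (x + - x * w) (x + t) = dist (- x * w) t" "dist x (x + - x * w) = norm (- x * w)"
          by (simp_all add: dist_norm)
        ultimately show "t \<in> (\<lambda>t. x + t) -` (ball 0 (norm x) \<union> ball (x + - x * w) (dist x (x + - x * w)))
            \<longleftrightarrow> t \<in> disc_union (- x * 1) (- x * w)"
          by (simp only: disc_union_def vimage_eq Un_iff mem_ball)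
      qed
      then have "emeasure lborel (ball 0 (norm x) \<union> ball (x + - x * w) (dist x (x + - x * w)))
        = emeasure lborel (disc_union (- x * 1) (- x * w))"
        by (metis emeasure_lborel_vimage_plus borel_open open_Un open_ball)
      also have "\<dots> = ennreal ((norm x)\<^sup>2 * union_area w)"
        using that by (subst emeasure_disc_union_mult) (simp_all add: emeasure_disc_union_1 union_area_def flip: ennreal_mult)
      finally show ?thesis by (simp add: pair_area_def measure_def union_area_def)
    qed
    note area = this
    have [measurable]: "pair_area 0 x \<in> borel_measurable borel"
    proof -
      have "(\<lambda>z. (x, z)) \<in> borel_measurable borel"
        by (intro borel_measurable_continuous_onI continuous_intros)
      from measurable_compose[OF this measurable_pair_area[of 0]] show ?thesis by simp
    qed
    have "(\<integral>\<^sup>+z. ennreal (exp (- lam * pair_area 0 x z)) \<partial>lborel)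
      = (\<integral>\<^sup>+z. ennreal (exp (- lam * pair_area 0 x z)) \<partial>distr lborel borel ((+) x))"
      by (simp add: lborel_distr_plus)
    also have "\<dots> = (\<integral>\<^sup>+w. ennreal (exp (- lam * pair_area 0 x (x + w))) \<partial>lborel)"
      by (subst nn_integral_distr) simp_all
    also have "\<dots> = ennreal ((norm (- x))\<^sup>2) * (\<integral>\<^sup>+w. ennreal (exp (- lam * pair_area 0 x (x + - x * w))) \<partial>lborel)"
      using that by (intro nn_integral_mult_complex) simp_all
    also have "\<dots> = ennreal ((norm x)\<^sup>2) * (\<integral>\<^sup>+w. ennreal (exp (- (lam * union_area w) * (norm x)\<^sup>2)) \<partial>lborel)"
      by (simp only: area norm_minus_cancel) (simp add: mult_ac)
    also have "\<dots> = (\<integral>\<^sup>+w. ennreal ((norm x)\<^sup>2) * ennreal (exp (- (lam * union_area w) * (norm x)\<^sup>2)) \<partial>lborel)"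
      by (subst nn_integral_cmult) simp_all
    also have "\<dots> = (\<integral>\<^sup>+w. ennreal ((norm x)\<^sup>2 * exp (- (lam * union_area w) * (norm x)\<^sup>2)) \<partial>lborel)"
      by (simp add: ennreal_mult)
    finally show ?thesis .
  qed
  have "(\<integral>\<^sup>+x. \<integral>\<^sup>+z. ennreal (exp (- lam * pair_area 0 x z)) \<partial>lborel \<partial>(lborel :: complex measure))
    = (\<integral>\<^sup>+x. \<integral>\<^sup>+w. ennreal ((norm x)\<^sup>2 * exp (- (lam * union_area w) * (norm x)\<^sup>2)) \<partial>lborel \<partial>(lborel :: complex measure))"
  proof (rule nn_integral_cong_AE)
    have "AE x in lborel. x \<noteq> (0 :: complex)" by (rule AE_lborel_singleton)
    then show "AE x in (lborel :: complex measure). (\<integral>\<^sup>+z. ennreal (exp (- lam * pair_area 0 x z)) \<partial>lborel)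
      = (\<integral>\<^sup>+w. ennreal ((norm x)\<^sup>2 * exp (- (lam * union_area w) * (norm x)\<^sup>2)) \<partial>lborel)"
      by eventually_elim (rule inner)
  qed
  \<comment> \<open>With \<open>w\<close> fixed, \<open>x\<close> enters only through
    \<open>(norm x)^2\<close>, and the radial integral is
    \<open>\<pi> / (lam * union_area w)^2\<close>.\<close>
  also have "\<dots> = (\<integral>\<^sup>+w. \<integral>\<^sup>+x. ennreal ((norm x)\<^sup>2 * exp (- (lam * union_area w) * (norm x)\<^sup>2)) \<partial>(lborel :: complex measure) \<partial>lborel)"
    by (rule lborel_pair.Fubini'[symmetric]) measurable
  also have "\<dots> = (\<integral>\<^sup>+w. ennreal (pi / lam\<^sup>2) * ennreal (1 / (union_area w)\<^sup>2) \<partial>lborel)"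
  proof (rule nn_integral_cong)
    fix w
    have pos: "0 < lam * union_area w" using assms union_area_pos[of w] pi_gt_zero by (intro mult_pos_pos) linarith+
    have "(\<integral>\<^sup>+x. ennreal ((norm x)\<^sup>2 * exp (- (lam * union_area w) * (norm x)\<^sup>2)) \<partial>(lborel :: complex measure))
      = ennreal pi * (\<integral>\<^sup>+s. ennreal (s * exp (- (lam * union_area w) * s)) * indicator {0<..} s \<partial>lborel)"
      by (rule nn_integral_radial) measurable
    also have "\<dots> = ennreal pi * ennreal (1 / (lam * union_area w)\<^sup>2)"
      by (simp only: nn_integral_exp_half_line(2)[OF pos])
    also have "\<dots> = ennreal (pi / lam\<^sup>2) * ennreal (1 / (union_area w)\<^sup>2)"
      by (simp add: power_mult_distrib flip: ennreal_mult)
    finally show "(\<integral>\<^sup>+x. ennreal ((norm x)\<^sup>2 * exp (- (lam * union_area w) * (norm x)\<^sup>2)) \<partial>(lborel :: complex measure))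
      = ennreal (pi / lam\<^sup>2) * ennreal (1 / (union_area w)\<^sup>2)" .
  qed
  also have "\<dots> = ennreal (pi / lam\<^sup>2) * (\<integral>\<^sup>+w. ennreal (1 / (union_area w)\<^sup>2) \<partial>lborel)"
    by (rule nn_integral_cmult) measurable
  also have "\<dots> \<le> ennreal (pi / lam\<^sup>2) * ennreal (1.2802 / pi)"
    by (intro mult_left_mono inverse_square_union_area_le) simp
  also have "\<dots> = ennreal (1.2802 / lam\<^sup>2)"
    using assms by (simp flip: ennreal_mult)
  finally show ?thesis .
qed

section \<open>The complex plane as a model of \<open>real ^ 2\<close>\<close>

definition plane :: "complex \<Rightarrow> real ^ 2" where
  "plane z = Re z *\<^sub>R axis 1 1 + Im z *\<^sub>R axis 2 1"

lemma measurable_plane [measurable]: "plane \<in> borel_measurable borel"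
  unfolding plane_def[abs_def] by (intro borel_measurable_continuous_onI continuous_intros)

lemma distr_plane: "distr lborel borel plane = lborel"
proof -
  have pair: "distr (lborel :: (real \<times> real) measure) borel (\<lambda>(x, y). x *\<^sub>R 1 + y *\<^sub>R \<i>) = lborel"
    by (intro distr_lborel_basis2) (auto simp: Basis_complex_def complex_eq_iff)
  have m: "(\<lambda>(x, y). x *\<^sub>R 1 + y *\<^sub>R \<i>) \<in> (lborel :: (real \<times> real) measure) \<rightarrow>\<^sub>M borel"
    by (simp, intro borel_measurable_continuous_onI) (auto simp: case_prod_beta intro!: continuous_intros)
  have "distr lborel borel plane = distr (distr (lborel :: (real \<times> real) measure) borel (\<lambda>(x, y). x *\<^sub>R 1 + y *\<^sub>R \<i>)) borel plane"
    by (simp only: pair)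
  also have "\<dots> = distr lborel borel (plane \<circ> (\<lambda>(x, y). x *\<^sub>R 1 + y *\<^sub>R \<i>))"
    by (rule distr_distr[OF measurable_plane m])
  also have "plane \<circ> (\<lambda>(x, y). x *\<^sub>R 1 + y *\<^sub>R \<i>) = (\<lambda>(x, y). x *\<^sub>R axis 1 1 + y *\<^sub>R axis 2 1)"
    by (auto simp: plane_def)
  also have "distr lborel borel \<dots> = lborel"
    by (intro distr_lborel_basis2) (auto simp: Basis_vec_def axis_eq_axis UNIV_2)
  finally show ?thesis .
qed

lemma dist_plane: "dist (plane x) (plane z) = dist x z"
proof -
  have "plane x - plane z = Re (x - z) *\<^sub>R axis 1 1 + Im (x - z) *\<^sub>R axis 2 1"
    by (simp add: plane_def algebra_simps)
  then show ?thesis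
    by (simp add: dist_norm norm_vec_def L2_set_def UNIV_2 axis_def cmod_def)
qed

lemma norm_plane: "norm (plane x) = norm x"
  using dist_plane[of x 0] by (simp add: dist_norm plane_def)

lemma nn_integral_exp_union_plane:
  assumes "0 < lam"
  shows "(\<integral>\<^sup>+x. \<integral>\<^sup>+z. ennreal (exp (- lam * pair_area 0 x z)) \<partial>lborel \<partial>(lborel :: (real ^ 2) measure))
    \<le> ennreal (1.2802 / lam\<^sup>2)"
proof -
  define F where "F x z = ennreal (exp (- lam * pair_area 0 x z))" for x z :: "real ^ 2"
  have F: "(\<lambda>p. F (fst p) (snd p)) \<in> borel_measurable (borel \<Otimes>\<^sub>M borel)"
    using measurable_pair_area[of 0] unfolding F_def borel_prod by measurable
  then have [measurable]: "(\<lambda>x. F (f x) (g x)) \<in> borel_measurable N"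
    if [measurable]: "f \<in> borel_measurable N" "g \<in> borel_measurable N" for f g and N :: "'c measure"
    using measurable_compose[OF measurable_Pair[OF that] F] by simp
  have "F (plane x) (plane z) = ennreal (exp (- lam * pair_area 0 x z))" for x z
  proof -
    have "plane -` (ball 0 (norm (plane x)) \<union> ball (plane z) (dist (plane x) (plane z))) = ball 0 (norm x) \<union> ball z (dist x z)"
      by (auto simp: dist_plane norm_plane)
    moreover have "measure lborel (ball 0 (norm (plane x)) \<union> ball (plane z) (dist (plane x) (plane z)))
      = measure (distr lborel borel plane) (ball 0 (norm (plane x)) \<union> ball (plane z) (dist (plane x) (plane z)))"
      by (simp only: distr_plane)
    ultimately show ?thesis unfolding F_def pair_area_def diff_zero by (simp add: measure_distr)
  qed
  note eq = this
  have "(\<integral>\<^sup>+x. \<integral>\<^sup>+z. F x z \<partial>lborel \<partial>lborel) = (\<integral>\<^sup>+x. \<integral>\<^sup>+z. F x z \<partial>distr lborel borel plane \<partial>distr lborel borel plane)"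
    by (simp only: distr_plane)
  also have "\<dots> = (\<integral>\<^sup>+x. \<integral>\<^sup>+z. F (plane x) (plane z) \<partial>lborel \<partial>lborel)"
  proof -
    have "(\<integral>\<^sup>+z. F x z \<partial>distr lborel borel plane) = (\<integral>\<^sup>+z. F x (plane z) \<partial>lborel)" for x
      by (rule nn_integral_distr) measurable
    then show ?thesis by (simp, subst nn_integral_distr) measurable
  qed
  also have "\<dots> \<le> ennreal (1.2802 / lam\<^sup>2)"
    unfolding eq by (rule nn_integral_exp_union_complex[OF assms])
  finally show ?thesis unfolding F_def .
qed

subsection \<open>Poisson processes\<close>

text \<open>Two macro stations transmit with the same power, so comparing received powers compares
  distances. A user exactly at \<open>Y\<close> would receive infinite power from it, which has to
  be excluded first.\<close>

lemma het_cell_macro_closer: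
  assumes "z \<in> het_cell (A \<union> A') (\<lambda>x. if x \<in> A then P else P') beta X"
    and "X \<in> A" "Y \<in> A" "0 < P" "0 < beta"
  shows "dist X z \<le> dist Y z"
proof (rule ccontr)
  assume "\<not> dist X z \<le> dist Y z"
  then have less: "dist Y z < dist X z" by simp
  then have "X \<noteq> z" by auto
  have "\<forall>Y\<in>A \<union> A'. rx_power (if Y \<in> A then P else P') beta Y z \<le> rx_power (if X \<in> A then P else P') beta X z"
    using assms(1) by (simp only: het_cell_def mem_Collect_eq)
  from bspec[OF this, of Y] have le: "rx_power P beta Y z \<le> rx_power P beta X z"
    using assms(2,3) by simp
  have "Y \<noteq> z" using le \<open>X \<noteq> z\<close> \<open>0 < P\<close> by (auto simp: rx_power_def)
  then have "dist Y z powr (- beta) \<le> dist X z powr (- beta)"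
    using le \<open>X \<noteq> z\<close> \<open>0 < P\<close> by (simp add: rx_power_def)
  moreover have "dist X z powr (- beta) < dist Y z powr (- beta)"
    using less \<open>Y \<noteq> z\<close> assms(5) by (intro powr_less_mono2_neg) auto
  ultimately show False by simp
qed

text \<open>A ball slightly larger than the norm of some point of \<open>S\<close> contains finitely
  many points, so a minimum exists and the choice operator returns a minimiser.\<close>

lemma nearest_to_origin_least:
  assumes "S \<noteq> {}" "\<And>r. finite (S \<inter> ball 0 r)"
  shows "nearest_to_origin S \<in> S" "\<And>y. y \<in> S \<Longrightarrow> norm (nearest_to_origin S) \<le> norm y"
proof -
  obtain y where y: "y \<in> S" using assms(1) by blast
  define F where "F = S \<inter> ball 0 (norm y + 1)"
  have F: "finite F" "F \<noteq> {}" using assms(2) y by (auto simp: F_def)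
  obtain x where x: "x \<in> F" "\<And>x'. x' \<in> F \<Longrightarrow> norm x \<le> norm x'"
    using ex_is_arg_min_if_finite[OF F, of norm] by (auto simp: is_arg_min_linorder)
  have "norm x \<le> norm x'" if "x' \<in> S" for x'
  proof (cases "x' \<in> F")
    case False
    then have "norm y + 1 \<le> norm x'" using that by (auto simp: F_def)
    moreover have "norm x < norm y + 1" using x(1) by (simp add: F_def)
    ultimately show ?thesis by simp
  qed (rule x(2))
  then have "\<exists>x. x \<in> S \<and> (\<forall>y\<in>S. norm x \<le> norm y)" using x(1) by (auto simp: F_def)
  then have "nearest_to_origin S \<in> S \<and> (\<forall>y\<in>S. norm (nearest_to_origin S) \<le> norm y)"
    unfolding nearest_to_origin_def by (rule someI_ex)
  then show "nearest_to_origin S \<in> S" "\<And>y. y \<in> S \<Longrightarrow> norm (nearest_to_origin S) \<le> norm y" by auto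
qed

section \<open>Consequences of the Poisson law\<close>

lemma poisson_ppD:
  assumes "poisson_pp M lam Phi"
  shows "prob_space M" "0 \<le> lam"
    and "\<And>B. B \<in> sets borel \<Longrightarrow> bounded B \<Longrightarrow> AE \<omega> in M. finite (Phi \<omega> \<inter> B)"
    and "\<And>B k. B \<in> sets borel \<Longrightarrow> bounded B \<Longrightarrow> {\<omega> \<in> space M. card (Phi \<omega> \<inter> B) = k} \<in> sets M"
    and "\<And>B k. B \<in> sets borel \<Longrightarrow> bounded B \<Longrightarrow> measure M {\<omega> \<in> space M. card (Phi \<omega> \<inter> B) = k}
             = (lam * measure lborel B) ^ k * exp (- (lam * measure lborel B)) / fact k"
  using assms unfolding poisson_pp_def by blast+

lemma AE_locally_finite:
  assumes "poisson_pp M lam Phi"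
  shows "AE \<omega> in M. \<forall>r. finite (Phi \<omega> \<inter> ball 0 r)"
proof -
  have "AE \<omega> in M. \<forall>n::nat. finite (Phi \<omega> \<inter> ball 0 (real n))"
    using poisson_ppD(3)[OF assms] by (simp add: AE_all_countable)
  then show ?thesis
  proof eventually_elim
    case (elim \<omega>)
    show ?case
    proof
      fix r :: real
      obtain n where "r \<le> real n" using real_arch_simple by blast
      then show "finite (Phi \<omega> \<inter> ball 0 r)"
        using elim by (meson Int_mono finite_subset order_refl subset_ball)
    qed
  qed
qed

text \<open>For an empty configuration the nearest station would be unspecified. The void
  probabilities \<open>exp (- lam * \<pi> * n^2)\<close> of growing balls tend to 0, so this is a
  null event.\<close>

lemma AE_nonempty:
  assumes P: "poisson_pp M lam Phi" and "0 < lam"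
  shows "AE \<omega> in M. Phi \<omega> \<noteq> {}"
proof -
  interpret prob_space M by (rule poisson_ppD(1)[OF P])
  define A where "A n = {\<omega> \<in> space M. card (Phi \<omega> \<inter> ball 0 (real n)) = 0}" for n
  have A[measurable]: "A n \<in> sets M" for n
    unfolding A_def by (rule poisson_ppD(4)[OF P]) auto
  have pA: "prob (A n) = exp (- (lam * pi) * (real n)\<^sup>2)" for n
  proof -
    have "measure lborel (ball (0 :: point) (real n)) = pi * (real n)\<^sup>2"
      by (simp add: content_ball unit_ball_vol_2)
    then show ?thesis unfolding A_def using poisson_ppD(5)[OF P, of "ball 0 (real n)" 0] by simp
  qed
  have "(\<lambda>n. exp (- (lam * pi) * (real n)\<^sup>2)) \<longlonglongrightarrow> 0"
    using assms(2) pi_gt_zero by real_asymp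
  moreover have "prob (\<Inter>n. A n) \<le> exp (- (lam * pi) * (real n)\<^sup>2)" for n
    unfolding pA[symmetric] by (intro finite_measure_mono) auto
  ultimately have "prob (\<Inter>n. A n) \<le> 0"
    by (intro LIMSEQ_le_const) auto
  then have "(\<Inter>n. A n) \<in> null_sets M"
    by (intro null_setsI) (simp_all add: emeasure_eq_measure measure_nonneg antisym)
  then have "AE \<omega> in M. \<omega> \<notin> (\<Inter>n. A n)" by (rule AE_not_in)
  then show ?thesis
    using AE_space by eventually_elim (auto simp: A_def)
qed

lemma sums_poisson_mean:
  "(\<lambda>k. real k * (m ^ k * exp (- m) / fact k)) sums (m :: real)"
proof -
  have "(\<lambda>k. m * exp (- m) * (m ^ k /\<^sub>R fact k)) sums (m * exp (- m) * exp m)"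
    by (intro sums_mult exp_converges)
  moreover have "m * exp (- m) * (m ^ k /\<^sub>R fact k) = real (Suc k) * (m ^ Suc k * exp (- m) / fact (Suc k))" for k
    by (simp add: field_simps del: of_nat_Suc)
  moreover have "m * exp (- m) * exp m = m" by (simp add: mult.assoc exp_minus_inverse flip: exp_add)
  ultimately have "(\<lambda>k. real (Suc k) * (m ^ Suc k * exp (- m) / fact (Suc k))) sums m" by simp
  then show ?thesis using sums_Suc_iff[of "\<lambda>k. real k * (m ^ k * exp (- m) / fact k)" m] by simp
qed

text \<open>Splitting by the value of the count turns the left side into a series over the level
  events, to which the product rule applies term by term; what remains is the mean of a Poisson
  variable.\<close>

lemma nn_integral_card_indep:
  assumes P: "poisson_pp M mu U" and Q: "Q \<in> sets borel" "bounded Q" and E: "E \<in> sets M"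
    and indep: "\<And>k. measure M ({\<omega> \<in> space M. card (U \<omega> \<inter> Q) = k} \<inter> E)
      = measure M {\<omega> \<in> space M. card (U \<omega> \<inter> Q) = k} * measure M E"
  shows "(\<integral>\<^sup>+\<omega>. of_nat (card (U \<omega> \<inter> Q)) * indicator E \<omega> \<partial>M) = ennreal (mu * measure lborel Q) * ennreal (measure M E)"
proof -
  interpret prob_space M by (rule poisson_ppD(1)[OF P])
  define m where "m = mu * measure lborel Q"
  have m: "0 \<le> m" using poisson_ppD(2)[OF P] by (simp add: m_def)
  define A where "A k = {\<omega> \<in> space M. card (U \<omega> \<inter> Q) = k}" for k
  have A[measurable]: "A k \<in> sets M" for k
    unfolding A_def by (rule poisson_ppD(4)[OF P Q])
  note E[measurable]
  have "(\<integral>\<^sup>+\<omega>. of_nat (card (U \<omega> \<inter> Q)) * indicator E \<omega> \<partial>M) = (\<integral>\<^sup>+\<omega>. (\<Sum>k. of_nat k * indicator (A k \<inter> E) \<omega>) \<partial>M)"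
  proof (rule nn_integral_cong)
    fix \<omega> assume \<omega>: "\<omega> \<in> space M"
    have "(\<Sum>k. of_nat k * indicator (A k \<inter> E) \<omega>) = (\<Sum>k\<in>{card (U \<omega> \<inter> Q)}. of_nat k * indicator (A k \<inter> E) \<omega> :: ennreal)"
      by (rule suminf_finite) (auto simp: A_def)
    then show "of_nat (card (U \<omega> \<inter> Q)) * indicator E \<omega> = (\<Sum>k. of_nat k * indicator (A k \<inter> E) \<omega> :: ennreal)"
      using \<omega> by (simp add: A_def indicator_def)
  qed
  also have "\<dots> = (\<Sum>k. of_nat k * emeasure M (A k \<inter> E))"
    by (subst nn_integral_suminf) (simp_all add: nn_integral_cmult)
  also have "\<dots> = (\<Sum>k. ennreal (real k * (m ^ k * exp (- m) / fact k)) * ennreal (prob E))"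
  proof (rule arg_cong[where f = suminf], rule ext)
    fix k
    have "emeasure M (A k \<inter> E) = ennreal (m ^ k * exp (- m) / fact k * prob E)"
      using indep[of k] poisson_ppD(5)[OF P Q, of k] by (simp add: emeasure_eq_measure A_def m_def)
    then show "of_nat k * emeasure M (A k \<inter> E) = ennreal (real k * (m ^ k * exp (- m) / fact k)) * ennreal (prob E)"
      using m by (simp add: ennreal_of_nat_eq_real_of_nat mult_ac flip: ennreal_mult)
  qed
  also have "\<dots> = (\<Sum>k. ennreal (real k * (m ^ k * exp (- m) / fact k))) * ennreal (prob E)"
    by (rule ennreal_suminf_multc)
  also have "(\<Sum>k. ennreal (real k * (m ^ k * exp (- m) / fact k))) = ennreal m"
    using sums_poisson_mean[of m] m by (intro suminf_ennreal_eq) auto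
  finally show ?thesis by (simp add: m_def)
qed

text \<open>Up to a null set this is the event that \<open>\<Phi>\<close> meets \<open>R\<close> but not \<open>B\<close>.\<close>
lemma prob_nearest_event_le:
  assumes P: "poisson_pp M lam Phi" and R: "R \<in> sets borel" "bounded R" and B: "B \<in> sets borel" "bounded B"
    and disj: "R \<inter> B = {}"
  shows "measure M ({\<omega> \<in> space M. card (Phi \<omega> \<inter> B) = 0} - {\<omega> \<in> space M. card (Phi \<omega> \<inter> (R \<union> B)) = 0})
    \<le> lam * measure lborel R * exp (- lam * measure lborel B)"
proof -
  interpret prob_space M by (rule poisson_ppD(1)[OF P])
  define A where "A = {\<omega> \<in> space M. card (Phi \<omega> \<inter> B) = 0}"
  define C where "C = {\<omega> \<in> space M. card (Phi \<omega> \<inter> (R \<union> B)) = 0}"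
  have RB: "R \<union> B \<in> sets borel" "bounded (R \<union> B)" using R B by auto
  have meas: "A \<in> sets M" "C \<in> sets M" unfolding A_def C_def using B RB by (auto intro: poisson_ppD(4)[OF P])
  have pA: "prob A = exp (- lam * measure lborel B)"
    using poisson_ppD(5)[OF P B, of 0] by (simp add: A_def)
  have "measure lborel (R \<union> B) = measure lborel R + measure lborel B"
    using R B disj emeasure_bounded_finite[of R] emeasure_bounded_finite[of B]
    by (intro measure_Union) auto
  then have pC: "prob C = exp (- lam * measure lborel R) * exp (- lam * measure lborel B)"
    using poisson_ppD(5)[OF P RB, of 0] by (simp add: C_def algebra_simps flip: exp_add)
  \<comment> \<open>\<open>card\<close> is also 0 on infinite sets, so \<open>C\<close> lies in
    \<open>A\<close> only up to the null event that the intersection is infinite.\<close>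
  have "prob (A \<inter> C) = prob C"
  proof (rule finite_measure_eq_AE)
    show "AE \<omega> in M. \<omega> \<in> A \<inter> C \<longleftrightarrow> \<omega> \<in> C"
      using poisson_ppD(3)[OF P RB] AE_space
      by eventually_elim (auto simp: A_def C_def Int_Un_distrib)
  qed (use meas in auto)
  then have "prob (A - C) = exp (- lam * measure lborel B) * (1 - exp (- lam * measure lborel R))"
    using finite_measure_Diff'[of A C] meas pA pC by (simp add: algebra_simps)
  also have "\<dots> \<le> exp (- lam * measure lborel B) * (lam * measure lborel R)"
  proof (rule mult_left_mono)
    show "1 - exp (- lam * measure lborel R) \<le> lam * measure lborel R"
      using exp_ge_add_one_self[of "- lam * measure lborel R"] by simp
  qed simp
  finally show ?thesis unfolding A_def C_def by (simp add: mult_ac)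
qed

section \<open>The mesh\<close>

text \<open>Half-open squares of side \<open>d / 2\<close>, numbered by coding the pair of integer
  parts; in the sum norm their diameter is at most \<open>d\<close>. Numbers that code no pair give
  empty mesh cells.\<close>

lemma ex_grid:
  assumes "0 < d"
  shows "\<exists>Q :: nat \<Rightarrow> point set. (\<forall>n. Q n \<in> sets borel) \<and> disjoint_family Q \<and> (\<Union>n. Q n) = UNIV
    \<and> (\<forall>n. \<forall>x\<in>Q n. \<forall>y\<in>Q n. dist x y \<le> d)"
proof -
  define e where "e = d / 2"
  have e: "0 < e" using assms by (simp add: e_def)
  define idx where "idx x = to_nat (\<lfloor>x $ 1 / e\<rfloor>, \<lfloor>x $ 2 / e\<rfloor>)" for x :: point
  define Q where "Q n = {x. idx x = n}" for n
  have "Q n \<in> sets borel" for n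
  proof -
    have "Q n = (\<Union>(i, j)\<in>{ij. to_nat ij = n}. {x. \<lfloor>x $ 1 / e\<rfloor> = i} \<inter> {x. \<lfloor>x $ 2 / e\<rfloor> = j})"
      by (auto simp: Q_def idx_def)
    moreover have "{x :: point. \<lfloor>x $ k / e\<rfloor> = i} \<in> sets borel" for k i
    proof -
      have "{x :: point. \<lfloor>x $ k / e\<rfloor> = i} = {x. of_int i \<le> x $ k / e} \<inter> {x. x $ k / e < of_int i + 1}"
        by (auto simp: floor_eq_iff)
      moreover have "{x :: point. of_int i \<le> x $ k / e} \<in> sets borel" "{x :: point. x $ k / e < of_int i + 1} \<in> sets borel"
        using e by (intro borel_closed borel_open closed_Collect_le open_Collect_less continuous_intros; simp)+
      ultimately show ?thesis by auto
    qed
    ultimately show ?thesis by (auto intro!: sets.countable_UN')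
  qed
  moreover have "disjoint_family Q" by (auto simp: disjoint_family_on_def Q_def)
  moreover have "(\<Union>n. Q n) = UNIV" by (auto simp: Q_def)
  moreover have "dist x y \<le> d" if "x \<in> Q n" "y \<in> Q n" for x y n
  proof -
    have "\<lfloor>x $ 1 / e\<rfloor> = \<lfloor>y $ 1 / e\<rfloor>" "\<lfloor>x $ 2 / e\<rfloor> = \<lfloor>y $ 2 / e\<rfloor>"
      using that unfolding Q_def idx_def mem_Collect_eq by (metis to_nat_split prod.inject)+
    then have "\<bar>x $ 1 / e - y $ 1 / e\<bar> \<le> 1" "\<bar>x $ 2 / e - y $ 2 / e\<bar> \<le> 1" by linarith+
    then have "\<bar>(x - y) $ 1\<bar> \<le> e" "\<bar>(x - y) $ 2\<bar> \<le> e"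
      using e by (simp_all add: abs_le_iff field_simps)
    moreover have "norm (x - y) \<le> \<bar>(x - y) $ 1\<bar> + \<bar>(x - y) $ 2\<bar>"
      using norm_le_l1_cart[of "x - y"] by (simp add: sum_2)
    ultimately show ?thesis by (simp add: dist_norm e_def)
  qed
  ultimately show ?thesis by blast
qed

text \<open>For a mesh of width \<open>d\<close>, let \<open>X\<close> be the macro station nearest to the origin, lying in the mesh cell \<open>Q r\<close>. A user in
  \<open>Q q\<close> served by \<open>X\<close> forces the macro stations to avoid a region determined by the representatives of the two mesh cells.\<close>
lemma mean_users_le_mesh:
  fixes c :: "nat \<Rightarrow> point"
  assumes Phi: "poisson_pp M lam Phi" and U: "poisson_pp M mu V" and lam: "0 < lam"
    and indep: "\<And>A E. A \<in> sigma_sets (space M) (proc_events M V) \<Longrightarrow> E \<in> sigma_sets (space M) (proc_events M Phi)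
      \<Longrightarrow> measure M (A \<inter> E) = measure M A * measure M E"
    and Q: "\<And>n. Q n \<in> sets borel" "disjoint_family Q" "(\<Union>n. Q n) = UNIV"
    and d: "\<And>n x. x \<in> Q n \<Longrightarrow> dist x (c n) \<le> d"
    and cell: "\<And>\<omega> z y. z \<in> cell \<omega> \<Longrightarrow> nearest_to_origin (Phi \<omega>) \<in> Phi \<omega> \<Longrightarrow> y \<in> Phi \<omega> \<Longrightarrow> dist (nearest_to_origin (Phi \<omega>)) z \<le> dist y z"
  shows "(\<integral>\<^sup>+\<omega>. ecount (V \<omega> \<inter> cell \<omega>) \<partial>M) \<le> (\<Sum>q. \<Sum>r. ennreal (mu * measure lborel (Q q)) *
      ennreal (lam * measure lborel (Q r) * exp (- lam * measure lborel
        (ball 0 (norm (c r) - d) \<union> ball (c q) (dist (c r) (c q) - 3 * d)))))"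
proof -
  interpret prob_space M by (rule poisson_ppD(1)[OF Phi])
  \<comment> \<open>The radii are reduced so that a macro station in this region contradicts the
    choice of \<open>X\<close> or the service of \<open>z\<close> by \<open>X\<close>: one
    \<open>d\<close> for replacing \<open>X\<close> by \<open>c r\<close>, and in the second disc
    two more for replacing \<open>z\<close> by \<open>c q\<close> in both distances
    compared.\<close>
  define B where "B q r = ball 0 (norm (c r) - d) \<union> ball (c q) (dist (c r) (c q) - 3 * d)" for q r
  have B: "B q r \<in> sets borel" "bounded (B q r)" for q r by (auto simp: B_def)
  have bdd: "bounded (Q n)" for n
    by (rule bounded_subset[of "cball (c n) d"]) (use d in \<open>auto simp: dist_commute\<close>)
  have disj: "Q r \<inter> B q r = {}" for q r
  proof -
    have False if y: "y \<in> Q r" "y \<in> B q r" for y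
    proof -
      have "dist y (c r) \<le> d" using d y by blast
      moreover have "0 \<le> d" using calculation by (rule order_trans[OF zero_le_dist])
      moreover have "norm (c r) \<le> norm y + dist y (c r)"
        using norm_triangle_ineq2[of "c r" y] by (simp add: dist_norm norm_minus_commute)
      moreover have "dist (c r) (c q) \<le> dist y (c r) + dist y (c q)"
        by (rule dist_triangle3)
      ultimately show False using y(2) by (auto simp: B_def dist_commute)
    qed
    then show ?thesis by blast
  qed
  define E where "E q r = {\<omega> \<in> space M. card (Phi \<omega> \<inter> B q r) = 0} - {\<omega> \<in> space M. card (Phi \<omega> \<inter> (Q r \<union> B q r)) = 0}" for q r
  have QB: "Q r \<union> B q r \<in> sets borel" "bounded (Q r \<union> B q r)" for q r using Q B bdd by auto
  have E_meas[measurable]: "E q r \<in> sets M" for q r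
    unfolding E_def using B QB by (intro sets.Diff poisson_ppD(4)[OF Phi])
  \<comment> \<open>Independence is available on the generated sigma algebras, so the event has to
    be expressed through counts of macro stations.\<close>
  have E_sigma: "E q r \<in> sigma_sets (space M) (proc_events M Phi)" for q r
  proof -
    interpret S: sigma_algebra "space M" "sigma_sets (space M) (proc_events M Phi)"
      by (rule sigma_algebra_sigma_sets) (auto simp: proc_events_def)
    show ?thesis unfolding E_def using B QB by (intro S.Diff) (auto simp: proc_events_def intro!: sigma_sets.Basic)
  qed
  have V_meas: "{\<omega> \<in> space M. card (V \<omega> \<inter> Q q) = k} \<in> sets M" for q k
    by (rule poisson_ppD(4)[OF U Q(1) bdd])
  have V_nat: "(\<lambda>\<omega>. card (V \<omega> \<inter> Q q)) \<in> measurable M (count_space UNIV)" for q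
  proof (rule measurable_count_space_eq2_countable[THEN iffD2])
    show "(\<lambda>\<omega>. card (V \<omega> \<inter> Q q)) \<in> space M \<rightarrow> UNIV \<and> (\<forall>k\<in>UNIV. (\<lambda>\<omega>. card (V \<omega> \<inter> Q q)) -` {k} \<inter> space M \<in> sets M)"
      using V_meas[of q] by (auto simp: vimage_def Int_def conj_commute)
  qed
  have [measurable]: "(\<lambda>\<omega>. of_nat (card (V \<omega> \<inter> Q q)) :: ennreal) \<in> borel_measurable M" for q
    using measurable_compose[OF V_nat, of of_nat borel] by simp
  have "AE \<omega> in M. \<forall>q. finite (V \<omega> \<inter> Q q)"
    using poisson_ppD(3)[OF U Q(1) bdd] by (simp add: AE_all_countable)
  then have "AE \<omega> in M. ecount (V \<omega> \<inter> cell \<omega>) \<le> (\<Sum>q. \<Sum>r. of_nat (card (V \<omega> \<inter> Q q)) * indicator (E q r) \<omega>)"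
    using AE_locally_finite[OF Phi] AE_nonempty[OF Phi lam] AE_space
  proof eventually_elim
    case (elim \<omega>)
    define X where "X = nearest_to_origin (Phi \<omega>)"
    have X: "X \<in> Phi \<omega>" "\<And>y. y \<in> Phi \<omega> \<Longrightarrow> norm X \<le> norm y"
      unfolding X_def using elim nearest_to_origin_least by blast+
    obtain r where r: "X \<in> Q r" using Q(3) by blast
    \<comment> \<open>As a counting measure, \<open>ecount\<close> is countably subadditive over the
      mesh.\<close>
    have ecount_emeasure: "ecount S = emeasure (count_space UNIV) S" for S
      by (simp add: ecount_def emeasure_count_space)
    have "ecount (V \<omega> \<inter> cell \<omega>) = emeasure (count_space UNIV) (\<Union>q. V \<omega> \<inter> cell \<omega> \<inter> Q q)"
      using Q(3) unfolding ecount_emeasure by (intro arg_cong2[where f = emeasure] refl) blast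
    also have "\<dots> \<le> (\<Sum>q. emeasure (count_space UNIV) (V \<omega> \<inter> cell \<omega> \<inter> Q q))"
      by (intro emeasure_subadditive_countably) auto
    also have "\<dots> \<le> (\<Sum>q. \<Sum>r. of_nat (card (V \<omega> \<inter> Q q)) * indicator (E q r) \<omega>)"
    proof (intro suminf_le summableI)
      fix q
      show "emeasure (count_space UNIV) (V \<omega> \<inter> cell \<omega> \<inter> Q q) \<le> (\<Sum>r. of_nat (card (V \<omega> \<inter> Q q)) * indicator (E q r) \<omega>)"
      proof (cases "V \<omega> \<inter> cell \<omega> \<inter> Q q = {}")
        case False
        then obtain z where z: "z \<in> cell \<omega>" "z \<in> Q q" by blast
        have empty: "Phi \<omega> \<inter> B q r = {}"
        proof -
          have False if y: "y \<in> Phi \<omega>" "y \<in> B q r" for y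
          proof -
            have "dist X z \<le> dist y z" "norm X \<le> norm y" using cell z(1) X y(1) unfolding X_def by blast+
            moreover have "dist X (c r) \<le> d" "dist z (c q) \<le> d" using d r z(2) by blast+
            moreover have "norm (c r) \<le> norm X + dist X (c r)"
              using norm_triangle_ineq2[of "c r" X] by (simp add: dist_norm norm_minus_commute)
            moreover have "dist y z \<le> dist y (c q) + dist z (c q)" by (rule dist_triangle2)
            moreover have "dist (c r) (c q) \<le> dist X (c r) + dist X (c q)" by (rule dist_triangle3)
            moreover have "dist X (c q) \<le> dist X z + dist z (c q)" by (rule dist_triangle)
            ultimately show False using y(2) by (auto simp: B_def dist_commute)
          qed
          then show ?thesis by blast
        qed
        have "finite (Phi \<omega> \<inter> (Q r \<union> B q r))"
        proof -
          obtain R where "Q r \<union> B q r \<subseteq> ball 0 R" using QB(2) bounded_subset_ballD by blast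
          then show ?thesis using elim by (meson Int_mono finite_subset order_refl)
        qed
        then have "card (Phi \<omega> \<inter> (Q r \<union> B q r)) \<noteq> 0" using X(1) r by auto
        then have "\<omega> \<in> E q r" using empty elim by (simp add: E_def)
        \<comment> \<open>The summand of the mesh cell that holds \<open>X\<close> suffices; all
          others are nonnegative.\<close>
        then have "of_nat (card (V \<omega> \<inter> Q q)) = (\<Sum>r\<in>{r}. of_nat (card (V \<omega> \<inter> Q q)) * indicator (E q r) \<omega> :: ennreal)"
          by simp
        also have "\<dots> \<le> (\<Sum>r. of_nat (card (V \<omega> \<inter> Q q)) * indicator (E q r) \<omega>)"
          by (rule sum_le_suminf) (auto intro: summableI)
        finally have "of_nat (card (V \<omega> \<inter> Q q)) \<le> (\<Sum>r. of_nat (card (V \<omega> \<inter> Q q)) * indicator (E q r) \<omega> :: ennreal)" .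
        moreover have "emeasure (count_space UNIV) (V \<omega> \<inter> cell \<omega> \<inter> Q q) \<le> emeasure (count_space UNIV) (V \<omega> \<inter> Q q)"
          by (intro emeasure_mono) auto
        ultimately show ?thesis using elim by (auto simp: emeasure_count_space_finite intro: order_trans)
      qed simp
    qed
    finally show ?case .
  qed
  \<comment> \<open>The left integrand is merely compared almost everywhere with a sum of measurable
    terms, and only this sum is integrated further.\<close>
  then have "(\<integral>\<^sup>+\<omega>. ecount (V \<omega> \<inter> cell \<omega>) \<partial>M) \<le> (\<integral>\<^sup>+\<omega>. (\<Sum>q. \<Sum>r. of_nat (card (V \<omega> \<inter> Q q)) * indicator (E q r) \<omega>) \<partial>M)"
    by (rule nn_integral_mono_AE)
  also have "\<dots> = (\<Sum>q. \<integral>\<^sup>+\<omega>. (\<Sum>r. of_nat (card (V \<omega> \<inter> Q q)) * indicator (E q r) \<omega>) \<partial>M)"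
    by (rule nn_integral_suminf) measurable
  also have "\<dots> = (\<Sum>q. \<Sum>r. \<integral>\<^sup>+\<omega>. of_nat (card (V \<omega> \<inter> Q q)) * indicator (E q r) \<omega> \<partial>M)"
    by (intro suminf_cong nn_integral_suminf) measurable
  also have "\<dots> = (\<Sum>q. \<Sum>r. ennreal (mu * measure lborel (Q q)) * ennreal (prob (E q r)))"
    by (intro suminf_cong nn_integral_card_indep[OF U Q(1) bdd] E_meas indep E_sigma)
      (auto simp: proc_events_def intro!: sigma_sets.Basic Q(1) bdd)
  also have "\<dots> \<le> (\<Sum>q. \<Sum>r. ennreal (mu * measure lborel (Q q)) * ennreal (lam * measure lborel (Q r) * exp (- lam * measure lborel (B q r))))"
    unfolding E_def
    by (intro suminf_le summableI mult_left_mono ennreal_leI prob_nearest_event_le[OF Phi Q(1) bdd B disj]) simp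
  finally show ?thesis unfolding B_def .
qed

text \<open>The double sum is the integral of a step function that on
  \<open>Q r \<times> Q q\<close> stays below the exponential on the right. The slack
  \<open>6 * d\<close> is the \<open>3 * d\<close> already present, \<open>d\<close> for moving the
  centre from \<open>c q\<close> to \<open>z\<close>, and \<open>2 * d\<close> for moving both ends
  of the distance.\<close>

lemma mesh_sum_le_integral:
  fixes c :: "nat \<Rightarrow> point"
  assumes lam: "0 < lam" and mu: "0 \<le> mu"
    and Q: "\<And>n. Q n \<in> sets borel" "disjoint_family Q" "(\<Union>n. Q n) = UNIV"
    and d: "\<And>n x. x \<in> Q n \<Longrightarrow> dist x (c n) \<le> d"
  shows "(\<Sum>q. \<Sum>r. ennreal (mu * measure lborel (Q q)) *
      ennreal (lam * measure lborel (Q r) * exp (- lam * measure lborel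
        (ball 0 (norm (c r) - d) \<union> ball (c q) (dist (c r) (c q) - 3 * d)))))
    \<le> ennreal (mu * lam) * (\<integral>\<^sup>+p. ennreal (exp (- lam * pair_area (6 * d) (fst p) (snd p))) \<partial>(lborel \<Otimes>\<^sub>M (lborel :: point measure)))"
proof -
  define F where "F q r = ennreal (exp (- lam * measure lborel
        (ball 0 (norm (c r) - d) \<union> ball (c q) (dist (c r) (c q) - 3 * d))))" for q r
  define G where "G p = ennreal (exp (- lam * pair_area (6 * d) (fst p) (snd p)))" for p :: "point \<times> point"
  note Q(1)[measurable]
  have bdd: "bounded (Q n)" for n
    by (rule bounded_subset[of "cball (c n) d"]) (use d in \<open>auto simp: dist_commute\<close>)
  have em: "ennreal (measure lborel (Q n)) = emeasure lborel (Q n)" for n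
    using emeasure_bounded_finite[OF bdd[of n]] by (simp add: emeasure_eq_ennreal_measure less_top)
  have FG: "F q r \<le> G (x, z)" if "x \<in> Q r" "z \<in> Q q" for q r x z
  proof -
    have xz: "dist x (c r) \<le> d" "dist z (c q) \<le> d" using d that by blast+
    have "norm x \<le> norm (c r) + dist x (c r)"
      using norm_triangle_ineq2[of x "c r"] by (simp add: dist_norm)
    moreover have "dist x z \<le> dist x (c r) + dist (c r) z" by (rule dist_triangle)
    moreover have "dist (c r) z \<le> dist (c r) (c q) + dist z (c q)" by (rule dist_triangle2)
    moreover have "dist y (c q) \<le> dist y z + dist z (c q)" for y by (rule dist_triangle)
    ultimately have "ball 0 (norm x - 6 * d) \<union> ball z (dist x z - 6 * d)
      \<subseteq> ball 0 (norm (c r) - d) \<union> ball (c q) (dist (c r) (c q) - 3 * d)"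
      using xz order_trans[OF zero_le_dist xz(1)] by (auto simp: dist_commute) (smt (verit) dist_commute)
    then have "measure lborel (ball 0 (norm x - 6 * d) \<union> ball z (dist x z - 6 * d))
      \<le> measure lborel (ball 0 (norm (c r) - d) \<union> ball (c q) (dist (c r) (c q) - 3 * d))"
      by (intro measure_mono_fmeasurable fmeasurableI emeasure_bounded_finite) auto
    then show ?thesis unfolding F_def G_def pair_area_def using lam by (simp add: ennreal_leI)
  qed
  have "(\<Sum>q. \<Sum>r. ennreal (mu * measure lborel (Q q)) *
      ennreal (lam * measure lborel (Q r) * exp (- lam * measure lborel
        (ball 0 (norm (c r) - d) \<union> ball (c q) (dist (c r) (c q) - 3 * d)))))
    = (\<Sum>q. \<Sum>r. ennreal (mu * lam) * (F q r * emeasure lborel (Q r) * emeasure lborel (Q q)))"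
    using lam mu unfolding F_def em[symmetric] by (simp add: mult_ac flip: ennreal_mult)
  also have "\<dots> = ennreal (mu * lam) * (\<Sum>q. \<Sum>r. F q r * emeasure lborel (Q r) * emeasure lborel (Q q))"
    by (simp only: ennreal_suminf_cmult)
  finally have start: "(\<Sum>q. \<Sum>r. ennreal (mu * measure lborel (Q q)) *
      ennreal (lam * measure lborel (Q r) * exp (- lam * measure lborel
        (ball 0 (norm (c r) - d) \<union> ball (c q) (dist (c r) (c q) - 3 * d)))))
    = ennreal (mu * lam) * (\<Sum>q. \<Sum>r. F q r * emeasure lborel (Q r) * emeasure lborel (Q q))" .
  have "(\<Sum>q. \<Sum>r. F q r * emeasure lborel (Q r) * emeasure lborel (Q q))
    = (\<Sum>q. \<Sum>r. \<integral>\<^sup>+p. F q r * indicator (Q r \<times> Q q) p \<partial>(lborel \<Otimes>\<^sub>M lborel))"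
    by (simp add: nn_integral_cmult_indicator lborel.emeasure_pair_measure_Times mult.assoc)
  also have "\<dots> = (\<integral>\<^sup>+p. (\<Sum>q. \<Sum>r. F q r * indicator (Q r \<times> Q q) p) \<partial>(lborel \<Otimes>\<^sub>M lborel))"
    by (simp add: nn_integral_suminf)
  also have "\<dots> \<le> (\<integral>\<^sup>+p. G p \<partial>(lborel \<Otimes>\<^sub>M lborel))"
  proof (rule nn_integral_mono)
    fix p :: "point \<times> point"
    obtain x z where p: "p = (x, z)" by (cases p)
    obtain r q where rq: "x \<in> Q r" "z \<in> Q q" using Q(3) by blast
    have "(\<Sum>r. F q' r * indicator (Q r \<times> Q q') p) = F q' r * indicator (Q q') z" for q'
    proof -
      have "(\<Sum>r. F q' r * indicator (Q r \<times> Q q') p) = (\<Sum>r. F q' r * indicator (Q q') z * indicator (Q r) x)"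
        by (simp add: p indicator_times mult_ac)
      also have "\<dots> = F q' r * indicator (Q q') z"
        by (rule suminf_cmult_indicator[OF Q(2) rq(1)])
      finally show ?thesis .
    qed
    then have "(\<Sum>q. \<Sum>r. F q r * indicator (Q r \<times> Q q) p) = F q r"
      using suminf_cmult_indicator[OF Q(2) rq(2), of "\<lambda>q. F q r"] by simp
    then show "(\<Sum>q. \<Sum>r. F q r * indicator (Q r \<times> Q q) p) \<le> G p" using FG[OF rq] by (simp add: p)
  qed
  finally have "(\<Sum>q. \<Sum>r. F q r * emeasure lborel (Q r) * emeasure lborel (Q q)) \<le> (\<integral>\<^sup>+p. G p \<partial>(lborel \<Otimes>\<^sub>M lborel))" .
  then show ?thesis unfolding start G_def by (intro mult_left_mono) simp_all
qed

section \<open>The limit of vanishing mesh width\<close>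

lemma nn_integral_gauss_plane:
  assumes "0 < c"
  shows "(\<integral>\<^sup>+z. ennreal (exp (- c * (dist x z)\<^sup>2)) \<partial>(lborel :: point measure)) = ennreal (pi / c)"
proof -
  have "(\<integral>\<^sup>+z. ennreal (exp (- c * (dist x z)\<^sup>2)) \<partial>(lborel :: point measure))
    = (\<integral>\<^sup>+z. ennreal (exp (- c * (dist x z)\<^sup>2)) \<partial>distr lborel borel ((+) x))"
    by (simp only: lborel_distr_plus)
  also have "\<dots> = (\<integral>\<^sup>+z. ennreal (exp (- c * (norm z)\<^sup>2)) \<partial>(lborel :: point measure))"
    by (subst nn_integral_distr) (simp_all add: dist_norm)
  also have "\<dots> = (\<integral>\<^sup>+z. ennreal (exp (- c * (norm z)\<^sup>2)) \<partial>distr lborel borel plane)"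
    by (simp only: distr_plane)
  also have "\<dots> = (\<integral>\<^sup>+z. ennreal (exp (- c * (norm z)\<^sup>2)) \<partial>(lborel :: complex measure))"
    by (subst nn_integral_distr) (simp_all add: norm_plane)
  also have "\<dots> = ennreal pi * (\<integral>\<^sup>+s. ennreal (exp (- c * s)) * indicator {0<..} s \<partial>lborel)"
    by (rule nn_integral_radial) measurable
  also have "\<dots> = ennreal (pi / c)"
    using assms by (simp only: nn_integral_exp_half_line(1)) (simp flip: ennreal_mult)
  finally show ?thesis .
qed

text \<open>The union is at least as large as the mean of the two discs, and
  \<open>(r - 1)^2 \<ge> r^2 / 2 - 1\<close>. This quadratic growth provides an integrable Gaussian
  majorant at \<open>e = 1\<close>.\<close>

lemma measure_disc_pair_ge:
  fixes x z :: point
  shows "pi / 4 * ((norm x)\<^sup>2 + (dist x z)\<^sup>2) - pi \<le> pair_area 1 x z"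
proof -
  have ball: "pi * (r\<^sup>2 / 2 - 1) \<le> measure lborel (ball a (r - 1))" if "0 \<le> r" for r and a :: point
  proof (cases "1 \<le> r")
    case True
    have "r\<^sup>2 / 2 - 1 \<le> (r - 1)\<^sup>2" using zero_le_power2[of "r - 2"] by (simp add: power2_eq_square algebra_simps)
    then have "pi * (r\<^sup>2 / 2 - 1) \<le> pi * (r - 1)\<^sup>2" by (intro mult_left_mono) auto
    then show ?thesis using True by (simp add: content_ball unit_ball_vol_2)
  next
    case False
    then have "r\<^sup>2 \<le> 1" using that by (simp add: power_le_one)
    then have "pi * (r\<^sup>2 / 2 - 1) \<le> 0" by (intro mult_nonneg_nonpos) auto
    then show ?thesis using measure_nonneg order_trans by blast
  qed
  have sub: "measure lborel (ball y r) \<le> pair_area 1 x z"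
    if "ball y r \<subseteq> ball 0 (norm x - 1) \<union> ball z (dist x z - 1)" for y r
    unfolding pair_area_def using that by (intro measure_mono_fmeasurable fmeasurableI emeasure_bounded_finite) auto
  show ?thesis
    using ball[of "norm x" 0] ball[of "dist x z" z] sub[of 0 "norm x - 1"] sub[of z "dist x z - 1"]
    by (simp add: algebra_simps)
qed

text \<open>Along \<open>e = 1 / (n + 1)\<close> the regions grow and the exponentials decrease.
  Dominated convergence applies with the function at \<open>e = 1\<close>, which is
  \<open>F 0\<close>; finiteness of \<open>K\<close> makes multiplication by it continuous.\<close>

lemma nn_integral_exp_union_limit:
  fixes lam :: real and C K :: ennreal
  assumes "0 < lam" and K: "K < \<infinity>"
    and bound: "\<And>e. 0 < e \<Longrightarrow> C \<le> K * (\<integral>\<^sup>+p. ennreal (exp (- lam * pair_area e (fst p) (snd p))) \<partial>(lborel \<Otimes>\<^sub>M (lborel :: point measure)))"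
  shows "C \<le> K * (\<integral>\<^sup>+p. ennreal (exp (- lam * pair_area 0 (fst p) (snd p))) \<partial>(lborel \<Otimes>\<^sub>M (lborel :: point measure)))"
proof -
  define D where "D e p = ball 0 (norm (fst p) - e) \<union> ball (snd p) (dist (fst p) (snd p) - e)" for e and p :: "point \<times> point"
  have pair_area: "pair_area e (fst p) (snd p) = measure lborel (D e p)" for e p
    by (simp add: pair_area_def D_def)
  define F where "F n p = ennreal (exp (- lam * pair_area (1 / real (Suc n)) (fst p) (snd p)))" for n and p :: "point \<times> point"
  define F0 where "F0 p = ennreal (exp (- lam * pair_area 0 (fst p) (snd p)))" for p :: "point \<times> point"
  have F_meas: "F n \<in> borel_measurable (lborel \<Otimes>\<^sub>M lborel)" for n
    unfolding F_def[abs_def] lborel_prod using measurable_pair_area by measurable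
  have mono: "pair_area (1 / real (Suc m)) (fst p) (snd p) \<le> pair_area (1 / real (Suc n)) (fst p) (snd p)" if "m \<le> n" for m n and p :: "point \<times> point"
    unfolding pair_area
  proof (intro measure_mono_fmeasurable fmeasurableI emeasure_bounded_finite)
    have "1 / real (Suc n) \<le> 1 / real (Suc m)" using that by (simp add: frac_le)
    then show "D (1 / real (Suc m)) p \<subseteq> D (1 / real (Suc n)) p" unfolding D_def by auto
  qed (auto simp: D_def)
  have dec: "decseq F"
  proof (intro monotoneI le_funI)
    fix m n :: nat and p assume "m \<le> n"
    from mult_left_mono[OF mono[OF this, of p], of lam] assms(1) show "F n p \<le> F m p"
      unfolding F_def by (intro ennreal_leI) simp
  qed
  have fin: "(\<integral>\<^sup>+p. F 0 p \<partial>(lborel \<Otimes>\<^sub>M lborel)) < \<infinity>"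
  proof -
    define c where "c = lam * pi / 4"
    have c: "0 < c" using assms(1) by (simp add: c_def)
    have "(\<integral>\<^sup>+p. F 0 p \<partial>(lborel \<Otimes>\<^sub>M lborel))
      \<le> (\<integral>\<^sup>+p. ennreal (exp (lam * pi)) * (ennreal (exp (- c * (dist 0 (fst p))\<^sup>2)) * ennreal (exp (- c * (dist (fst p) (snd p))\<^sup>2))) \<partial>(lborel \<Otimes>\<^sub>M (lborel :: point measure)))"
    proof (rule nn_integral_mono)
      fix p :: "point \<times> point"
      have "- lam * pair_area 1 (fst p) (snd p) \<le> - lam * (pi / 4 * ((norm (fst p))\<^sup>2 + (dist (fst p) (snd p))\<^sup>2) - pi)"
        using measure_disc_pair_ge[of "fst p" "snd p"] assms(1) by (intro mult_left_mono_neg) auto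
      then have "exp (- lam * pair_area 1 (fst p) (snd p)) \<le> exp (lam * pi) * (exp (- c * (norm (fst p))\<^sup>2) * exp (- c * (dist (fst p) (snd p))\<^sup>2))"
        by (simp add: c_def algebra_simps flip: exp_add)
      then show "F 0 p \<le> ennreal (exp (lam * pi)) * (ennreal (exp (- c * (dist 0 (fst p))\<^sup>2)) * ennreal (exp (- c * (dist (fst p) (snd p))\<^sup>2)))"
        by (simp add: F_def ennreal_leI flip: ennreal_mult)
    qed
    also have "\<dots> = ennreal (exp (lam * pi)) * (\<integral>\<^sup>+p. ennreal (exp (- c * (dist 0 (fst p))\<^sup>2)) * ennreal (exp (- c * (dist (fst p) (snd p))\<^sup>2)) \<partial>(lborel \<Otimes>\<^sub>M (lborel :: point measure)))"
      by (rule nn_integral_cmult) measurable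
    also have "(\<integral>\<^sup>+p. ennreal (exp (- c * (dist 0 (fst p))\<^sup>2)) * ennreal (exp (- c * (dist (fst p) (snd p))\<^sup>2)) \<partial>(lborel \<Otimes>\<^sub>M (lborel :: point measure)))
      = (\<integral>\<^sup>+x. \<integral>\<^sup>+z. ennreal (exp (- c * (dist 0 x)\<^sup>2)) * ennreal (exp (- c * (dist x z)\<^sup>2)) \<partial>lborel \<partial>(lborel :: point measure))"
      by (subst lborel.nn_integral_fst[symmetric]) simp_all
    also have "\<dots> = (\<integral>\<^sup>+x. ennreal (exp (- c * (dist 0 x)\<^sup>2)) * ennreal (pi / c) \<partial>(lborel :: point measure))"
      by (rule nn_integral_cong, subst nn_integral_cmult, measurable, simp only: nn_integral_gauss_plane[OF c])
    also have "\<dots> = ennreal (pi / c) * ennreal (pi / c)"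
      by (subst nn_integral_multc, measurable, simp only: nn_integral_gauss_plane[OF c])
    also have "ennreal (exp (lam * pi)) * \<dots> < \<infinity>"
      by (simp add: ennreal_mult_less_top)
    finally show ?thesis .
  qed
  have "C \<le> K * (\<integral>\<^sup>+p. F0 p \<partial>(lborel \<Otimes>\<^sub>M lborel))"
  proof (rule LIMSEQ_le_const)
    have "(\<lambda>n. \<integral>\<^sup>+p. F n p \<partial>(lborel \<Otimes>\<^sub>M lborel)) \<longlonglongrightarrow> (\<integral>\<^sup>+p. F0 p \<partial>(lborel \<Otimes>\<^sub>M lborel))"
    proof (rule nn_integral_dominated_convergence[where w = "F 0"])
      show "AE p in lborel \<Otimes>\<^sub>M lborel. (\<lambda>n. F n p) \<longlonglongrightarrow> F0 p"
      proof (rule AE_I2)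
        fix p :: "point \<times> point"
        \<comment> \<open>Since the balls are open, the shrunken ones exhaust them.\<close>
        have U: "(\<Union>n. D (1 / real (Suc n)) p) = D 0 p"
        proof -
          have "\<exists>n. t < r - 1 / real (Suc n)" if "t < r" for t r :: real
          proof -
            have "0 < r - t" using that by simp
            then obtain n where "inverse (real (Suc n)) < r - t" using reals_Archimedean by blast
            then show ?thesis by (intro exI[of _ n]) (simp add: inverse_eq_divide)
          qed
          moreover have "t < r" if "t < r - 1 / real (Suc n)" for t r :: real and n
          proof -
            have "0 < 1 / real (Suc n)" by simp
            with that show ?thesis by linarith
          qed
          ultimately have ex: "(\<exists>n. t < r - 1 / real (Suc n)) \<longleftrightarrow> t < r" for t r :: real by blast
          show ?thesis
            unfolding D_def set_eq_iff UN_iff Un_iff mem_ball bex_UNIV ex_disj_distrib ex diff_zero by simp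
        qed
        have "(\<lambda>n. pair_area (1 / real (Suc n)) (fst p) (snd p)) \<longlonglongrightarrow> measure lborel (\<Union>n. D (1 / real (Suc n)) p)"
          unfolding pair_area
        proof (rule Lim_measure_incseq)
          show "range (\<lambda>n. D (1 / real (Suc n)) p) \<subseteq> sets lborel" by (auto simp: D_def)
          show "incseq (\<lambda>n. D (1 / real (Suc n)) p)"
          proof (rule incseq_SucI)
            fix n
            have "1 / real (Suc (Suc n)) \<le> 1 / real (Suc n)" by (simp add: frac_le)
            then show "D (1 / real (Suc n)) p \<subseteq> D (1 / real (Suc (Suc n))) p" unfolding D_def by auto
          qed
          have "bounded (D 0 p)" by (simp add: D_def)
          then show "emeasure lborel (\<Union>n. D (1 / real (Suc n)) p) \<noteq> \<infinity>"
            unfolding U using emeasure_bounded_finite by force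
        qed
        then show "(\<lambda>n. F n p) \<longlonglongrightarrow> F0 p"
          unfolding U pair_area F_def F0_def by (intro tendsto_ennrealI tendsto_intros)
      qed
      show "AE p in lborel \<Otimes>\<^sub>M lborel. F n p \<le> F 0 p" for n
        by (intro AE_I2 le_funD[OF decseqD[OF dec]]) simp
      show "F0 \<in> borel_measurable (lborel \<Otimes>\<^sub>M lborel)"
        unfolding F0_def[abs_def] lborel_prod using measurable_pair_area[of 0] by measurable
    qed (use F_meas fin in auto)
    then show "(\<lambda>n. K * (\<integral>\<^sup>+p. F n p \<partial>(lborel \<Otimes>\<^sub>M lborel))) \<longlonglongrightarrow> K * (\<integral>\<^sup>+p. F0 p \<partial>(lborel \<Otimes>\<^sub>M lborel))"
      using K by (intro ennreal_tendsto_cmult) (simp_all add: less_top)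
    show "\<exists>N. \<forall>n\<ge>N. C \<le> K * (\<integral>\<^sup>+p. F n p \<partial>(lborel \<Otimes>\<^sub>M lborel))"
      unfolding F_def by (intro exI allI impI bound) simp
  qed
  then show ?thesis by (simp add: F0_def)
qed

theorem theorem6:
  fixes M :: "'w measure"
    and Phi_macro Phi_micro U_static :: "'w \<Rightarrow> point set"
    and lam_BS p P_macro P_micro beta lam_SU :: real
  assumes "prob_space M"
    and "lam_BS > 0" and "0 < p" and "p \<le> 1"
    and "P_macro > 0" and "P_micro \<ge> 0" and "beta > 2" and "lam_SU > 0"
    and "poisson_pp M (p * lam_BS) Phi_macro"
    and "poisson_pp M ((1 - p) * lam_BS) Phi_micro"
    and "poisson_pp M lam_SU U_static"
    and "indep_processes M (\<lambda>i::nat. [Phi_macro, Phi_micro, U_static] ! i) {0, 1, 2}"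
  shows "(\<integral>\<^sup>+ \<omega>. ecount (U_static \<omega> \<inter>
             het_cell (Phi_macro \<omega> \<union> Phi_micro \<omega>)
                      (\<lambda>x. if x \<in> Phi_macro \<omega> then P_macro else P_micro) beta
                      (nearest_to_origin (Phi_macro \<omega>))) \<partial>M)
         \<le> ennreal (1.2802 * lam_SU / (lam_BS * p))"
proof -
  interpret prob_space M by (fact assms(1))
  define lam where "lam = p * lam_BS"
  have lam: "0 < lam" using assms(2,3) by (simp add: lam_def)
  have Phi: "poisson_pp M lam Phi_macro" using assms(9) by (simp add: lam_def)
  define cell where "cell \<omega> = het_cell (Phi_macro \<omega> \<union> Phi_micro \<omega>)
      (\<lambda>x. if x \<in> Phi_macro \<omega> then P_macro else P_micro) beta (nearest_to_origin (Phi_macro \<omega>))" for \<omega>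
  have cell: "dist (nearest_to_origin (Phi_macro \<omega>)) z \<le> dist y z"
    if "z \<in> cell \<omega>" "nearest_to_origin (Phi_macro \<omega>) \<in> Phi_macro \<omega>" "y \<in> Phi_macro \<omega>" for \<omega> z y
    using that assms(5,7) unfolding cell_def by (intro het_cell_macro_closer[of z "Phi_macro \<omega>" "Phi_micro \<omega>" P_macro P_micro beta]) auto
  have indep: "prob (A \<inter> E) = prob A * prob E"
    if A: "A \<in> sigma_sets (space M) (proc_events M U_static)"
      and E: "E \<in> sigma_sets (space M) (proc_events M Phi_macro)" for A E
  proof -
    have "indep_sets (\<lambda>i. sigma_sets (space M) (proc_events M ([Phi_macro, Phi_micro, U_static] ! i))) {0, 1, 2}"
      using assms(12) by (simp only: indep_processes_def)
    from indep_setsD[OF this, of "{0, 2}" "\<lambda>i. if i = 0 then E else A"] A E show ?thesis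
      by (simp add: Int_commute mult.commute)
  qed
  define I where "I e = (\<integral>\<^sup>+p. ennreal (exp (- lam * pair_area e (fst p) (snd p))) \<partial>(lborel \<Otimes>\<^sub>M (lborel :: point measure)))" for e
  have "(\<integral>\<^sup>+\<omega>. ecount (U_static \<omega> \<inter> cell \<omega>) \<partial>M) \<le> ennreal (lam_SU * lam) * I e" if "0 < e" for e
  proof -
    \<comment> \<open>The integral bound loses six mesh widths, so the width is
      \<open>e / 6\<close>.\<close>
    have "0 < e / 6" using that by simp
    from ex_grid[OF this] obtain Q :: "nat \<Rightarrow> point set" where
      Q: "\<And>n. Q n \<in> sets borel" "disjoint_family Q" "(\<Union>n. Q n) = UNIV"
      and diam: "\<And>n x y. x \<in> Q n \<Longrightarrow> y \<in> Q n \<Longrightarrow> dist x y \<le> e / 6"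
      by blast
    \<comment> \<open>Any representative will do. An empty mesh cell gets an arbitrary point, for
      which the distance bound is vacuous.\<close>
    define c where "c n = (SOME x. x \<in> Q n)" for n
    have c: "dist x (c n) \<le> e / 6" if "x \<in> Q n" for n x
      unfolding c_def by (rule diam[OF that someI[of "\<lambda>x. x \<in> Q n", OF that]])
    have "(\<integral>\<^sup>+\<omega>. ecount (U_static \<omega> \<inter> cell \<omega>) \<partial>M)
      \<le> (\<Sum>q. \<Sum>r. ennreal (lam_SU * measure lborel (Q q)) *
      ennreal (lam * measure lborel (Q r) * exp (- lam * measure lborel
        (ball 0 (norm (c r) - e / 6) \<union> ball (c q) (dist (c r) (c q) - 3 * (e / 6))))))"
      by (rule mean_users_le_mesh[OF Phi assms(11) lam indep Q c cell])
    also have "\<dots> \<le> ennreal (lam_SU * lam) * I (6 * (e / 6))"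
      unfolding I_def using assms(8) by (intro mesh_sum_le_integral[OF lam _ Q c]) simp
    finally show ?thesis by simp
  qed
  then have "(\<integral>\<^sup>+\<omega>. ecount (U_static \<omega> \<inter> cell \<omega>) \<partial>M) \<le> ennreal (lam_SU * lam) *
    (\<integral>\<^sup>+p. ennreal (exp (- lam * pair_area 0 (fst p) (snd p))) \<partial>(lborel \<Otimes>\<^sub>M (lborel :: point measure)))"
    unfolding I_def by (intro nn_integral_exp_union_limit[OF lam]) auto
  also have "(\<integral>\<^sup>+p. ennreal (exp (- lam * pair_area 0 (fst p) (snd p))) \<partial>(lborel \<Otimes>\<^sub>M (lborel :: point measure)))
    = (\<integral>\<^sup>+x. \<integral>\<^sup>+z. ennreal (exp (- lam * pair_area 0 x z)) \<partial>lborel \<partial>(lborel :: point measure))"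
  proof -
    have "(\<lambda>p. ennreal (exp (- lam * pair_area 0 (fst p) (snd p))))
      \<in> borel_measurable (lborel \<Otimes>\<^sub>M (lborel :: point measure))"
      unfolding lborel_prod using measurable_pair_area[of 0] by measurable
    from lborel.nn_integral_fst[OF this] show ?thesis by simp
  qed
  also have "ennreal (lam_SU * lam) * \<dots> \<le> ennreal (lam_SU * lam) * ennreal (1.2802 / lam\<^sup>2)"
    by (intro mult_left_mono nn_integral_exp_union_plane lam) simp
  also have "\<dots> = ennreal (1.2802 * lam_SU / (lam_BS * p))"
    using lam assms(2,3,8) by (simp add: power2_eq_square lam_def field_simps flip: ennreal_mult)
  finally show ?thesis unfolding cell_def .
qed

end
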